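(* Let $a\in\mathbb{R}$, $I\in\mathbb{I}_{a+}$, $m\in\mathbb{N}^*$, $q_a\in\mathbb{R}^m$, $\alpha=(\alpha_i)\in(0,1]^m$, $A=(A_{ij})\in\mathrm{L}^\infty_{\mathrm{loc}}(I,\mathbb{R}^{m\times m})$ and $B=(B_i)\in\mathrm{L}^\infty_{\mathrm{loc}}(I,\mathbb{R}^m)$. Let $Z(\cdot,\cdot)$ be the left Riemann-Liouville state-transition matrix associated to $A$ and $\overline{\alpha}\in(0,1]^{m\times m}$. Then the non-homogeneous linear vector Cauchy problem $$\mathrm{D}^\alpha_{a+}[q](t)=A(t)\times q(t)+B(t),\qquad \mathrm{I}^{1-\alpha}_{a+}[q](a)=q_a$$ admits a unique (global) solution, denoted by $q$, and it is given by $$q(t)=Z(t,a)\times q_a+\int_a^t Z(t,s)\times B(s)\,ds$$ for almost every $t\in I$.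
   Context: $\mathbb{N}^*$ is the set of positive integers; $\times$ denotes the usual matrix-matrix or matrix-vector product and $\mathrm{Id}_m$ the identity matrix. For $a\in\mathbb{R}$, $\mathbb{I}_{a+}$ denotes the set of intervals $I\subset\mathbb{R}$ with $\{a\}\subsetneq I\subset[a,+\infty)$ (not necessarily compact). $\mathrm{L}^1_{\mathrm{loc}}(I)$, $\mathrm{L}^\infty_{\mathrm{loc}}(I)$, $\mathrm{AC}_{\mathrm{loc}}(I)$ are the sets of functions on $I$ that are respectively integrable, essentially bounded, absolutely continuous on every compact subinterval of $I$. Left Riemann-Liouville operators. Let $I\in\mathbb{I}_{a+}$ and $q\in \mathrm{L}^1_{\mathrm{loc}}(I,\mathbb{R})$. For a real $\alpha>0$, $\mathrm{I}^\alpha_{a+}[q](t):=\int_a^t\frac{1}{\Gamma(\alpha)}(t-\tau)^{\alpha-1}q(\tau)\,d\tau$ (defined for a.e. $t\in I$), and $\mathrm{I}^0_{a+}[q]:=q$; if $\mathrm{I}^\alpha_{a+}[q]$ is a.e. equal to a continuous function, it is identified with it. For $0\le\alpha\le1$, $\mathrm{AC}^\alpha_{a+}(I,\mathbb{R})$ is the set of $q\in \mathrm{L}^1_{\mathrm{loc}}(I,\mathbb{R})$ with $\mathrm{I}^{1-\alpha}_{a+}[q]\in\mathrm{AC}_{\mathrm{loc}}(I,\mathbb{R})$, and then $\mathrm{D}^\alpha_{a+}[q]:=\frac{d}{dt}\mathrm{I}^{1-\alpha}_{a+}[q]$ a.e. on $I$. For vector or matrix functions and a vector or matrix multi-order $\alpha$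 of the same size, everything is taken entrywise, each entry with the corresponding order. The same operators with base point $s$ instead of $a$ are denoted with the subscript $s+$. A (global) solution of the Cauchy problem in the claim is a function $q\in\mathrm{AC}^\alpha_{a+}(I,\mathbb{R}^m)$ with $\mathrm{I}^{1-\alpha}_{a+}[q](a)=q_a$ and satisfying the differential equation for a.e. $t\in I$ (functions equal a.e. are identified). For $\alpha=(\alpha_i)\in(0,1]^m$, $\overline{\alpha}\in(0,1]^{m\times m}$ is the row constant matrix with entries $\overline{\alpha}_{ij}=\alpha_i$. Left Riemann-Liouville state-transition matrix. Let $\beta=(\beta_{ij})\in(0,1]^{m\times m}$. For $s\in I$, $s<\sup I$, put $I^s:=I\cap[s,+\infty)$. The matrix Cauchy problem $\mathrm{D}^\beta_{s+}[Z](t)=A(t)\times Z(t)$ for a.e. $t\in I^s$, $\mathrm{I}^{1-\beta}_{s+}[Z](s)=\mathrm{Id}_m$, admits a unique (global) solution in $\mathrm{AC}^\beta_{s+}(I^s,\mathbb{R}^{m\times m})$, denoted by $Z(\cdot,s)$. The function $Z(\cdot,\cdot)$ is the left Riemann-Liouville state-transition matrix associated to $A$ and $\beta$. It satisfies $$Z(t,s)=\Big[\tfrac{1}{\Gamma(\beta)}(t-s)^{\beta-1}\Big]\otimes\mathrm{Id}_m+\int_s^t\Big[\tfrac{1}{\Gamma(\beta)}(t-\tau)^{\beta-1}\Big]\otimes\big[A(\tau)\times Z(\tau,s)\big]\,d\tau$$ for almost every $t,s\in I$ with $t>s$, where $\otimes$ is the Hadamard (entrywise) product and $\big[\frac{1}{\Gamma(\beta)}(t-\tau)^{\beta-1}\big]$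 is the matrix with entries $\frac{1}{\Gamma(\beta_{ij})}(t-\tau)^{\beta_{ij}-1}$. *)

theory Defs
  imports "HOL-Analysis.Analysis"
begin

section \<open>Intervals and local function spaces\<close>

definition intervals_from :: "real \<Rightarrow> real set set" where
  "intervals_from a = {I. is_interval I \<and> {a} \<subset> I \<and> I \<subseteq> {a..}}"

definition L1_loc :: "real set \<Rightarrow> (real \<Rightarrow> real) set" where
  "L1_loc I = {f. \<forall>c d. {c..d} \<subseteq> I \<longrightarrow> f absolutely_integrable_on {c..d}}"

definition Linf_loc :: "real set \<Rightarrow> (real \<Rightarrow> 'b::euclidean_space) set" where
  "Linf_loc I = {f. \<forall>c d. {c..d} \<subseteq> I \<longrightarrow>
     f \<in> borel_measurable (lebesgue_on {c..d}) \<and>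
     (\<exists>C. AE t in lebesgue_on {c..d}. norm (f t) \<le> C)}"

text \<open>Finite families of non-overlapping subintervals \<open>[u, v]\<close> are encoded as
  finite sets of endpoint pairs \<open>(u, v)\<close>.\<close>

definition abs_cont_on :: "real \<Rightarrow> real \<Rightarrow> (real \<Rightarrow> real) \<Rightarrow> bool" where
  "abs_cont_on c d f \<longleftrightarrow>
     (\<forall>\<epsilon>>0. \<exists>\<delta>>0. \<forall>P.
        finite P \<and> (\<forall>(u, v)\<in>P. c \<le> u \<and> u \<le> v \<and> v \<le> d) \<and>
        disjoint_family_on (\<lambda>(u, v). {u<..<v}) P \<and>
        (\<Sum>(u, v)\<in>P. v - u) < \<delta>
        \<longrightarrow> (\<Sum>(u, v)\<in>P. \<bar>f v - f u\<bar>) < \<epsilon>)"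

definition AC_loc :: "real set \<Rightarrow> (real \<Rightarrow> real) set" where
  "AC_loc I = {f. \<forall>c d. {c..d} \<subseteq> I \<longrightarrow> abs_cont_on c d f}"

section \<open>Left Riemann-Liouville operators\<close>

definition RL_integral_raw :: "real \<Rightarrow> real \<Rightarrow> (real \<Rightarrow> real) \<Rightarrow> real \<Rightarrow> real" where
  "RL_integral_raw a \<alpha> q t =
     (if \<alpha> = 0 then q t
      else (LINT \<tau>:{a..t}|lebesgue. 1 / Gamma \<alpha> * (t - \<tau>) powr (\<alpha> - 1) * q \<tau>))"

text \<open>The fractional integral is replaced by its continuous representative on \<open>I\<close> whenever
  there is one. As \<open>I\<close> is a non-degenerate interval, the values of that
  representative on \<open>I\<close>, including the one at the base point \<open>a\<close>, are uniquely determined.\<close>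

definition RL_integral :: "real \<Rightarrow> real set \<Rightarrow> real \<Rightarrow> (real \<Rightarrow> real) \<Rightarrow> real \<Rightarrow> real" where
  "RL_integral a I \<alpha> q =
     (if \<exists>g. continuous_on I g \<and> (AE t in lebesgue_on I. RL_integral_raw a \<alpha> q t = g t)
      then (SOME g. continuous_on I g \<and> (AE t in lebesgue_on I. RL_integral_raw a \<alpha> q t = g t))
      else RL_integral_raw a \<alpha> q)"

definition RL_AC :: "real \<Rightarrow> real set \<Rightarrow> real \<Rightarrow> (real \<Rightarrow> real) set" where
  "RL_AC a I \<alpha> = {q \<in> L1_loc I. RL_integral a I (1 - \<alpha>) q \<in> AC_loc I}"

text \<open>Only meaningful for almost every \<open>t \<in> I\<close>, when \<open>q \<in> RL_AC a I \<alpha>\<close>.\<close>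

definition RL_deriv :: "real \<Rightarrow> real set \<Rightarrow> real \<Rightarrow> (real \<Rightarrow> real) \<Rightarrow> real \<Rightarrow> real" where
  "RL_deriv a I \<alpha> q t = deriv (RL_integral a I (1 - \<alpha>) q) t"

section \<open>Linear Cauchy problems\<close>

definition RL_vector_solution ::
  "real \<Rightarrow> real set \<Rightarrow> real^'m \<Rightarrow> (real \<Rightarrow> real^'m^'m) \<Rightarrow> (real \<Rightarrow> real^'m) \<Rightarrow> real^'m \<Rightarrow>
   (real \<Rightarrow> real^'m) \<Rightarrow> bool" where
  "RL_vector_solution a I \<alpha> A B q\<^sub>a q \<longleftrightarrow>
     (\<forall>i. (\<lambda>t. q t $ i) \<in> RL_AC a I (\<alpha> $ i)) \<and>
     (AE t in lebesgue_on I. (\<chi> i. RL_deriv a I (\<alpha> $ i) (\<lambda>t. q t $ i) t) = A t *v q t + B t) \<and>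
     (\<chi> i. RL_integral a I (1 - \<alpha> $ i) (\<lambda>t. q t $ i) a) = q\<^sub>a"

definition RL_matrix_solution ::
  "real \<Rightarrow> real set \<Rightarrow> real^'m^'m \<Rightarrow> (real \<Rightarrow> real^'m^'m) \<Rightarrow> (real \<Rightarrow> real^'m^'m) \<Rightarrow> bool" where
  "RL_matrix_solution s I \<beta> A Z \<longleftrightarrow>
     (\<forall>i j. (\<lambda>t. Z t $ i $ j) \<in> RL_AC s I (\<beta> $ i $ j)) \<and>
     (AE t in lebesgue_on I.
        (\<chi> i j. RL_deriv s I (\<beta> $ i $ j) (\<lambda>t. Z t $ i $ j) t) = A t ** Z t) \<and>
     (\<chi> i j. RL_integral s I (1 - \<beta> $ i $ j) (\<lambda>t. Z t $ i $ j) s) = mat 1"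

section \<open>State-transition matrix\<close>

text \<open>For each fixed \<open>s\<close> the Cauchy problem determines \<open>\<lambda>t. Z t s\<close> only up to a null set depending
  on \<open>s\<close>, so integrals of \<open>Z t s\<close> over \<open>s\<close> are meaningful only if these representatives are chosen
  coherently. Joint measurability suffices: by Tonelli, two jointly measurable choices agree
  for almost every pair \<open>(t, s)\<close> with \<open>s < t\<close>.\<close>

definition is_RL_state_transition ::
  "real set \<Rightarrow> (real \<Rightarrow> real^'m^'m) \<Rightarrow> real^'m^'m \<Rightarrow> (real \<Rightarrow> real \<Rightarrow> real^'m^'m) \<Rightarrow> bool" where
  "is_RL_state_transition I A \<beta> Z \<longleftrightarrow>
     (\<forall>s\<in>I. (\<exists>r\<in>I. s < r) \<longrightarrow> RL_matrix_solution s (I \<inter> {s..}) \<beta> A (\<lambda>t. Z t s)) \<and>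
     (\<lambda>(t, s). Z t s) \<in> borel_measurable (lebesgue_on {(t, s). t \<in> I \<and> s \<in> I \<and> s < t})"

definition RL_state_transition ::
  "real set \<Rightarrow> (real \<Rightarrow> real^'m^'m) \<Rightarrow> real^'m^'m \<Rightarrow> real \<Rightarrow> real \<Rightarrow> real^'m^'m" where
  "RL_state_transition I A \<beta> = (SOME Z. is_RL_state_transition I A \<beta> Z)"

definition row_constant :: "real^'m \<Rightarrow> real^'m^'m" where
  "row_constant \<alpha> = (\<chi> i j. \<alpha> $ i)"

end

theory Submission
  imports Defs
begin

text \<open>By Radon-Nikodym, applied to the total variation, an absolutely continuous function is the
  indefinite integral of its almost everywhere derivative. Since the kernels
  \<open>k\<^sub>\<alpha> x = x\<^bsup>\<alpha>-1\<^esup> / \<Gamma>(\<alpha>)\<close> form a convolution semigroup (the Beta integral), convolving with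
  \<open>k\<^sub>\<alpha>\<close> and \<open>k\<^bsub>1-\<alpha>\<^esub>\<close> turns both Cauchy problems into Volterra equations
  \<open>q = k\<^sub>\<alpha>(\<cdot> - a) q\<^sub>a + k\<^sub>\<alpha> * (A q + B)\<close>. In \<open>L\<^sup>1\<close> with weight \<open>exp (- l t)\<close> the
  linear part is a contraction for large \<open>l\<close>, because the Laplace transform of \<open>k\<^sub>\<alpha>\<close> is
  \<open>l\<^bsup>-\<alpha>\<^esup>\<close>. This gives uniqueness, and convergence of the Picard series for each initial time
  \<open>s\<close>; the series is jointly Borel measurable, so it is a state-transition matrix and agrees with
  \<open>Z\<close> almost everywhere. The formula for \<open>q\<close> is then checked by exchanging the integrals
  over \<open>s\<close> and \<open>\<tau>\<close>.\<close>

text \<open>For \<alpha> < 1 the kernel is unbounded at 0, and the initial datum enters as a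
  multiple of the kernel itself. Convolutions of order below 1 converge at almost every time only,
  so each use of linearity or of Fubini has to be backed by a finiteness statement; from order 1 on
  they converge at every time. The rate \<open>l\<close> depends on the right end \<open>T\<close>
  but on no initial time, and this uniformity in \<open>s\<close> is what makes
  \<open>Z t s *v B s\<close> integrable in \<open>s\<close>. The other obstacle is null sets: for
  each \<open>s\<close> the matrix \<open>Z\<close> is known at almost every \<open>t\<close>,
  whereas the formula integrates over \<open>s\<close> at fixed \<open>t\<close>. With Borel data
  that vanish off the interval, exceptional sets are measurable in the plane, and Tonelli exchanges
  the two quantifiers. Row constancy gives all columns of \<open>Z\<close> the same orders, so that
  \<open>Z t s *v x\<close> solves the vector problem with initial datum \<open>x\<close>.\<close>

section \<open>Functions of bounded variation\<close>

text \<open>Unlike in \<^const>\<open>abs_cont_on\<close>, the intervals are nondegenerate: families living in disjoint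
  intervals are then disjoint as sets of pairs, so sums over their union split.\<close>

definition interval_fams :: "real \<Rightarrow> real \<Rightarrow> (real \<times> real) set set" where
  "interval_fams c d = {P. finite P \<and> (\<forall>(u, v)\<in>P. c \<le> u \<and> u < v \<and> v \<le> d) \<and>
     disjoint_family_on (\<lambda>(u, v). {u<..<v}) P}"

definition fam_length :: "(real \<times> real) set \<Rightarrow> real" where
  "fam_length P = (\<Sum>(u, v)\<in>P. v - u)"

lemma fam_eqI:
  assumes "P \<in> interval_fams c d" "(u, v) \<in> P" "(u', v') \<in> P" "u < z" "z < v" "u' < z" "z < v'"
  shows "(u, v) = (u', v')"
proof (rule ccontr)
  assume "(u, v) \<noteq> (u', v')"
  then have "(case (u, v) of (u, v) \<Rightarrow> {u<..<v}) \<inter> (case (u', v') of (u, v) \<Rightarrow> {u<..<v}) = {}"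
    using assms(1-3) unfolding interval_fams_def disjoint_family_on_def by blast
  then show False using assms(4-) by auto
qed

lemma famD:
  assumes "P \<in> interval_fams c d"
  shows "finite P" "\<And>u v. (u, v) \<in> P \<Longrightarrow> c \<le> u \<and> u < v \<and> v \<le> d"
  using assms by (auto simp: interval_fams_def)

lemma famI:
  assumes "finite P" "\<And>u v. (u, v) \<in> P \<Longrightarrow> c \<le> u \<and> u < v \<and> v \<le> d"
    and "\<And>u v u' v' z. (u, v) \<in> P \<Longrightarrow> (u', v') \<in> P \<Longrightarrow> u < z \<Longrightarrow> z < v \<Longrightarrow> u' < z \<Longrightarrow> z < v' \<Longrightarrow>
      (u, v) = (u', v')"
  shows "P \<in> interval_fams c d"
  using assms unfolding interval_fams_def disjoint_family_on_def by fastforce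

lemma fam_mono: "c' \<le> c \<Longrightarrow> d \<le> d' \<Longrightarrow> interval_fams c d \<subseteq> interval_fams c' d'"
  by (fastforce simp: interval_fams_def)

text \<open>The lengths are Lebesgue measures of disjoint open intervals, so they add up to the
  measure of a subset of \<open>{u..v}\<close>.\<close>

lemma fam_length_le:
  assumes P: "P \<in> interval_fams u v" and "u \<le> v"
  shows "fam_length P \<le> v - u"
proof -
  have "fam_length P = (\<Sum>p\<in>P. measure lborel {fst p<..<snd p})"
    unfolding fam_length_def using famD[OF P] by (intro sum.cong) (auto simp: less_imp_le)
  also have "\<dots> = measure lborel (\<Union>p\<in>P. {fst p<..<snd p})"
  proof (intro measure_finite_Union[symmetric])
    show "disjoint_family_on (\<lambda>p. {fst p<..<snd p}) P" using P by (simp add: interval_fams_def case_prod_unfold)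
    show "emeasure lborel {fst p<..<snd p} \<noteq> \<infinity>" if "p \<in> P" for p
      using famD(2)[OF P, of "fst p" "snd p"] that by (simp add: emeasure_lborel_Ioo)
  qed (use famD(1)[OF P] in auto)
  also have "\<dots> \<le> measure lborel {u..v}"
  proof (intro measure_mono_fmeasurable)
    show "(\<Union>p\<in>P. {fst p<..<snd p}) \<subseteq> {u..v}"
      using famD(2)[OF P] by fastforce
  qed (use famD(1)[OF P] in \<open>auto simp: fmeasurable_def emeasure_lborel_Icc_eq\<close>)
  finally show ?thesis using \<open>u \<le> v\<close> by simp
qed

section \<open>Variation over a family, and total variation\<close>

definition fam_var :: "(real \<Rightarrow> real) \<Rightarrow> (real \<times> real) set \<Rightarrow> real" where
  "fam_var g P = (\<Sum>(u, v)\<in>P. \<bar>g v - g u\<bar>)"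

text \<open>Intervals that straddle \<open>u\<close> are cut there; by the triangle inequality this
  can only raise the variation.\<close>

lemma fam_var_split:
  assumes P: "P \<in> interval_fams c v" and u: "c \<le> u" "u \<le> v"
  shows "\<exists>P1\<in>interval_fams c u. \<exists>P2\<in>interval_fams u v. fam_var g P \<le> fam_var g P1 + fam_var g P2"
proof -
  note PD = famD[OF P]
  \<comment> \<open>\<open>f1\<close> and \<open>f2\<close> keep the parts of an interval to the
    left and to the right of \<open>u\<close>; \<open>Q1\<close> and \<open>Q2\<close> select the
    intervals for which that part is nondegenerate.\<close>
  define Q1 where "Q1 = {p\<in>P. fst p < u}"
  define Q2 where "Q2 = {p\<in>P. u < snd p}"
  define f1 where "f1 = (\<lambda>p::real\<times>real. (fst p, min (snd p) u))"
  define f2 where "f2 = (\<lambda>p::real\<times>real. (max (fst p) u, snd p))"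
  have eq: "p = p'" if "p \<in> P" "p' \<in> P" "fst p < z" "z < snd p" "fst p' < z" "z < snd p'" for p p' z
    using fam_eqI[OF P, of "fst p" "snd p" "fst p'" "snd p'" z] that by simp
  have fin: "finite Q1" "finite Q2" using PD by (auto simp: Q1_def Q2_def)
  \<comment> \<open>Clipped intervals with a common left end overlap, hence come from the same
    interval of \<open>P\<close>; this lets the sums be reindexed.\<close>
  have inj1: "inj_on f1 Q1"
  proof (rule inj_onI)
    fix p p' assume *: "p \<in> Q1" "p' \<in> Q1" "f1 p = f1 p'"
    with PD(2)[of "fst p" "snd p"] PD(2)[of "fst p'" "snd p'"]
    have **: "fst p < snd p" "fst p' < snd p'" "fst p = fst p'" by (auto simp: f1_def Q1_def)
    obtain z where "fst p < z" "z < min (snd p) (snd p')" using dense[of "fst p" "min (snd p) (snd p')"] ** by auto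
    then show "p = p'" using * ** by (intro eq[of p p' z]) (auto simp: Q1_def)
  qed
  have inj2: "inj_on f2 Q2"
  proof (rule inj_onI)
    fix p p' assume *: "p \<in> Q2" "p' \<in> Q2" "f2 p = f2 p'"
    with PD(2)[of "fst p" "snd p"] PD(2)[of "fst p'" "snd p'"]
    have **: "fst p < snd p" "fst p' < snd p'" "snd p = snd p'" by (auto simp: f2_def Q2_def)
    obtain z where "max (fst p) (fst p') < z" "z < snd p" using dense[of "max (fst p) (fst p')" "snd p"] ** by auto
    then show "p = p'" using * ** by (intro eq[of p p' z]) (auto simp: Q2_def)
  qed
  have 1: "f1 ` Q1 \<in> interval_fams c u"
  proof (rule famI)
    fix x y assume "(x, y) \<in> f1 ` Q1"
    then show "c \<le> x \<and> x < y \<and> y \<le> u" using PD by (auto simp: f1_def Q1_def)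
  next
    fix x y x' y' z assume *: "(x, y) \<in> f1 ` Q1" "(x', y') \<in> f1 ` Q1" "x < z" "z < y" "x' < z" "z < y'"
    then obtain p p' where "p \<in> P" "p' \<in> P" "(x, y) = f1 p" "(x', y') = f1 p'" by (auto simp: Q1_def)
    then show "(x, y) = (x', y')" using eq[of p p' z] * by (auto simp: f1_def)
  qed (use fin in auto)
  have 2: "f2 ` Q2 \<in> interval_fams u v"
  proof (rule famI)
    fix x y assume "(x, y) \<in> f2 ` Q2"
    then show "u \<le> x \<and> x < y \<and> y \<le> v" using PD by (auto simp: f2_def Q2_def)
  next
    fix x y x' y' z assume *: "(x, y) \<in> f2 ` Q2" "(x', y') \<in> f2 ` Q2" "x < z" "z < y" "x' < z" "z < y'"
    then obtain p p' where "p \<in> P" "p' \<in> P" "(x, y) = f2 p" "(x', y') = f2 p'" by (auto simp: Q2_def)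
    then show "(x, y) = (x', y')" using eq[of p p' z] * by (auto simp: f2_def)
  qed (use fin in auto)
  have "fam_var g P \<le> (\<Sum>p\<in>P. (if fst p < u then \<bar>g (min (snd p) u) - g (fst p)\<bar> else 0)
      + (if u < snd p then \<bar>g (snd p) - g (max (fst p) u)\<bar> else 0))"
    unfolding fam_var_def
  proof (intro sum_mono)
    fix p assume "p \<in> P"
    then have "fst p < snd p" using PD(2)[of "fst p" "snd p"] by auto
    then show "(case p of (u, v) \<Rightarrow> \<bar>g v - g u\<bar>) \<le> (if fst p < u then \<bar>g (min (snd p) u) - g (fst p)\<bar> else 0)
      + (if u < snd p then \<bar>g (snd p) - g (max (fst p) u)\<bar> else 0)"
      by (auto simp: case_prod_unfold min_def max_def)
  qed
  also have "\<dots> = (\<Sum>p\<in>Q1. \<bar>g (min (snd p) u) - g (fst p)\<bar>) + (\<Sum>p\<in>Q2. \<bar>g (snd p) - g (max (fst p) u)\<bar>)"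
    using PD by (simp add: sum.distrib Q1_def Q2_def sum.inter_filter)
  also have "\<dots> = fam_var g (f1 ` Q1) + fam_var g (f2 ` Q2)"
    unfolding fam_var_def sum.reindex[OF inj1] sum.reindex[OF inj2] by (simp add: f1_def f2_def)
  finally show ?thesis using 1 2 by blast
qed

text \<open>A supremum of reals, hence meaningful only under a bound on the variations, which the
  context below supplies.\<close>

definition total_var :: "(real \<Rightarrow> real) \<Rightarrow> real \<Rightarrow> real \<Rightarrow> real" where
  "total_var g u v = Sup (fam_var g ` interval_fams u v)"

lemma interval_fams_empty: "{} \<in> interval_fams u v" by (simp add: interval_fams_def disjoint_family_on_def)

context
  fixes g :: "real \<Rightarrow> real" and c d K :: real
  assumes bv: "\<And>P. P \<in> interval_fams c d \<Longrightarrow> fam_var g P \<le> K"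
begin

lemma fam_bdd: "c \<le> u \<Longrightarrow> v \<le> d \<Longrightarrow> bdd_above (fam_var g ` interval_fams u v)"
  using bv fam_mono[of c u v d] by (intro bdd_aboveI[of _ K]) auto

lemma fam_var_le: "c \<le> u \<Longrightarrow> v \<le> d \<Longrightarrow> P \<in> interval_fams u v \<Longrightarrow> fam_var g P \<le> total_var g u v"
  unfolding total_var_def using fam_bdd by (intro cSup_upper) auto

text \<open>Any family in \<open>{c..u}\<close> can be enlarged by the interval from
  \<open>u\<close> to \<open>v\<close>. This one inequality makes both the total variation and its
  difference with \<open>g\<close> monotone.\<close>

lemma total_var_ge_diff:
  assumes "c \<le> u" "u \<le> v" "v \<le> d"
  shows "total_var g c u + \<bar>g v - g u\<bar> \<le> total_var g c v"
proof (cases "u = v")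
  case False
  have "total_var g c u \<le> total_var g c v - \<bar>g v - g u\<bar>"
    unfolding total_var_def[of g c u]
  proof (rule cSup_least)
    fix x assume "x \<in> fam_var g ` interval_fams c u"
    then obtain P where P: "P \<in> interval_fams c u" "x = fam_var g P" by auto
    note PD = famD[OF P(1)]
    have notin: "(u, v) \<notin> P" using PD(2)[of u v] assms False by auto
    have "insert (u, v) P \<in> interval_fams c v"
    proof (rule famI)
      fix x y x' y' z
      assume "(x, y) \<in> insert (u, v) P" "(x', y') \<in> insert (u, v) P" "x < z" "z < y" "x' < z" "z < y'"
      then show "(x, y) = (x', y')"
        using fam_eqI[OF P(1)] PD(2)[of x y] PD(2)[of x' y'] by auto
    qed (use PD assms False in \<open>auto, fastforce\<close>)
    then have "fam_var g (insert (u, v) P) \<le> total_var g c v" using assms by (intro fam_var_le) auto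
    moreover have "fam_var g (insert (u, v) P) = \<bar>g v - g u\<bar> + fam_var g P"
      unfolding fam_var_def using notin PD by simp
    ultimately show "x \<le> total_var g c v - \<bar>g v - g u\<bar>" using P by simp
  qed (use interval_fams_empty in auto)
  then show ?thesis by simp
qed auto

text \<open>The half of additivity that needs cutting at \<open>u\<close>; it bounds the increments
  of the variation from above.\<close>

lemma total_var_diff_le:
  assumes "c \<le> u" "u \<le> v" "v \<le> d"
  shows "total_var g c v - total_var g c u \<le> total_var g u v"
proof -
  have "total_var g c v \<le> total_var g c u + total_var g u v"
    unfolding total_var_def[of g c v]
  proof (rule cSup_least)
    fix x assume "x \<in> fam_var g ` interval_fams c v"
    then obtain P where P: "P \<in> interval_fams c v" "x = fam_var g P" by auto
    obtain P1 P2 where "P1 \<in> interval_fams c u" "P2 \<in> interval_fams u v" "fam_var g P \<le> fam_var g P1 + fam_var g P2"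
      using fam_var_split[OF P(1) assms(1,2)] by blast
    with fam_var_le[of c u P1] fam_var_le[of u v P2] assms P show "x \<le> total_var g c u + total_var g u v" by auto
  qed (use interval_fams_empty in auto)
  then show ?thesis by simp
qed

text \<open>The modulus of absolute continuity of \<open>g\<close> carries over to its variation:
  filling each interval of \<open>P\<close> with a nearly optimal family yields one family of no
  greater total length, to which the hypothesis applies.\<close>

lemma total_var_sum_le:
  assumes \<delta>: "\<And>P. P \<in> interval_fams c d \<Longrightarrow> fam_length P < \<delta> \<Longrightarrow> fam_var g P \<le> e"
    and P: "P \<in> interval_fams c d" "fam_length P < \<delta>"
  shows "(\<Sum>(u, v)\<in>P. total_var g u v) \<le> e"
proof (rule field_le_epsilon)
  fix \<eta> :: real assume "0 < \<eta>"
  \<comment> \<open>An error of \<open>\<kappa>\<close> per interval adds up to at most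
    \<open>\<eta>\<close>; the added 1 covers an empty \<open>P\<close>.\<close>
  define \<kappa> where "\<kappa> = \<eta> / (card P + 1)"
  have \<kappa>: "\<kappa> > 0" using \<open>0 < \<eta>\<close> by (simp add: \<kappa>_def)
  note PD = famD[OF P(1)]
  have "\<exists>Q\<in>interval_fams (fst p) (snd p). total_var g (fst p) (snd p) - \<kappa> < fam_var g Q" for p
    using less_cSupD[of "fam_var g ` interval_fams (fst p) (snd p)" "total_var g (fst p) (snd p) - \<kappa>"] interval_fams_empty \<kappa>
    by (auto simp: total_var_def)
  then obtain Q where Q: "\<And>p. Q p \<in> interval_fams (fst p) (snd p)"
    "\<And>p. total_var g (fst p) (snd p) - \<kappa> < fam_var g (Q p)" by metis
  have QD: "fst p \<le> x \<and> x < y \<and> y \<le> snd p" if "(x, y) \<in> Q p" for x y p using famD(2)[OF Q(1) that] .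
  have PQ: "p = p'" if "(x, y) \<in> Q p" "(x', y') \<in> Q p'" "x < z" "z < y" "x' < z" "z < y'" "p \<in> P" "p' \<in> P"
    for x y x' y' z p p'
    using fam_eqI[OF P(1), of "fst p" "snd p" "fst p'" "snd p'" z] QD[OF that(1)] QD[OF that(2)] that by simp
  \<comment> \<open>Intervals are nondegenerate, so a pair shared by \<open>Q p\<close> and
    \<open>Q p'\<close> would have an interior point lying in two different intervals of
    \<open>P\<close>.\<close>
  have disj: "\<forall>p\<in>P. \<forall>p'\<in>P. p \<noteq> p' \<longrightarrow> Q p \<inter> Q p' = {}"
  proof (intro ballI impI, rule ccontr)
    fix p p' assume *: "p \<in> P" "p' \<in> P" "p \<noteq> p'" "Q p \<inter> Q p' \<noteq> {}"
    then obtain x y where xy: "(x, y) \<in> Q p" "(x, y) \<in> Q p'" by auto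
    then obtain z where "x < z" "z < y" using QD[of x y p] dense by blast
    with PQ[OF xy(1) xy(2)] * show False by blast
  qed
  have U: "(\<Union>p\<in>P. Q p) \<in> interval_fams c d"
  proof (rule famI)
    show "finite (\<Union>p\<in>P. Q p)" using PD famD(1)[OF Q(1)] by auto
    fix x y assume "(x, y) \<in> (\<Union>p\<in>P. Q p)"
    then show "c \<le> x \<and> x < y \<and> y \<le> d" using PD(2) QD by fastforce
  next
    fix x y x' y' z
    assume *: "(x, y) \<in> (\<Union>p\<in>P. Q p)" "(x', y') \<in> (\<Union>p\<in>P. Q p)" "x < z" "z < y" "x' < z" "z < y'"
    then obtain p p' where p: "p \<in> P" "p' \<in> P" "(x, y) \<in> Q p" "(x', y') \<in> Q p'" by blast
    with PQ[OF p(3,4)] * have "p = p'" by blast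
    with fam_eqI[OF Q(1)[of p]] p * show "(x, y) = (x', y')" by blast
  qed
  have "fam_length (\<Union>p\<in>P. Q p) = (\<Sum>p\<in>P. fam_length (Q p))"
    unfolding fam_length_def using PD famD(1)[OF Q(1)] disj by (intro sum.UNION_disjoint) auto
  also have "\<dots> \<le> (\<Sum>p\<in>P. snd p - fst p)"
    using PD Q by (intro sum_mono fam_length_le) (auto, fastforce)
  also have "\<dots> < \<delta>" using P by (simp add: fam_length_def case_prod_unfold)
  finally have "fam_var g (\<Union>p\<in>P. Q p) \<le> e" using \<delta> U by blast
  moreover have "fam_var g (\<Union>p\<in>P. Q p) = (\<Sum>p\<in>P. fam_var g (Q p))"
    unfolding fam_var_def using PD famD(1)[OF Q(1)] disj by (intro sum.UNION_disjoint) auto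
  moreover have "(\<Sum>p\<in>P. total_var g (fst p) (snd p)) \<le> (\<Sum>p\<in>P. fam_var g (Q p) + \<kappa>)"
    using Q(2) by (intro sum_mono) (smt (verit))
  moreover have "(\<Sum>p\<in>P. fam_var g (Q p) + \<kappa>) \<le> (\<Sum>p\<in>P. fam_var g (Q p)) + \<eta>"
  proof -
    have "real (card P) * \<kappa> \<le> \<eta>" using \<open>0 < \<eta>\<close> by (simp add: \<kappa>_def field_simps)
    then show ?thesis by (simp add: sum.distrib)
  qed
  ultimately show "(\<Sum>(u, v)\<in>P. total_var g u v) \<le> e + \<eta>" by (simp add: case_prod_unfold)
qed

end

section \<open>Monotone functions: a density from the Stieltjes measure\<close>

lemma open_interval_Inf_Sup:
  fixes C :: "real set"
  assumes "open C" "connected C" "bounded C" "C \<noteq> {}"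
  shows "x \<in> C \<longleftrightarrow> Inf C < x \<and> x < Sup C" "Inf C < Sup C"
proof -
  have bdd: "bdd_above C" "bdd_below C" using assms bounded_imp_bdd_above bounded_imp_bdd_below by auto
  have strict: "Inf C < x \<and> x < Sup C" if x: "x \<in> C" for x
  proof -
    obtain e where e: "e > 0" "ball x e \<subseteq> C" using openE[OF assms(1) x] .
    then have "x - e/2 \<in> C" "x + e/2 \<in> C" by (auto simp: subset_iff dist_real_def)
    then have "Inf C \<le> x - e/2" "x + e/2 \<le> Sup C" using bdd by (auto intro: cInf_lower cSup_upper)
    with e show ?thesis by auto
  qed
  show "x \<in> C \<longleftrightarrow> Inf C < x \<and> x < Sup C"
  proof
    assume "Inf C < x \<and> x < Sup C"
    then obtain y z where "y \<in> C" "z \<in> C" "y < x" "x < z"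
      using cInf_less_iff[of C x] less_cSup_iff[of C x] bdd assms by auto
    with assms(2) show "x \<in> C" unfolding connected_iff_interval by (meson less_imp_le)
  qed (use strict in auto)
  show "Inf C < Sup C" using assms(4) strict less_trans by blast
qed

text \<open>Absolute continuity in the form used internally. The bound is nonstrict so that it
  survives suprema over families and monotone limits of measures.\<close>

definition small_increments :: "real \<Rightarrow> real \<Rightarrow> (real \<Rightarrow> real) \<Rightarrow> bool" where
  "small_increments c d F \<longleftrightarrow>
    (\<forall>e>0. \<exists>\<delta>>0. \<forall>P\<in>interval_fams c d. fam_length P < \<delta> \<longrightarrow> fam_var F P \<le> e)"

lemma small_increments_continuous:
  assumes "small_increments c d F"
  shows "continuous_on {c..d} F"
  unfolding continuous_on_iff
proof (intro ballI allI impI)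
  fix x e :: real assume x: "x \<in> {c..d}" and e: "0 < e"
  then obtain \<delta> where \<delta>: "\<delta> > 0" "\<And>P. P \<in> interval_fams c d \<Longrightarrow> fam_length P < \<delta> \<Longrightarrow> fam_var F P \<le> e/2"
    using assms unfolding small_increments_def by (metis half_gt_zero)
  have *: "\<bar>F v - F u\<bar> < e" if "u \<in> {c..d}" "v \<in> {c..d}" "u < v" "v - u < \<delta>" for u v
  proof -
    have "{(u, v)} \<in> interval_fams c d" using that by (intro famI) auto
    from \<delta>(2)[OF this] show ?thesis using that e by (simp add: fam_length_def fam_var_def)
  qed
  show "\<exists>r>0. \<forall>y\<in>{c..d}. dist y x < r \<longrightarrow> dist (F y) (F x) < e"
  proof (intro exI[of _ \<delta>] conjI ballI impI \<delta>(1))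
    fix y assume y: "y \<in> {c..d}" "dist y x < \<delta>"
    show "dist (F y) (F x) < e"
      using *[of x y] *[of y x] x y e by (cases x y rule: linorder_cases) (auto simp: dist_real_def)
  qed
qed

text \<open>The components of \<open>U\<close> are disjoint open intervals, so every finite set of
  them is a family to which the modulus applies; the whole of \<open>U\<close> follows by continuity
  of the measure from below.\<close>

lemma interval_measure_open_small:
  fixes F :: "real \<Rightarrow> real"
  assumes mono: "\<And>x y. x \<le> y \<Longrightarrow> F x \<le> F y" and cont: "continuous_on UNIV F"
    and \<delta>: "\<And>P. P \<in> interval_fams c d \<Longrightarrow> fam_length P < \<delta> \<Longrightarrow> fam_var F P \<le> e"
    and U: "open U" "U \<subseteq> {c<..<d}" "emeasure lborel U < ennreal \<delta>" and "0 \<le> e"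
  shows "emeasure (interval_measure F) U \<le> ennreal e"
proof (cases "U = {}")
  case False
  let ?M = "interval_measure F"
  have rc: "continuous (at_right x) F" for x
    using cont by (meson UNIV_I continuous_on_eq_continuous_at continuous_at_imp_continuous_at_within open_UNIV)
  define D where "D = components U"
  have Dne: "D \<noteq> {}" using False by (simp add: D_def)
  have disj: "C \<inter> C' = {}" if "C \<in> D" "C' \<in> D" "C \<noteq> C'" for C C'
    using that pairwise_disjoint_components[of U] by (auto simp: D_def pairwise_def)
  have op: "open C" if "C \<in> D" for C using that U(1) open_components D_def by blast
  have Csub: "C \<subseteq> U" if "C \<in> D" for C using that D_def in_components_subset by blast
  have Cne: "C \<noteq> {}" if "C \<in> D" for C using that D_def in_components_nonempty by blast
  have bU: "bounded U" using U(2) bounded_subset[of "box c d" U] by simp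
  have int: "x \<in> C \<longleftrightarrow> Inf C < x \<and> x < Sup C" "Inf C < Sup C" if "C \<in> D" for C x
    using open_interval_Inf_Sup[of C] op[OF that] Cne[OF that] bounded_subset[OF bU Csub[OF that]]
      in_components_connected[of C U] that by (auto simp: D_def)
  have "countable D"
    by (rule countable_disjoint_open_subsets) (use op disj in \<open>auto simp: disjnt_def pairwise_def\<close>)
  \<comment> \<open>Finite sets of components that increase to \<open>D\<close>; repetitions in the
    enumeration of a finite \<open>D\<close> do no harm.\<close>
  define E where "E = (\<lambda>n::nat. from_nat_into D ` {..<n})"
  have ED: "E n \<subseteq> D" for n using from_nat_into[OF Dne] by (auto simp: E_def)
  have fin: "emeasure ?M (\<Union>(E n)) \<le> ennreal e" for n
  proof -
    define f where "f = (\<lambda>C::real set. (Inf C, Sup C))"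
    have inj: "inj_on f (E n)"
    proof (rule inj_onI)
      fix C C' assume *: "C \<in> E n" "C' \<in> E n" "f C = f C'"
      then have C: "C \<in> D" "C' \<in> D" using ED by auto
      have "x \<in> C \<longleftrightarrow> x \<in> C'" for x unfolding int(1)[OF C(1)] int(1)[OF C(2)] using * by (simp add: f_def)
      then show "C = C'" by blast
    qed
    have "f ` E n \<in> interval_fams c d"
    proof (rule famI)
      show "finite (f ` E n)" by (simp add: E_def)
      fix u v assume "(u, v) \<in> f ` E n"
      then obtain C where C: "C \<in> D" "u = Inf C" "v = Sup C" using ED by (auto simp: f_def)
      with int[OF C(1)] Csub[OF C(1)] U(2) have "{u<..<v} \<subseteq> {c<..<d}" "u < v"
        by (simp_all add: subset_iff)
      then show "c \<le> u \<and> u < v \<and> v \<le> d" using greaterThanLessThan_subseteq_greaterThanLessThan by blast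
    next
      fix x y x' y' z
      assume *: "(x, y) \<in> f ` E n" "(x', y') \<in> f ` E n" "x < z" "z < y" "x' < z" "z < y'"
      then obtain C C' where C: "C \<in> D" "(x, y) = f C" "C' \<in> D" "(x', y') = f C'" using ED by blast
      then have "z \<in> C" "z \<in> C'" using int[OF C(1)] int[OF C(3)] * by (auto simp: f_def)
      then show "(x, y) = (x', y')" using disj[of C C'] C by auto
    qed
    moreover have "fam_length (f ` E n) < \<delta>"
    proof -
      have "ennreal (fam_length (f ` E n)) = (\<Sum>C\<in>E n. ennreal (Sup C - Inf C))"
        unfolding fam_length_def sum.reindex[OF inj] using ED int(2)
        by (subst sum_ennreal) (auto simp: f_def subset_iff less_imp_le)
      also have "\<dots> = (\<Sum>C\<in>E n. emeasure lborel C)"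
      proof (rule sum.cong[OF refl])
        fix C assume "C \<in> E n"
        then have C: "C \<in> D" using ED by auto
        have "emeasure lborel C = emeasure lborel {Inf C<..<Sup C}"
          by (rule arg_cong[where f="emeasure lborel"], rule set_eqI) (simp only: greaterThanLessThan_iff int(1)[OF C])
        then show "ennreal (Sup C - Inf C) = emeasure lborel C" using int(2)[OF C] by simp
      qed
      also have "\<dots> = emeasure lborel (\<Union>C\<in>E n. C)"
      proof (rule sum_emeasure)
        show "disjoint_family_on (\<lambda>C. C) (E n)" using disj ED by (auto simp: disjoint_family_on_def subset_iff)
        show "(\<lambda>C. C) ` E n \<subseteq> sets lborel" using op ED by (auto simp: subset_iff)
      qed (simp add: E_def)
      also have "\<dots> \<le> emeasure lborel U" using Csub ED U(1) by (intro emeasure_mono) auto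
      also have "\<dots> < ennreal \<delta>" by fact
      finally show ?thesis by (metis ennreal_leI linorder_not_le)
    qed
    ultimately have "fam_var F (f ` E n) \<le> e" by (rule \<delta>)
    moreover have "emeasure ?M (\<Union>(E n)) \<le> ennreal (fam_var F (f ` E n))"
    proof -
      have "emeasure ?M (\<Union>C\<in>E n. C) \<le> (\<Sum>C\<in>E n. emeasure ?M C)"
        using op ED by (intro emeasure_subadditive_finite) (auto simp: E_def subset_iff)
      also have "\<dots> \<le> (\<Sum>C\<in>E n. ennreal \<bar>F (Sup C) - F (Inf C)\<bar>)"
      proof (rule sum_mono)
        fix C assume "C \<in> E n"
        then have C: "C \<in> D" using ED by auto
        have "emeasure ?M C \<le> emeasure ?M {Inf C<..Sup C}"
        proof (rule emeasure_mono)
          show "C \<subseteq> {Inf C<..Sup C}"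
            by (rule subsetI) (simp only: greaterThanAtMost_iff int(1)[OF C] less_imp_le)
        qed simp
        also have "\<dots> = ennreal \<bar>F (Sup C) - F (Inf C)\<bar>"
          using emeasure_interval_measure_Ioc[of "Inf C" "Sup C" F] int(2)[OF C] mono rc
            mono[of "Inf C" "Sup C"] by simp
        finally show "emeasure ?M C \<le> ennreal \<bar>F (Sup C) - F (Inf C)\<bar>" .
      qed
      also have "\<dots> = ennreal (fam_var F (f ` E n))"
        unfolding fam_var_def sum.reindex[OF inj] by (subst sum_ennreal) (auto simp: f_def)
      finally show ?thesis by simp
    qed
    ultimately show ?thesis using ennreal_leI order_trans by blast
  qed
  have "U = \<Union>D" by (simp add: D_def)
  also have "\<dots> = (\<Union>n. \<Union>(E n))"
  proof -
    have "D = (\<Union>n. E n)" unfolding E_def image_UN[symmetric] UN_lessThan_UNIV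
      using range_from_nat_into[OF Dne \<open>countable D\<close>] by simp
    then show ?thesis by auto
  qed
  finally have "emeasure ?M U = (SUP n. emeasure ?M (\<Union>(E n)))"
    using op ED by (subst SUP_emeasure_incseq) (auto simp: incseq_def E_def subset_iff intro!: borel_open open_Union)
  also have "\<dots> \<le> ennreal e" using fin by (intro SUP_least) auto
  finally show ?thesis .
qed auto

text \<open>Absolute continuity of \<open>F\<close> says that its Stieltjes measure ignores Lebesgue
  null sets, so Radon-Nikodym supplies the integrand.\<close>

lemma mono_small_increments_integral:
  fixes F :: "real \<Rightarrow> real"
  assumes cd: "c \<le> d" and mono: "\<And>x y. c \<le> x \<Longrightarrow> x \<le> y \<Longrightarrow> y \<le> d \<Longrightarrow> F x \<le> F y"
    and sm: "small_increments c d F"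
  shows "\<exists>h. integrable lborel h \<and> (\<forall>t\<in>{c..d}. F t - F c = (LINT \<tau>:{c..t}|lborel. h \<tau>))"
proof -
  \<comment> \<open>The Stieltjes measure needs a monotone continuous function on the whole line;
    \<open>G\<close> is constant outside \<open>{c..d}\<close> and so adds no mass there.\<close>
  define G where "G x = F (max c (min d x))" for x
  let ?M = "interval_measure G"
  have Geq: "G x = F x" if "x \<in> {c..d}" for x using that by (auto simp: G_def)
  have Gm: "G x \<le> G y" if "x \<le> y" for x y unfolding G_def using that cd by (intro mono) auto
  have Gc: "continuous_on UNIV G"
    unfolding G_def
    by (rule continuous_on_compose2[OF small_increments_continuous[OF sm]])
      (use cd in \<open>auto intro!: continuous_intros\<close>)
  have rc: "continuous (at_right x) G" for x
    using Gc by (meson UNIV_I continuous_on_eq_continuous_at continuous_at_imp_continuous_at_within open_UNIV)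
  have Ioc: "emeasure ?M {x<..y} = ennreal (G y - G x)" if "x \<le> y" for x y
    by (rule emeasure_interval_measure_Ioc) (use that Gm rc in auto)
  \<comment> \<open>Half-open intervals outside have increment 0, and by continuity of
    \<open>G\<close> the point \<open>d\<close> carries no mass.\<close>
  have null_outside: "emeasure ?M (- {c<..<d}) = 0"
  proof -
    have "emeasure ?M {c - real n<..c} = 0" for n
      by (subst Ioc) (use cd in \<open>auto simp: G_def\<close>)
    moreover have "emeasure ?M {d<..d + real n} = 0" for n
      by (subst Ioc) (use cd in \<open>auto simp: G_def\<close>)
    moreover have "emeasure ?M {d} = 0"
      using emeasure_interval_measure_Icc[of d d G] Gm Gc by simp
    ultimately have "(\<Union>n. {c - real n<..c}) \<union> (\<Union>n. {d<..d + real n}) \<union> {d} \<in> null_sets ?M"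
      by (intro null_sets.Un null_sets_UN) auto
    moreover have "- {c<..<d} \<subseteq> (\<Union>n. {c - real n<..c}) \<union> (\<Union>n. {d<..d + real n}) \<union> {d}"
    proof
      fix x assume "x \<in> - {c<..<d}"
      moreover obtain n where "\<bar>x\<bar> + \<bar>c\<bar> + \<bar>d\<bar> < real n" using reals_Archimedean2 by blast
      ultimately show "x \<in> (\<Union>n. {c - real n<..c}) \<union> (\<Union>n. {d<..d + real n}) \<union> {d}"
        by (cases "x \<le> c") (auto intro!: exI[of _ n])
    qed
    ultimately have "- {c<..<d} \<in> null_sets ?M"
      by (metis (no_types, lifting) null_sets_subset borel_comp borel_open open_greaterThanLessThan sets_interval_measure)
    then show ?thesis by auto
  qed
  have var: "fam_var G P = fam_var F P" if "P \<in> interval_fams c d" for P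
    unfolding fam_var_def using famD(2)[OF that] by (intro sum.cong) (fastforce simp: Geq)+
  have "absolutely_continuous lborel ?M"
    unfolding absolutely_continuous_def
  proof
    fix N :: "real set" assume N: "N \<in> null_sets lborel"
    have small: "emeasure ?M N \<le> ennreal e" if e: "e > 0" for e
    proof -
      obtain \<delta> where \<delta>: "\<delta> > 0" "\<And>P. P \<in> interval_fams c d \<Longrightarrow> fam_length P < \<delta> \<Longrightarrow> fam_var G P \<le> e"
        using sm[unfolded small_increments_def, rule_format, OF e] by (auto simp: var)
      \<comment> \<open>Outer regularity encloses the null set \<open>N\<close> in an open set of
        measure below \<open>\<delta>\<close>, which may then be cut to the inside of
        \<open>{c..d}\<close>.\<close>
      obtain U where U: "open U" "N \<subseteq> U" "emeasure lborel (U - N) < \<delta>"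
        using outer_regular_lborel[of N \<delta>] N \<delta>(1) by (metis null_setsD2 sets_lborel)
      let ?U = "U \<inter> {c<..<d}"
      have "emeasure lborel ?U \<le> emeasure lborel (U - N \<union> N)"
        using U N by (intro emeasure_mono) auto
      also have "\<dots> \<le> emeasure lborel (U - N) + emeasure lborel N"
        using U N by (intro emeasure_subadditive) auto
      also have "\<dots> < \<delta>" using U N by auto
      finally have "emeasure ?M ?U \<le> ennreal e"
        by (intro interval_measure_open_small[where c=c and d=d and \<delta>=\<delta>]) (use Gm Gc \<delta> U e in auto)
      moreover have "emeasure ?M N \<le> emeasure ?M (?U \<union> - {c<..<d})"
        using U N by (intro emeasure_mono) auto
      moreover have "\<dots> \<le> emeasure ?M ?U + emeasure ?M (- {c<..<d})"
        using U by (intro emeasure_subadditive) auto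
      ultimately show ?thesis using null_outside by (auto intro: order_trans)
    qed
    have "emeasure ?M N \<le> 0 + ennreal e" if "0 < e" for e using small[OF that] by simp
    then have "emeasure ?M N \<le> 0" by (rule ennreal_le_epsilon)
    with N show "N \<in> null_sets ?M" by (simp add: null_sets_def)
  qed
  from sigma_finite_measure.Radon_Nikodym[OF sigma_finite_lborel this] obtain h0 where
    h0[measurable]: "h0 \<in> borel_measurable lborel" and dens: "density lborel h0 = ?M" by auto
  have em: "emeasure ?M A = (\<integral>\<^sup>+x. h0 x * indicator A x \<partial>lborel)" if "A \<in> sets borel" for A
    unfolding dens[symmetric] using that by (intro emeasure_density) auto
  have "emeasure ?M UNIV \<le> emeasure ?M ({c<..d} \<union> - {c<..<d})" by (intro emeasure_mono) auto
  also have "\<dots> \<le> emeasure ?M {c<..d} + emeasure ?M (- {c<..<d})" by (intro emeasure_subadditive) auto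
  also have "\<dots> < \<infinity>" using Ioc[OF cd] null_outside by simp
  finally have fin: "(\<integral>\<^sup>+x. h0 x \<partial>lborel) < \<infinity>" using em[of UNIV] by simp
  \<comment> \<open>The density is an extended real; the total mass is finite, so it is finite
    almost everywhere and a real function can replace it.\<close>
  define h where "h x = enn2real (h0 x)" for x
  have [measurable]: "h \<in> borel_measurable lborel" unfolding h_def by measurable
  have AE: "AE x in lborel. h0 x = ennreal (h x)"
    using nn_integral_PInf_AE[OF h0] fin by (auto simp: h_def less_top)
  have int: "integrable lborel h"
  proof (rule integrableI_bounded)
    have "(\<integral>\<^sup>+x. ennreal (norm (h x)) \<partial>lborel) = (\<integral>\<^sup>+x. h0 x \<partial>lborel)"
      using AE by (intro nn_integral_cong_AE) (auto simp: h_def)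
    then show "(\<integral>\<^sup>+x. ennreal (norm (h x)) \<partial>lborel) < \<infinity>" using fin by simp
  qed simp
  have "F t - F c = (LINT \<tau>:{c..t}|lborel. h \<tau>)" if t: "t \<in> {c..d}" for t
  proof -
    have ct: "c \<le> t" "c \<in> {c..d}" using t by auto
    have "ennreal (F t - F c) = emeasure ?M {c<..t}"
      by (simp only: Ioc[OF ct(1)] Geq[OF t] Geq[OF ct(2)])
    also have "\<dots> = (\<integral>\<^sup>+x. h0 x * indicator {c<..t} x \<partial>lborel)" by (rule em) simp
    also have "\<dots> = (\<integral>\<^sup>+x. ennreal (indicator {c..t} x * h x) \<partial>lborel)"
      by (rule nn_integral_cong_AE)
        (use AE AE_lborel_singleton[of c] in \<open>eventually_elim, auto simp: indicator_def\<close>)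
    also have "\<dots> = ennreal (LINT x|lborel. indicator {c..t} x * h x)"
      using integrable_mult_indicator[of "{c..t}" lborel h] int
      by (intro nn_integral_eq_integral) (auto simp: h_def)
    finally have "ennreal (F t - F c) = ennreal (LINT x|lborel. indicator {c..t} x * h x)" .
    moreover have "F c \<le> F t" using t by (intro mono) auto
    moreover have "0 \<le> (LINT x|lborel. indicator {c..t} x * h x)"
      by (intro integral_nonneg_AE) (auto simp: h_def)
    ultimately show ?thesis by (simp add: set_lebesgue_integral_def)
  qed
  with int show ?thesis by blast
qed

section \<open>From monotone to absolutely continuous functions\<close>

lemma fam_var_diff_le: "fam_var (\<lambda>x. f x - g x) P \<le> fam_var f P + fam_var g P"
  unfolding fam_var_def sum.distrib[symmetric] by (intro sum_mono) (auto simp: case_prod_unfold)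

lemma integrable_imp_set_integrable:
  fixes h :: "'a \<Rightarrow> real"
  shows "integrable M h \<Longrightarrow> A \<in> sets M \<Longrightarrow> set_integrable M A h"
  unfolding set_integrable_def by (rule integrable_mult_indicator)

lemma set_integral_lborel_diff:
  assumes "integrable lborel h1" "integrable lborel h2" "A \<in> sets borel"
  shows "(LINT x:A|lborel. h1 x - h2 x) = (LINT x:A|lborel. h1 x) - (LINT x:A|lborel. h2 x :: real)"
proof (rule set_integral_diff(2))
  show "set_integrable lborel A h1" "set_integrable lborel A h2"
    using assms by (simp_all add: integrable_imp_set_integrable)
qed

text \<open>Jordan decomposition \<open>g = V - (V - g)\<close> with \<open>V\<close> the total
  variation from \<open>c\<close>: both parts are monotone with small increments, and their
  densities are subtracted.\<close>

lemma bounded_variation_integral: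
  assumes cd: "c \<le> d" and sm: "small_increments c d g"
    and bv: "\<And>P. P \<in> interval_fams c d \<Longrightarrow> fam_var g P \<le> K"
  shows "\<exists>h. integrable lborel h \<and> (\<forall>t\<in>{c..d}. g t - g c = (LINT \<tau>:{c..t}|lborel. h \<tau>))"
proof -
  define V where "V = total_var g c"
  have ge: "V u + \<bar>g v - g u\<bar> \<le> V v" if "c \<le> u" "u \<le> v" "v \<le> d" for u v
    unfolding V_def by (rule total_var_ge_diff[OF bv that])
  have smV: "small_increments c d V"
    unfolding small_increments_def
  proof (intro allI impI)
    fix e :: real assume "0 < e"
    then obtain \<delta> where \<delta>: "\<delta> > 0" "\<And>P. P \<in> interval_fams c d \<Longrightarrow> fam_length P < \<delta> \<Longrightarrow> fam_var g P \<le> e"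
      using sm unfolding small_increments_def by metis
    have "fam_var V P \<le> e" if P: "P \<in> interval_fams c d" "fam_length P < \<delta>" for P
    proof -
      have "fam_var V P \<le> (\<Sum>(u, v)\<in>P. total_var g u v)"
        unfolding fam_var_def
      proof (rule sum_mono, clarify)
        fix u v assume "(u, v) \<in> P"
        then have "c \<le> u" "u \<le> v" "v \<le> d" using famD(2)[OF P(1)] by fastforce+
        then show "\<bar>V v - V u\<bar> \<le> total_var g u v"
          using ge[of u v] total_var_diff_le[where c=c and d=d and K=K, OF bv, of u v] by (simp add: V_def)
      qed
      also have "\<dots> \<le> e" using total_var_sum_le[OF bv \<delta>(2) P] .
      finally show ?thesis .
    qed
    with \<delta>(1) show "\<exists>\<delta>>0. \<forall>P\<in>interval_fams c d. fam_length P < \<delta> \<longrightarrow> fam_var V P \<le> e" by blast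
  qed
  have smW: "small_increments c d (\<lambda>x. V x - g x)"
    unfolding small_increments_def
  proof (intro allI impI)
    fix e :: real assume "0 < e"
    then have e2: "0 < e / 2" by simp
    from smV[unfolded small_increments_def, rule_format, OF e2] obtain \<delta>1 where
      1: "\<delta>1 > 0" "\<And>P. P \<in> interval_fams c d \<Longrightarrow> fam_length P < \<delta>1 \<Longrightarrow> fam_var V P \<le> e / 2" by blast
    from sm[unfolded small_increments_def, rule_format, OF e2] obtain \<delta>2 where
      2: "\<delta>2 > 0" "\<And>P. P \<in> interval_fams c d \<Longrightarrow> fam_length P < \<delta>2 \<Longrightarrow> fam_var g P \<le> e / 2" by blast
    have "fam_var (\<lambda>x. V x - g x) P \<le> e" if "P \<in> interval_fams c d" "fam_length P < min \<delta>1 \<delta>2" for P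
      using 1(2)[of P] 2(2)[of P] that fam_var_diff_le[of V g P] by simp
    with 1 2 show "\<exists>\<delta>>0. \<forall>P\<in>interval_fams c d. fam_length P < \<delta> \<longrightarrow> fam_var (\<lambda>x. V x - g x) P \<le> e"
      by (intro exI[of _ "min \<delta>1 \<delta>2"]) auto
  qed
  have "V x \<le> V y" if "c \<le> x" "x \<le> y" "y \<le> d" for x y
    using ge[OF that] by simp
  from mono_small_increments_integral[OF cd this smV] obtain h1 where
    h1: "integrable lborel h1" "\<And>t. t \<in> {c..d} \<Longrightarrow> V t - V c = (LINT \<tau>:{c..t}|lborel. h1 \<tau>)" by blast
  have "V x - g x \<le> V y - g y" if "c \<le> x" "x \<le> y" "y \<le> d" for x y
    using ge[OF that] by simp
  from mono_small_increments_integral[OF cd this smW] obtain h2 where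
    h2: "integrable lborel h2" "\<And>t. t \<in> {c..d} \<Longrightarrow> V t - g t - (V c - g c) = (LINT \<tau>:{c..t}|lborel. h2 \<tau>)"
    by blast
  have "g t - g c = (LINT \<tau>:{c..t}|lborel. h1 \<tau> - h2 \<tau>)" if "t \<in> {c..d}" for t
    using h1(2)[OF that] h2(2)[OF that] by (simp add: set_integral_lborel_diff[OF h1(1) h2(1)])
  with h1(1) h2(1) show ?thesis by (intro exI[of _ "\<lambda>\<tau>. h1 \<tau> - h2 \<tau>"]) auto
qed

lemma small_increments_subinterval:
  "small_increments c d g \<Longrightarrow> c \<le> c' \<Longrightarrow> d' \<le> d \<Longrightarrow> small_increments c' d' g"
  unfolding small_increments_def using fam_mono[of c c' d' d] by (meson subset_iff)

lemma small_increments_integral: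
  assumes cd: "c \<le> d" and sm: "small_increments c d g"
  shows "\<exists>h. integrable lborel h \<and> (\<forall>t\<in>{c..d}. g t - g c = (LINT \<tau>:{c..t}|lborel. h \<tau>))"
proof -
  obtain \<delta> where \<delta>: "\<delta> > 0" "\<And>P. P \<in> interval_fams c d \<Longrightarrow> fam_length P < \<delta> \<Longrightarrow> fam_var g P \<le> 1"
    using sm[unfolded small_increments_def, rule_format, of 1] by auto
  \<comment> \<open>On intervals shorter than \<open>\<delta>\<close> the total variation is at most 1 without any subdivision
    argument; the densities found there are glued together.\<close>
  have *: "\<exists>h. integrable lborel h \<and> (\<forall>t\<in>{b..d}. g t - g b = (LINT \<tau>:{b..t}|lborel. h \<tau>))"
    if "c \<le> b" "b \<le> d" "d - b \<le> real n * (\<delta> / 2)" for b n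
    using that
  proof (induction n arbitrary: b)
    case 0
    then have "b = d" by simp
    then show ?case by (intro exI[of _ "\<lambda>_. 0"]) auto
  next
    case (Suc n)
    define m where "m = min d (b + \<delta> / 2)"
    have m: "b \<le> m" "m \<le> d" "m - b < \<delta>" using Suc.prems \<delta>(1) by (auto simp: m_def)
    have "fam_var g P \<le> 1" if "P \<in> interval_fams b m" for P
      using \<delta>(2)[of P] fam_mono[of c b m d] that m Suc.prems fam_length_le[OF that m(1)] by auto
    from bounded_variation_integral[OF m(1) _ this] small_increments_subinterval[OF sm, of b m] m Suc.prems
    obtain h1 where h1: "integrable lborel h1" "\<And>t. t \<in> {b..m} \<Longrightarrow> g t - g b = (LINT \<tau>:{b..t}|lborel. h1 \<tau>)"
      by blast
    have "c \<le> m" "d - m \<le> real n * (\<delta> / 2)" using Suc.prems \<delta>(1) by (auto simp: m_def field_simps min_def)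
    from Suc.IH[OF this(1) m(2) this(2)] obtain h2 where
      h2: "integrable lborel h2" "\<And>t. t \<in> {m..d} \<Longrightarrow> g t - g m = (LINT \<tau>:{m..t}|lborel. h2 \<tau>)" by blast
    define h where "h x = indicator {..m} x * h1 x + indicator {m<..} x * h2 x" for x
    have int: "integrable lborel h"
      unfolding h_def using h1(1) h2(1)
        integrable_mult_indicator[of "{..m}" lborel h1] integrable_mult_indicator[of "{m<..}" lborel h2] by auto
    have "g t - g b = (LINT \<tau>:{b..t}|lborel. h \<tau>)" if t: "t \<in> {b..d}" for t
    proof (cases "t \<le> m")
      case True
      then have "(LINT \<tau>:{b..t}|lborel. h \<tau>) = (LINT \<tau>:{b..t}|lborel. h1 \<tau>)"
        by (intro set_lebesgue_integral_cong) (auto simp: h_def)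
      then show ?thesis using h1(2)[of t] True t by simp
    next
      case False
      have "{b..t} = {b..m} \<union> {m<..t}" using m False by auto
      then have "(LINT \<tau>:{b..t}|lborel. h \<tau>) = (LINT \<tau>:{b..m}|lborel. h \<tau>) + (LINT \<tau>:{m<..t}|lborel. h \<tau>)"
        using int by (simp only:) (intro set_integral_Un integrable_imp_set_integrable, auto)
      also have "(LINT \<tau>:{b..m}|lborel. h \<tau>) = (LINT \<tau>:{b..m}|lborel. h1 \<tau>)"
        by (intro set_lebesgue_integral_cong) (auto simp: h_def)
      also have "(LINT \<tau>:{m<..t}|lborel. h \<tau>) = (LINT \<tau>:{m<..t}|lborel. h2 \<tau>)"
        by (intro set_lebesgue_integral_cong) (auto simp: h_def)
      also have "\<dots> = (LINT \<tau>:{m..t}|lborel. h2 \<tau>)"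
        unfolding set_lebesgue_integral_def
      proof (rule integral_cong_AE)
        show "AE x in lborel. indicator {m<..t} x *\<^sub>R h2 x = indicator {m..t} x *\<^sub>R h2 x"
          using AE_lborel_singleton[of m] by eventually_elim (auto simp: indicator_def)
      qed (use h2(1) in auto)
      finally show ?thesis using h1(2)[of m] h2(2)[of t] m t False by simp
    qed
    with int show ?case by blast
  qed
  obtain n where "d - c \<le> real n * (\<delta> / 2)"
    using reals_Archimedean3[of "\<delta> / 2"] \<delta>(1) by (metis half_gt_zero less_imp_le)
  from *[OF order_refl cd this] show ?thesis .
qed

lemma abs_cont_on_small_increments:
  assumes "abs_cont_on c d g"
  shows "small_increments c d g"
  unfolding small_increments_def
proof (intro allI impI)
  fix e :: real assume "0 < e"
  from assms[unfolded abs_cont_on_def, rule_format, OF this] obtain \<delta> where \<delta>: "\<delta> > 0"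
    "\<And>P. finite P \<and> (\<forall>(u, v)\<in>P. c \<le> u \<and> u \<le> v \<and> v \<le> d) \<and>
        disjoint_family_on (\<lambda>(u, v). {u<..<v}) P \<and> (\<Sum>(u, v)\<in>P. v - u) < \<delta> \<Longrightarrow>
        (\<Sum>(u, v)\<in>P. \<bar>g v - g u\<bar>) < e" by blast
  have "fam_var g P \<le> e" if "P \<in> interval_fams c d" "fam_length P < \<delta>" for P
  proof -
    have "(\<Sum>(u, v)\<in>P. \<bar>g v - g u\<bar>) < e"
    proof (rule \<delta>(2), intro conjI)
      show "\<forall>(u, v)\<in>P. c \<le> u \<and> u \<le> v \<and> v \<le> d" using that by (fastforce simp: interval_fams_def)
    qed (use that in \<open>simp_all add: interval_fams_def fam_length_def\<close>)
    then show ?thesis by (simp add: fam_var_def)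
  qed
  with \<delta>(1) show "\<exists>\<delta>>0. \<forall>P\<in>interval_fams c d. fam_length P < \<delta> \<longrightarrow> fam_var g P \<le> e" by blast
qed

lemma indefinite_integral_diff:
  fixes h :: "real \<Rightarrow> real"
  assumes h: "integrable lborel h" and "c \<le> u" "u \<le> v"
  shows "(LINT \<tau>:{c..v}|lborel. h \<tau>) - (LINT \<tau>:{c..u}|lborel. h \<tau>) = (LINT \<tau>:{u<..<v}|lborel. h \<tau>)"
proof -
  have "{c..v} = {c..u} \<union> {u<..v}" using assms by auto
  then have "(LINT \<tau>:{c..v}|lborel. h \<tau>) = (LINT \<tau>:{c..u}|lborel. h \<tau>) + (LINT \<tau>:{u<..v}|lborel. h \<tau>)"
    using h by (simp only:) (intro set_integral_Un integrable_imp_set_integrable, auto)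
  moreover have "(LINT \<tau>:{u<..v}|lborel. h \<tau>) = (LINT \<tau>:{u<..<v}|lborel. h \<tau>)"
    unfolding set_lebesgue_integral_def
  proof (rule integral_cong_AE)
    show "AE x in lborel. indicator {u<..v} x *\<^sub>R h x = indicator {u<..<v} x *\<^sub>R h x"
      using AE_lborel_singleton[of v] by eventually_elim (auto simp: indicator_def)
  qed (use h in auto)
  ultimately show ?thesis by simp
qed

text \<open>Cutting the absolute value of \<open>h\<close> off at height \<open>n\<close> leaves an
  excess \<open>f n\<close> of small integral, while the bounded part contributes at most
  \<open>n\<close> times the total length.\<close>

lemma indefinite_integral_abs_cont:
  fixes h :: "real \<Rightarrow> real"
  assumes h: "integrable lborel h"
  shows "abs_cont_on c d (\<lambda>t. LINT \<tau>:{c..t}|lborel. h \<tau>)"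
  unfolding abs_cont_on_def
proof (intro allI impI)
  fix e :: real assume e: "0 < e"
  define f where "f n x = max (\<bar>h x\<bar> - real n) 0" for n x
  have [measurable]: "h \<in> borel_measurable borel" using h by auto
  have [measurable]: "f n \<in> borel_measurable borel" for n
    using borel_measurable_max[of "\<lambda>x. \<bar>h x\<bar> - real n" borel "\<lambda>_. 0"] by (simp add: f_def[abs_def])
  have "(\<lambda>n. LINT x|lborel. f n x) \<longlonglongrightarrow> (LINT x::real|lborel. (0::real))"
  proof (rule integral_dominated_convergence[of "\<lambda>x. 0" lborel f "\<lambda>x. \<bar>h x\<bar>"])
    show "AE x in lborel. (\<lambda>n. f n x) \<longlonglongrightarrow> 0"
    proof (intro AE_I2 tendsto_eventually)
      fix x
      obtain N where "\<bar>h x\<bar> < real N" using reals_Archimedean2 by blast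
      then show "\<forall>\<^sub>F n in sequentially. f n x = 0"
        by (intro eventually_sequentiallyI[of N]) (auto simp: f_def max_def)
    qed
    show "AE x in lborel. norm (f n x) \<le> \<bar>h x\<bar>" for n by (auto simp: f_def)
  qed (use h in auto)
  then have "\<forall>\<^sub>F n in sequentially. (LINT x|lborel. f n x) < e / 2"
    using e by (intro order_tendstoD) auto
  then obtain n where n: "(LINT x|lborel. f n x) < e / 2" by (auto simp: eventually_sequentially)
  have fint: "integrable lborel (f n)"
    by (rule Bochner_Integration.integrable_bound[OF h]) (auto simp: f_def)
  show "\<exists>\<delta>>0. \<forall>P. finite P \<and> (\<forall>(u, v)\<in>P. c \<le> u \<and> u \<le> v \<and> v \<le> d) \<and>
        disjoint_family_on (\<lambda>(u, v). {u<..<v}) P \<and> (\<Sum>(u, v)\<in>P. v - u) < \<delta>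
        \<longrightarrow> (\<Sum>(u, v)\<in>P. \<bar>(LINT \<tau>:{c..v}|lborel. h \<tau>) - (LINT \<tau>:{c..u}|lborel. h \<tau>)\<bar>) < e"
  \<comment> \<open>With this total length the bounded part contributes at most
    \<open>e / 2\<close>; the added 1 guards against \<open>n = 0\<close>.\<close>
  proof (intro exI[of _ "e / (2 * (real n + 1))"] conjI allI impI)
    fix P assume P: "finite P \<and> (\<forall>(u, v)\<in>P. c \<le> u \<and> u \<le> v \<and> v \<le> d) \<and>
        disjoint_family_on (\<lambda>(u, v). {u<..<v}) P \<and> (\<Sum>(u, v)\<in>P. v - u) < e / (2 * (real n + 1))"
    have D: "c \<le> fst p" "fst p \<le> snd p" if "p \<in> P" for p using P that by auto
    have bd: "\<bar>(LINT \<tau>:{c..snd p}|lborel. h \<tau>) - (LINT \<tau>:{c..fst p}|lborel. h \<tau>)\<bar>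
        \<le> real n * (snd p - fst p) + (LINT x|lborel. indicator {fst p<..<snd p} x * f n x)" if p: "p \<in> P" for p
    proof -
      let ?i = "indicator {fst p<..<snd p} :: real \<Rightarrow> real"
      have "\<bar>(LINT \<tau>:{c..snd p}|lborel. h \<tau>) - (LINT \<tau>:{c..fst p}|lborel. h \<tau>)\<bar> =
          \<bar>LINT x|lborel. ?i x * h x\<bar>"
        using indefinite_integral_diff[OF h D[OF p]] by (simp add: set_lebesgue_integral_def)
      also have "\<dots> \<le> (LINT x|lborel. \<bar>?i x * h x\<bar>)"
        using integral_norm_bound[of lborel "\<lambda>x. ?i x * h x"] by simp
      also have "\<dots> \<le> (LINT x|lborel. real n * ?i x + ?i x * f n x)"
      proof (rule integral_mono)
        show "integrable lborel (\<lambda>x. \<bar>?i x * h x\<bar>)"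
          using integrable_mult_indicator[of "{fst p<..<snd p}" lborel h] h by simp
        show "integrable lborel (\<lambda>x. real n * ?i x + ?i x * f n x)"
          using integrable_mult_indicator[of "{fst p<..<snd p}" lborel "f n"] fint D[OF p]
          by (auto simp: integrable_indicator_iff emeasure_lborel_Ioo)
      qed (auto simp: f_def indicator_def)
      also have "\<dots> = real n * (snd p - fst p) + (LINT x|lborel. ?i x * f n x)"
        using integrable_mult_indicator[of "{fst p<..<snd p}" lborel "f n"] fint D[OF p]
        by (subst Bochner_Integration.integral_add) (auto simp: integrable_indicator_iff emeasure_lborel_Ioo)
      finally show ?thesis .
    qed
    have "(\<Sum>(u, v)\<in>P. \<bar>(LINT \<tau>:{c..v}|lborel. h \<tau>) - (LINT \<tau>:{c..u}|lborel. h \<tau>)\<bar>)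
        \<le> (\<Sum>p\<in>P. real n * (snd p - fst p) + (LINT x|lborel. indicator {fst p<..<snd p} x * f n x))"
      using bd by (intro sum_mono) (auto simp: case_prod_unfold)
    also have "\<dots> = real n * (\<Sum>(u, v)\<in>P. v - u) + (\<Sum>p\<in>P. LINT x|lborel. indicator {fst p<..<snd p} x * f n x)"
      by (simp add: sum.distrib sum_distrib_left case_prod_unfold)
    also have "(\<Sum>p\<in>P. LINT x|lborel. indicator {fst p<..<snd p} x * f n x)
        = (LINT x|lborel. (\<Sum>p\<in>P. indicator {fst p<..<snd p} x * f n x))"
      by (rule Bochner_Integration.integral_sum[symmetric])
        (use integrable_mult_indicator[of _ lborel "f n"] fint in auto)
    also have "\<dots> \<le> (LINT x|lborel. f n x)"
    proof (rule integral_mono)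
      show "integrable lborel (\<lambda>x. \<Sum>p\<in>P. indicator {fst p<..<snd p} x * f n x)"
        using integrable_mult_indicator[of _ lborel "f n"] fint by (intro Bochner_Integration.integrable_sum) auto
      fix x
      have "(\<Sum>p\<in>P. indicator {fst p<..<snd p} x * f n x) = indicator (\<Union>p\<in>P. {fst p<..<snd p}) x * f n x"
        using P by (subst indicator_UN_disjoint) (auto simp: sum_distrib_right case_prod_unfold)
      also have "\<dots> \<le> f n x" by (auto simp: f_def indicator_def)
      finally show "(\<Sum>p\<in>P. indicator {fst p<..<snd p} x * f n x) \<le> f n x" .
    qed (rule fint)
    also have "real n * (\<Sum>(u, v)\<in>P. v - u) + (LINT x|lborel. f n x) < e"
    proof -
      have "real n * (\<Sum>(u, v)\<in>P. v - u) \<le> real n * (e / (2 * (real n + 1)))"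
        using P by (intro mult_left_mono) auto
      also have "\<dots> \<le> e / 2" using e by (simp add: field_simps)
      finally show ?thesis using n by simp
    qed
    finally show "(\<Sum>(u, v)\<in>P. \<bar>(LINT \<tau>:{c..v}|lborel. h \<tau>) - (LINT \<tau>:{c..u}|lborel. h \<tau>)\<bar>) < e" by simp
  qed (use e in simp)
qed

section \<open>Indefinite integrals\<close>

text \<open>The differentiation theorem used here concerns averages to the right
  (\<open>0 < k\<close>). Applied to the reflection of \<open>h\<close> it also gives the averages
  to the left; the exceptional set is the union of both.\<close>

lemma indefinite_integral_derivative_negligible:
  fixes h :: "real \<Rightarrow> real"
  assumes h: "\<And>u v. h integrable_on {u..v}"
  shows "\<exists>N. negligible N \<and> (\<forall>x>c. x \<notin> N \<longrightarrow> ((\<lambda>t. integral {c..t} h) has_real_derivative h x) (at x))"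
proof -
  obtain N1 where N1: "negligible N1" "\<And>x e. x \<notin> N1 \<Longrightarrow> 0 < e \<Longrightarrow>
      \<exists>d>0. \<forall>k. 0 < k \<and> k < d \<longrightarrow> norm (integral (cbox x (x + k *\<^sub>R One)) h /\<^sub>R k ^ DIM(real) - h x) < e"
    using integrable_ccontinuous_explicit[of h] h by (auto simp: cbox_interval)
  have h': "(\<lambda>x. h (- x)) integrable_on {u..v}" for u v
    using Henstock_Kurzweil_Integration.integrable_reflect_real[of h "- u" "- v"] h[of "- v" "- u"] by simp
  obtain N2 where N2: "negligible N2" "\<And>x e. x \<notin> N2 \<Longrightarrow> 0 < e \<Longrightarrow>
      \<exists>d>0. \<forall>k. 0 < k \<and> k < d \<longrightarrow>
        norm (integral (cbox x (x + k *\<^sub>R One)) (\<lambda>x. h (- x)) /\<^sub>R k ^ DIM(real) - h (- x)) < e"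
    using integrable_ccontinuous_explicit[of "\<lambda>x. h (- x)"] h' by (auto simp: cbox_interval)
  have "((\<lambda>t. integral {c..t} h) has_real_derivative h x) (at x)"
    if x: "c < x" "x \<notin> N1 \<union> uminus ` N2" for x
    unfolding DERIV_def LIM_eq
  proof (intro allI impI)
    fix e :: real assume e: "0 < e"
    have x2: "x \<notin> N1" "- x \<notin> N2" using x(2) by (auto simp: image_iff)
    obtain d1 where d1: "d1 > 0"
      "\<And>k. 0 < k \<Longrightarrow> k < d1 \<Longrightarrow> \<bar>integral {x..x + k} h / k - h x\<bar> < e"
      using N1(2)[OF x2(1) e] by (auto simp: cbox_interval divide_inverse mult.commute)
    obtain d2 where d2: "d2 > 0"
      "\<And>k. 0 < k \<Longrightarrow> k < d2 \<Longrightarrow> \<bar>integral {- x..- x + k} (\<lambda>x. h (- x)) / k - h x\<bar> < e"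
      using N2(2)[OF x2(2) e] by (auto simp: cbox_interval divide_inverse mult.commute)
    define d where "d = min (x - c) (min d1 d2)"
    have "norm ((integral {c..x + k} h - integral {c..x} h) / k - h x) < e" if k: "k \<noteq> 0" "\<bar>k\<bar> < d" for k
    proof (cases "k > 0")
      case True
      have "integral {c..x} h + integral {x..x + k} h = integral {c..x + k} h"
        by (rule Henstock_Kurzweil_Integration.integral_combine) (use True x h in auto)
      then have "integral {c..x + k} h - integral {c..x} h = integral {x..x + k} h" by simp
      then show ?thesis using d1(2)[of k] True k by (simp add: d_def)
    next
      case False
      have "integral {c..x + k} h + integral {x + k..x} h = integral {c..x} h"
        by (rule Henstock_Kurzweil_Integration.integral_combine) (use False k x h in \<open>auto simp: d_def\<close>)
      moreover have "integral {- x..- x + - k} (\<lambda>x. h (- x)) = integral {x + k..x} h"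
        using Henstock_Kurzweil_Integration.integral_reflect_real[of x "x + k" h] by simp
      ultimately have "(integral {c..x + k} h - integral {c..x} h) / k = integral {- x..- x + - k} (\<lambda>x. h (- x)) / (- k)"
        by (metis add_diff_cancel_left' minus_diff_eq minus_divide_left minus_divide_right)
      then show ?thesis using d2(2)[of "- k"] False k by (simp add: d_def)
    qed
    moreover have "d > 0" using d1 d2 x by (simp add: d_def)
    ultimately show "\<exists>s>0. \<forall>k. k \<noteq> 0 \<and> norm (k - 0) < s \<longrightarrow>
        norm ((integral {c..x + k} h - integral {c..x} h) / k - h x) < e"
      by (intro exI[of _ d]) auto
  qed
  moreover have "negligible (N1 \<union> uminus ` N2)"
    using N1(1) negligible_differentiable_image_negligible[OF order_refl N2(1), of uminus]
    by (auto intro!: negligible_Un derivative_intros simp: differentiable_on_def)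
  ultimately show ?thesis by blast
qed

lemma indefinite_integral_derivative:
  fixes h :: "real \<Rightarrow> real"
  assumes h: "integrable lborel h"
  shows "AE x in lborel. c < x \<longrightarrow> ((\<lambda>t. LINT \<tau>:{c..t}|lborel. h \<tau>) has_real_derivative h x) (at x)"
proof -
  have si: "set_integrable lborel {u..v} h" for u v using h by (simp add: integrable_imp_set_integrable)
  obtain N where N: "negligible N"
    "\<And>x. c < x \<Longrightarrow> x \<notin> N \<Longrightarrow> ((\<lambda>t. integral {c..t} h) has_real_derivative h x) (at x)"
    using indefinite_integral_derivative_negligible[of h c] set_borel_integral_eq_integral(1)[OF si] by blast
  have "AE x in lebesgue. x \<notin> N" using N(1) by (simp add: AE_not_in negligible_iff_null_sets)
  then have "AE x in lborel. x \<notin> N" by (simp add: AE_completion_iff)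
  then show ?thesis
    by eventually_elim (use N(2) in \<open>simp add: set_borel_integral_eq_integral(2)[OF si]\<close>)
qed

section \<open>Intervals starting at \<open>a\<close> and their exhaustion\<close>

lemma intervals_fromD:
  assumes "I \<in> intervals_from a"
  shows "a \<in> I" "\<And>x. x \<in> I \<Longrightarrow> a \<le> x" "\<And>t. t \<in> I \<Longrightarrow> {a..t} \<subseteq> I" "is_interval I"
    "\<exists>r\<in>I. a < r" "I \<in> sets borel" "I \<in> sets lebesgue"
proof -
  show 1: "a \<in> I" "\<And>x. x \<in> I \<Longrightarrow> a \<le> x" "is_interval I" using assms by (auto simp: intervals_from_def)
  then show "\<And>t. t \<in> I \<Longrightarrow> {a..t} \<subseteq> I" by (meson atLeastAtMost_iff mem_is_interval_1_I subsetI)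
  show "\<exists>r\<in>I. a < r" using assms 1 by (force simp: intervals_from_def)
  show "I \<in> sets borel" using 1 by (simp add: real_interval_borel_measurable)
  then show "I \<in> sets lebesgue" by simp
qed

text \<open>The rationals of \<open>I\<close> together with its greatest element, if there is one,
  are countable and cofinal. The sequence need not be monotone.\<close>

lemma intervals_from_exhaust:
  assumes "I \<in> intervals_from a"
  shows "\<exists>T::nat \<Rightarrow> real. range T \<subseteq> I \<and> (\<forall>t\<in>I. \<exists>n. t \<le> T n)"
proof -
  note I = intervals_fromD[OF assms]
  define D where "D = (I \<inter> \<rat>) \<union> {x\<in>I. \<forall>y\<in>I. y \<le> x}"
  have "{x\<in>I. \<forall>y\<in>I. y \<le> x} \<subseteq> {Sup I}" by (auto intro!: antisym cSup_least cSup_upper bdd_aboveI)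
  then have "countable {x\<in>I. \<forall>y\<in>I. y \<le> x}" using countable_finite finite_subset by blast
  then have cD: "countable D" unfolding D_def using countable_rat by auto
  have cover: "\<exists>r\<in>D. t \<le> r" if t: "t \<in> I" for t
  proof (cases "\<forall>y\<in>I. y \<le> t")
    case False
    then obtain y where y: "y \<in> I" "t < y" by auto
    then obtain r where r: "r \<in> \<rat>" "t < r" "r < y" using Rats_dense_in_real by blast
    then have "r \<in> I" using I(3)[OF y(1)] I(2)[OF t] by auto
    then show ?thesis using r by (auto simp: D_def intro!: bexI[of _ r])
  qed (use t in \<open>auto simp: D_def\<close>)
  then have "D \<noteq> {}" using I(1) by blast
  then have "range (from_nat_into D) = D" using cD by (simp add: range_from_nat_into)
  moreover have "D \<subseteq> I" by (auto simp: D_def)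
  moreover have "\<exists>n. t \<le> from_nat_into D n" if "t \<in> I" for t
    using cover[OF that] calculation(1) by (metis rangeE)
  ultimately show ?thesis by (intro exI[of _ "from_nat_into D"]) simp
qed

text \<open>Countably many \<open>T\<close> suffice, so local statements with a null set depending
  on \<open>T\<close> become global ones.\<close>

lemma AE_on_interval:
  assumes "I \<in> intervals_from a" and "\<And>T. T \<in> I \<Longrightarrow> AE x in M. x \<in> I \<longrightarrow> x \<le> T \<longrightarrow> P x"
  shows "AE x in M. x \<in> I \<longrightarrow> P x"
proof -
  obtain T :: "nat \<Rightarrow> real" where T: "range T \<subseteq> I" "\<And>t. t \<in> I \<Longrightarrow> \<exists>n. t \<le> T n"
    using intervals_from_exhaust[OF assms(1)] by blast
  have "AE x in M. \<forall>n. x \<in> I \<longrightarrow> x \<le> T n \<longrightarrow> P x"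
    using assms(2) T(1) by (subst AE_all_countable) auto
  then show ?thesis by eventually_elim (use T(2) in blast)
qed

section \<open>Borel representatives of Lebesgue measurable functions\<close>

lemma AE_lebesgue_on_iff:
  "S \<in> sets lebesgue \<Longrightarrow> (AE x in lebesgue_on S. P x) \<longleftrightarrow> (AE x in lborel. x \<in> S \<longrightarrow> P x)"
  for S :: "'a::euclidean_space set"
  by (subst AE_restrict_space_iff) (auto simp: AE_completion_iff)

text \<open>Here completeness of Lebesgue measure enters: a change on a null set preserves
  measurability, whatever the new values.\<close>

lemma borel_measurable_lebesgue_AE:
  fixes f g :: "'a::euclidean_space \<Rightarrow> 'b::topological_space"
  assumes g: "g \<in> borel_measurable lebesgue" and AE: "AE x in lebesgue. f x = g x"
  shows "f \<in> borel_measurable lebesgue"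
proof (rule measurableI)
  fix A :: "'b set" assume A: "A \<in> sets borel"
  have gA: "g -` A \<in> sets lebesgue" using measurable_sets[OF g A] by simp
  have "AE x in lebesgue. x \<in> g -` A \<longleftrightarrow> x \<in> f -` A" using AE by eventually_elim simp
  from completion.in_sets_AE[OF this gA] show "f -` A \<inter> space lebesgue \<in> sets lebesgue" by simp
qed simp

lemma set_integral_lebesgue_lborel_eq:
  fixes f g :: "real \<Rightarrow> real"
  assumes g: "g \<in> borel_measurable borel" and A: "A \<in> sets borel"
    and AE: "AE x in lborel. x \<in> A \<longrightarrow> f x = g x"
  shows "(LINT x:A|lebesgue. f x) = (LINT x:A|lborel. g x)"
proof -
  have gm: "(\<lambda>x. indicator A x *\<^sub>R g x) \<in> borel_measurable lborel" using g A by measurable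
  have AE': "AE x in lebesgue. indicator A x *\<^sub>R f x = indicator A x *\<^sub>R g x"
    by (subst AE_completion_iff) (use AE in \<open>eventually_elim, auto simp: indicator_def\<close>)
  have "(\<lambda>x. indicator A x *\<^sub>R f x) \<in> borel_measurable lebesgue"
    using borel_measurable_lebesgue_AE[OF measurable_completion[OF gm] AE'] .
  then have "(LINT x:A|lebesgue. f x) = (LINT x:A|lebesgue. g x)"
    unfolding set_lebesgue_integral_def using AE' measurable_completion[OF gm] by (intro integral_cong_AE) auto
  also have "\<dots> = (LINT x:A|lborel. g x)"
    unfolding set_lebesgue_integral_def by (rule integral_completion[OF gm])
  finally show ?thesis .
qed

text \<open>Functions are extended by zero outside \<open>I\<close>, so that Riemann-Liouville integrals become
  convolutions over the whole line.\<close>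

definition loc_int :: "real set \<Rightarrow> (real \<Rightarrow> real) \<Rightarrow> bool" where
  "loc_int I f \<longleftrightarrow> f \<in> borel_measurable borel \<and> (\<forall>x. x \<notin> I \<longrightarrow> f x = 0) \<and>
     (\<forall>T\<in>I. integrable lborel (\<lambda>x. indicator {..T} x * f x))"

text \<open>Only the truncations to \<open>{a..T}\<close> are known to be measurable;
  \<open>f\<close> cut to \<open>I\<close> is their pointwise limit, and a Lebesgue measurable
  function agrees with a Borel one off a null set.\<close>

lemma borel_representative:
  fixes f :: "real \<Rightarrow> real"
  assumes I: "I \<in> intervals_from a"
    and f: "\<And>T. T \<in> I \<Longrightarrow> (\<lambda>x. indicator {a..T} x * f x) \<in> borel_measurable lebesgue"
  shows "\<exists>g\<in>borel_measurable borel. (\<forall>x. x \<notin> I \<longrightarrow> g x = 0) \<and> (AE x\<in>I in lborel. f x = g x)"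
proof -
  note ID = intervals_fromD[OF I]
  obtain T :: "nat \<Rightarrow> real" where T: "range T \<subseteq> I" "\<And>t. t \<in> I \<Longrightarrow> \<exists>n. t \<le> T n"
    using intervals_from_exhaust[OF I] by blast
  \<comment> \<open>Running maxima make the cutoffs increase, so that they converge pointwise to the
    indicator of \<open>I\<close>.\<close>
  define S where "S n = Max (T ` {..n})" for n
  have S: "S n \<in> I" "\<And>i. i \<le> n \<Longrightarrow> T i \<le> S n" for n
  proof -
    have "S n \<in> T ` {..n}" unfolding S_def by (rule Max_in) auto
    then show "S n \<in> I" using T(1) by blast
  qed (simp add: S_def)
  have lim: "(\<lambda>n. indicator {a..S n} x * f x) \<longlonglongrightarrow> indicator I x * f x" for x
  proof (cases "x \<in> I")
    case True
    then obtain N where "x \<le> T N" using T(2) by blast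
    then have "x \<le> S n" if "n \<ge> N" for n using S(2)[OF that] by linarith
    with True ID(2)[OF True] show ?thesis
      by (intro tendsto_eventually eventually_sequentiallyI[of N]) auto
  next
    case False
    then have "x \<notin> {a..S n}" for n using ID(3)[OF S(1)[of n]] by blast
    with False show ?thesis by simp
  qed
  have "(\<lambda>x. indicator I x * f x) \<in> borel_measurable (completion lborel)"
    by (rule borel_measurable_LIMSEQ_real[OF lim f[OF S(1)]])
  from completion_ex_borel_measurable_real[OF this] obtain g0 where
    g0: "g0 \<in> borel_measurable lborel" "AE x in lborel. indicator I x * f x = g0 x" by blast
  have "(\<lambda>x. indicator I x * g0 x) \<in> borel_measurable borel"
    using g0(1) ID(6) by measurable
  moreover have "AE x\<in>I in lborel. f x = indicator I x * g0 x"
    using g0(2) by eventually_elim (auto simp: indicator_def split: if_splits)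
  ultimately show ?thesis by (intro bexI[of _ "\<lambda>x. indicator I x * g0 x"]) auto
qed

text \<open>Lets a solution, given only up to null sets, be traded for a Borel function on the whole
  line, to which Tonelli and convolution apply.\<close>

lemma L1_loc_iff_representative:
  assumes I: "I \<in> intervals_from a"
  shows "f \<in> L1_loc I \<longleftrightarrow> (\<exists>g. loc_int I g \<and> (AE x\<in>I in lborel. f x = g x))"
proof
  note ID = intervals_fromD[OF I]
  assume f: "f \<in> L1_loc I"
  have int: "integrable lebesgue (\<lambda>x. indicator {a..T} x * f x)" if "T \<in> I" for T
    using f ID(3)[OF that] by (auto simp: L1_loc_def set_integrable_def)
  then obtain g where g: "g \<in> borel_measurable borel" "\<And>x. x \<notin> I \<Longrightarrow> g x = 0"
    "AE x\<in>I in lborel. f x = g x"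
    using borel_representative[OF I, of f] by blast
  have "integrable lborel (\<lambda>x. indicator {..T} x * g x)" if T: "T \<in> I" for T
  proof -
    have gm: "(\<lambda>x. indicator {..T} x * g x) \<in> borel_measurable lborel" using g(1) by measurable
    have "AE x in lborel. indicator {a..T} x * f x = indicator {..T} x * g x"
      using g(3) by eventually_elim (use g(2) ID(2) ID(3)[OF T] in \<open>auto simp: indicator_def subset_iff\<close>)
    then have "AE x in lebesgue. indicator {a..T} x * f x = indicator {..T} x * g x"
      by (simp only: AE_completion_iff)
    with int[OF T] have "integrable lebesgue (\<lambda>x. indicator {..T} x * g x)"
      by (subst integrable_cong_AE[symmetric]) (auto intro: measurable_completion[OF gm])
    then show ?thesis by (subst (asm) integrable_completion[OF gm])
  qed
  with g show "\<exists>g. loc_int I g \<and> (AE x\<in>I in lborel. f x = g x)" by (auto simp: loc_int_def)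
next
  assume "\<exists>g. loc_int I g \<and> (AE x\<in>I in lborel. f x = g x)"
  then obtain g where g: "loc_int I g" "AE x\<in>I in lborel. f x = g x" by blast
  have "f absolutely_integrable_on {c..d}" if cd: "{c..d} \<subseteq> I" for c d
  proof (cases "c \<le> d")
    case True
    then have "d \<in> I" using cd by auto
    then have int: "integrable lborel (\<lambda>x. indicator {..d} x * g x)" using g(1) by (simp add: loc_int_def)
    from integrable_mult_indicator[OF _ this, of "{c..d}"]
    have "integrable lborel (\<lambda>x. indicator {c..d} x *\<^sub>R g x)"
      by (rule back_subst[where P="integrable lborel"]) (auto simp: indicator_def)
    then have i2: "integrable lebesgue (\<lambda>x. indicator {c..d} x *\<^sub>R g x)"
      by (subst integrable_completion) auto
    have "AE x in lborel. indicator {c..d} x *\<^sub>R g x = indicator {c..d} x *\<^sub>R f x"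
      using g(2) by eventually_elim (use cd in \<open>auto simp: indicator_def\<close>)
    then have AE: "AE x in lebesgue. indicator {c..d} x *\<^sub>R f x = indicator {c..d} x *\<^sub>R g x"
      by (subst AE_completion_iff) (auto elim: eventually_mono)
    have "integrable lebesgue (\<lambda>x. indicator {c..d} x *\<^sub>R f x)"
      by (subst integrable_cong_AE[OF _ _ AE])
        (use i2 borel_measurable_lebesgue_AE[OF borel_measurable_integrable[OF i2] AE] in auto)
    then show ?thesis by (simp add: set_integrable_def)
  qed auto
  then show "f \<in> L1_loc I" by (simp add: L1_loc_def)
qed

section \<open>Absolute continuity, almost everywhere derivative and indefinite integral\<close>

lemma abs_cont_on_cong:
  assumes f: "abs_cont_on c d f" and cd: "c \<le> c'" "d' \<le> d"
    and eq: "\<And>u v. u \<in> {c'..d'} \<Longrightarrow> v \<in> {c'..d'} \<Longrightarrow> f v - f u = g v - g u"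
  shows "abs_cont_on c' d' g"
  unfolding abs_cont_on_def
proof (intro allI impI)
  fix e :: real assume "0 < e"
  from f[unfolded abs_cont_on_def, rule_format, OF this] obtain \<delta> where \<delta>: "\<delta> > 0"
    "\<And>P. finite P \<and> (\<forall>(u, v)\<in>P. c \<le> u \<and> u \<le> v \<and> v \<le> d) \<and>
        disjoint_family_on (\<lambda>(u, v). {u<..<v}) P \<and> (\<Sum>(u, v)\<in>P. v - u) < \<delta> \<Longrightarrow>
        (\<Sum>(u, v)\<in>P. \<bar>f v - f u\<bar>) < e" by blast
  show "\<exists>\<delta>>0. \<forall>P. finite P \<and> (\<forall>(u, v)\<in>P. c' \<le> u \<and> u \<le> v \<and> v \<le> d') \<and>
        disjoint_family_on (\<lambda>(u, v). {u<..<v}) P \<and> (\<Sum>(u, v)\<in>P. v - u) < \<delta> \<longrightarrow>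
        (\<Sum>(u, v)\<in>P. \<bar>g v - g u\<bar>) < e"
    using \<delta>(1)
  proof (intro exI[of _ \<delta>] conjI allI impI)
    fix P assume P: "finite P \<and> (\<forall>(u, v)\<in>P. c' \<le> u \<and> u \<le> v \<and> v \<le> d') \<and>
        disjoint_family_on (\<lambda>(u, v). {u<..<v}) P \<and> (\<Sum>(u, v)\<in>P. v - u) < \<delta>"
    have "(\<Sum>(u, v)\<in>P. \<bar>g v - g u\<bar>) = (\<Sum>(u, v)\<in>P. \<bar>f v - f u\<bar>)"
    proof (rule sum.cong[OF refl], clarify)
      fix u v assume "(u, v) \<in> P"
      then have "u \<in> {c'..d'}" "v \<in> {c'..d'}" using P by (fastforce simp: case_prod_unfold)+
      then show "\<bar>g v - g u\<bar> = \<bar>f v - f u\<bar>" using eq by simp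
    qed
    also have "\<dots> < e"
    proof (rule \<delta>(2), intro conjI)
      show "\<forall>(u, v)\<in>P. c \<le> u \<and> u \<le> v \<and> v \<le> d" using P cd by fastforce
    qed (use P in auto)
    finally show "(\<Sum>(u, v)\<in>P. \<bar>g v - g u\<bar>) < e" .
  qed
qed

lemma loc_int_cutoff:
  assumes "loc_int I h" "T \<in> I"
  shows "integrable lborel (\<lambda>x. indicator {..T} x * h x)"
    and "A \<in> sets borel \<Longrightarrow> A \<subseteq> {..T} \<Longrightarrow> (LINT x:A|lborel. h x) = (LINT x:A|lborel. indicator {..T} x * h x)"
  using assms by (auto simp: loc_int_def subset_iff intro!: set_lebesgue_integral_cong)

lemma AE_open_interval_contra:
  fixes u v :: real
  assumes "AE x in lborel. P x" "u < v" "\<And>x. u < x \<Longrightarrow> x < v \<Longrightarrow> \<not> P x"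
  shows False
proof -
  have "AE x in lborel. x \<notin> {u<..<v}" using assms(1) by eventually_elim (use assms(3) in auto)
  then have "{u<..<v} \<in> null_sets lborel" by (subst (asm) AE_iff_null_sets[symmetric]) auto
  then have "emeasure lborel {u<..<v} = 0" by auto
  with \<open>u < v\<close> show False by (simp add: emeasure_lborel_Ioo)
qed

text \<open>Continuity upgrades equality almost everywhere to every point, the base point
  \<open>a\<close> included, where the initial condition is read off.\<close>

lemma continuous_on_AE_eq_interval:
  fixes f g :: "real \<Rightarrow> real"
  assumes I: "I \<in> intervals_from a" and cont: "continuous_on I f" "continuous_on I g"
    and AE: "AE x\<in>I in lborel. f x = g x" and t: "t \<in> I"
  shows "f t = g t"
proof (rule ccontr)
  note ID = intervals_fromD[OF I]
  assume ne: "f t \<noteq> g t"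
  have "continuous_on I (\<lambda>x. f x - g x)" using cont by (intro continuous_intros)
  then obtain d where d: "d > 0" "\<And>x. x \<in> I \<Longrightarrow> \<bar>x - t\<bar> < d \<Longrightarrow> \<bar>(f x - g x) - (f t - g t)\<bar> < \<bar>f t - g t\<bar>"
    unfolding continuous_on_iff using t ne by (metis dist_real_def right_minus_eq zero_less_abs_iff)
  have d': "\<not> (x \<in> I \<longrightarrow> f x = g x)" if "x \<in> I" "\<bar>x - t\<bar> < d" for x using d(2)[OF that] that by auto
  obtain r where r: "r \<in> I" "a < r" using ID(5) by blast
  show False
  \<comment> \<open>An open interval inside \<open>I\<close> adjoins \<open>t\<close> on the right
    or, if \<open>t\<close> is not below \<open>r\<close>, on the left.\<close>
  proof (cases "t < r")
    case True
    show False
    proof (rule AE_open_interval_contra[OF AE, of t "min r (t + d)"])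
      fix x assume x: "t < x" "x < min r (t + d)"
      then have "x \<in> I" using ID(3)[OF r(1)] ID(2)[OF t] by auto
      then show "\<not> (x \<in> I \<longrightarrow> f x = g x)" using x by (intro d') auto
    qed (use True d in auto)
  next
    case False
    show False
    proof (rule AE_open_interval_contra[OF AE, of "max a (t - d)" t])
      fix x assume x: "max a (t - d) < x" "x < t"
      then have "x \<in> I" using ID(3)[OF t] by auto
      then show "\<not> (x \<in> I \<longrightarrow> f x = g x)" using x by (intro d') auto
    qed (use False r d in auto)
  qed
qed

lemma AC_loc_continuous_on:
  assumes I: "I \<in> intervals_from a" and G: "G \<in> AC_loc I"
  shows "continuous_on I G"
  unfolding continuous_on_eq_continuous_within
proof
  note ID = intervals_fromD[OF I]
  fix t assume t: "t \<in> I"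
  have cont: "continuous_on {a..T} G" if "T \<in> I" for T
    using G ID(3)[OF that] by (auto simp: AC_loc_def intro!: small_increments_continuous abs_cont_on_small_increments)
  show "continuous (at t within I) G"
  \<comment> \<open>\<open>I\<close> need not be compact: either some \<open>T\<close> in
    \<open>I\<close> lies beyond \<open>t\<close> and \<open>{a..T}\<close> is a neighbourhood of
    \<open>t\<close> within \<open>I\<close>, or \<open>I\<close> is \<open>{a..t}\<close>.\<close>
  proof (cases "\<exists>T\<in>I. t < T")
    case True
    then obtain T where T: "T \<in> I" "t < T" by blast
    have "at t within I = at t within {a..T}"
      by (rule at_within_nhd[of t "{..<T}"]) (use T ID(2) ID(3)[OF T(1)] in auto)
    then show ?thesis using cont[OF T(1)] t T ID(2)[OF t] by (simp add: continuous_on_eq_continuous_within)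
  next
    case False
    then have "I = {a..t}" using ID(2) ID(3)[OF t] by force
    then show ?thesis using cont[OF t] t ID(2)[OF t] by (simp add: continuous_on_eq_continuous_within)
  qed
qed

lemma indefinite_integral_cutoff:
  assumes "loc_int I h" "T \<in> I" "t \<le> T"
  shows "(LINT x:{a..t}|lborel. h x) = (LINT x:{a..t}|lborel. indicator {..T} x * h x)"
  using assms by (intro loc_int_cutoff(2)[of I]) auto

lemma indefinite_integral_AC_loc:
  assumes I: "I \<in> intervals_from a" and h: "loc_int I h"
  shows "(\<lambda>t. c + (LINT \<tau>:{a..t}|lborel. h \<tau>)) \<in> AC_loc I"
  unfolding AC_loc_def
proof (intro CollectI allI impI)
  note ID = intervals_fromD[OF I]
  fix c' d assume cd: "{c'..d} \<subseteq> I"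
  show "abs_cont_on c' d (\<lambda>t. c + (LINT \<tau>:{a..t}|lborel. h \<tau>))"
  proof (cases "c' \<le> d")
    case True
    then have d: "d \<in> I" and c': "c' \<in> I" using cd by auto
    have "abs_cont_on a d (\<lambda>t. LINT \<tau>:{a..t}|lborel. indicator {..d} \<tau> * h \<tau>)"
      by (rule indefinite_integral_abs_cont[OF loc_int_cutoff(1)[OF h d]])
    then show ?thesis
      by (rule abs_cont_on_cong) (use ID(2)[OF c'] indefinite_integral_cutoff[OF h d] in auto)
  next
    \<comment> \<open>On an empty interval only the empty family is admissible.\<close>
    case False
    have empty: "P = {}" if "\<forall>(u, v)\<in>P. c' \<le> u \<and> u \<le> v \<and> v \<le> d" for P
      using False that by (metis (no_types, lifting) all_not_in_conv case_prodE order_trans)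
    show ?thesis unfolding abs_cont_on_def
      by (intro allI impI exI[of _ 1] conjI) (use empty in \<open>fastforce+\<close>)
  qed
qed

lemma AE_deriv_indefinite_integral:
  assumes I: "I \<in> intervals_from a" and h: "loc_int I h"
    and G: "\<And>t. t \<in> I \<Longrightarrow> G t = c + (LINT \<tau>:{a..t}|lborel. h \<tau>)"
  shows "AE t\<in>I in lborel. deriv G t = h t"
proof (rule AE_on_interval[OF I])
  note ID = intervals_fromD[OF I]
  fix T assume T: "T \<in> I"
  let ?h = "\<lambda>x. indicator {..T} x * h x"
  show "AE t\<in>I in lborel. t \<le> T \<longrightarrow> deriv G t = h t"
    using indefinite_integral_derivative[OF loc_int_cutoff(1)[OF h T], of a]
      AE_lborel_singleton[of a] AE_lborel_singleton[of T]
  proof eventually_elim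
    case (elim t)
    show ?case
    proof (intro impI)
      assume t: "t \<in> I" "t \<le> T"
      then have at: "a < t" "t < T" using elim ID(2)[OF t(1)] by auto
      with elim have "((\<lambda>t. LINT \<tau>:{a..t}|lborel. ?h \<tau>) has_real_derivative h t) (at t)" by simp
      then have "((\<lambda>t. c + (LINT \<tau>:{a..t}|lborel. ?h \<tau>)) has_real_derivative h t) (at t)"
        by (auto intro!: derivative_eq_intros)
      then have "(G has_real_derivative h t) (at t)"
      proof (rule has_field_derivative_transform_within_open[of _ _ _ "{a<..<T}"])
        fix x assume "x \<in> {a<..<T}"
        then show "c + (LINT \<tau>:{a..x}|lborel. ?h \<tau>) = G x"
          using ID(3)[OF T] G[of x] indefinite_integral_cutoff[OF h T, of x a]
          by (simp add: subset_iff)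
      qed (use at in auto)
      then show "deriv G t = h t" by (rule DERIV_imp_deriv)
    qed
  qed
qed

text \<open>The fundamental theorem of calculus for the Lebesgue integral. From left to right,
  absolute continuity supplies some density \<open>k\<close>, and differentiating its integral
  identifies \<open>k\<close> with \<open>h\<close> almost everywhere.\<close>

lemma AC_loc_deriv_iff:
  assumes I: "I \<in> intervals_from a" and h: "loc_int I h"
  shows "G \<in> AC_loc I \<and> (AE t\<in>I in lborel. deriv G t = h t) \<longleftrightarrow>
    (\<forall>t\<in>I. G t = G a + (LINT \<tau>:{a..t}|lborel. h \<tau>))"
proof
  note ID = intervals_fromD[OF I]
  assume "\<forall>t\<in>I. G t = G a + (LINT \<tau>:{a..t}|lborel. h \<tau>)"
  then have G: "G t = G a + (LINT \<tau>:{a..t}|lborel. h \<tau>)" if "t \<in> I" for t using that by blast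
  have "G \<in> AC_loc I"
    unfolding AC_loc_def
  proof (intro CollectI allI impI)
    fix c d assume cd: "{c..d} \<subseteq> I"
    then have "abs_cont_on c d (\<lambda>t. G a + (LINT \<tau>:{a..t}|lborel. h \<tau>))"
      using indefinite_integral_AC_loc[OF I h, of "G a"] by (simp add: AC_loc_def)
    then show "abs_cont_on c d G"
    proof (rule abs_cont_on_cong[OF _ order_refl order_refl])
      fix u v assume "u \<in> {c..d}" "v \<in> {c..d}"
      then have "u \<in> I" "v \<in> I" using cd by auto
      then show "(G a + (LINT \<tau>:{a..v}|lborel. h \<tau>)) - (G a + (LINT \<tau>:{a..u}|lborel. h \<tau>)) = G v - G u"
        by (simp only: G[symmetric])
    qed
  qed
  with AE_deriv_indefinite_integral[OF I h G]
  show "G \<in> AC_loc I \<and> (AE t\<in>I in lborel. deriv G t = h t)" by blast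
next
  note ID = intervals_fromD[OF I]
  assume asm: "G \<in> AC_loc I \<and> (AE t\<in>I in lborel. deriv G t = h t)"
  show "\<forall>t\<in>I. G t = G a + (LINT \<tau>:{a..t}|lborel. h \<tau>)"
  proof
    fix t assume t: "t \<in> I"
    have "small_increments a t G"
      using asm ID(3)[OF t] by (auto simp: AC_loc_def intro: abs_cont_on_small_increments)
    from small_increments_integral[OF ID(2)[OF t] this] obtain k where
      k: "integrable lborel k" "\<And>x. x \<in> {a..t} \<Longrightarrow> G x - G a = (LINT \<tau>:{a..x}|lborel. k \<tau>)" by blast
    have AE: "AE x in lborel. indicator {a..t} x *\<^sub>R k x = indicator {a..t} x *\<^sub>R h x"
      using indefinite_integral_derivative[OF k(1), of a] asm[THEN conjunct2]
        AE_lborel_singleton[of a] AE_lborel_singleton[of t]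
    proof eventually_elim
      case (elim x)
      show ?case
      proof (cases "x \<in> {a<..<t}")
        case True
        then have x: "a < x" "x < t" "x \<in> I" using ID(3)[OF t] by auto
        with elim have "((\<lambda>t. LINT \<tau>:{a..t}|lborel. k \<tau>) has_real_derivative k x) (at x)" by simp
        then have "((\<lambda>t. G a + (LINT \<tau>:{a..t}|lborel. k \<tau>)) has_real_derivative k x) (at x)"
          by (auto intro!: derivative_eq_intros)
        then have "(G has_real_derivative k x) (at x)"
        proof (rule has_field_derivative_transform_within_open[of _ _ _ "{a<..<t}"])
          fix y assume "y \<in> {a<..<t}"
          then show "G a + (LINT \<tau>:{a..y}|lborel. k \<tau>) = G y" using k(2)[of y] by auto
        qed (use x in auto)
        with elim x show ?thesis by (metis DERIV_imp_deriv)
      next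
        case False
        then have "x \<notin> {a..t}" using elim by auto
        then show ?thesis by simp
      qed
    qed
    have "(LINT \<tau>:{a..t}|lborel. k \<tau>) = (LINT \<tau>:{a..t}|lborel. h \<tau>)"
      unfolding set_lebesgue_integral_def
      by (rule integral_cong_AE[OF _ _ AE]) (use k(1) h in \<open>auto simp: loc_int_def\<close>)
    with k(2)[of t] ID(2)[OF t] show "G t = G a + (LINT \<tau>:{a..t}|lborel. h \<tau>)" by auto
  qed
qed

text \<open>All that a solution demands of \<open>RL_integral\<close>, its value at \<open>a\<close>
  included, becomes one almost everywhere identity for the raw integral, in which the choice of a
  continuous representative no longer occurs.\<close>

lemma RL_integral_AC_iff:
  assumes I: "I \<in> intervals_from a" and h: "loc_int I h"
  shows "RL_integral a I \<gamma> q \<in> AC_loc I \<and> (AE t\<in>I in lborel. deriv (RL_integral a I \<gamma> q) t = h t) \<and>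
      RL_integral a I \<gamma> q a = c \<longleftrightarrow>
    (AE t\<in>I in lborel. RL_integral_raw a \<gamma> q t = c + (LINT \<tau>:{a..t}|lborel. h \<tau>))"
    (is "?L \<longleftrightarrow> ?R")
proof
  note ID = intervals_fromD[OF I]
  define r where "r = RL_integral_raw a \<gamma> q"
  define G where "G = RL_integral a I \<gamma> q"
  define C where "C g \<longleftrightarrow> continuous_on I g \<and> (AE t in lebesgue_on I. r t = g t)" for g
  have G: "G = (if \<exists>g. C g then SOME g. C g else r)"
    unfolding G_def RL_integral_def C_def r_def by simp
  have some: "C G" if "C g" for g
  proof -
    have "C (SOME g. C g)" by (rule someI[of C g, OF that])
    then show ?thesis using that G by auto
  qed
  {
    assume ?L
    then have L: "G \<in> AC_loc I" "AE t\<in>I in lborel. deriv G t = h t" "G a = c" by (simp_all add: G_def)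
    have "AE t\<in>I in lborel. r t = G t"
    proof (cases "\<exists>g. C g")
      case True
      with some have "C G" by blast
      then show ?thesis using ID(7) by (simp add: C_def AE_lebesgue_on_iff)
    next
      \<comment> \<open>Without a continuous representative \<open>RL_integral\<close> is the raw
        integral itself.\<close>
      case False
      then show ?thesis using G by simp
    qed
    moreover have "G t = c + (LINT \<tau>:{a..t}|lborel. h \<tau>)" if "t \<in> I" for t
      using AC_loc_deriv_iff[OF I h, of G] L that by auto
    ultimately show ?R unfolding r_def[symmetric] by (auto elim: eventually_mono)
  }
  {
    assume R: ?R
    define G0 where "G0 t = c + (LINT \<tau>:{a..t}|lborel. h \<tau>)" for t
    have G0AC: "G0 \<in> AC_loc I" unfolding G0_def[abs_def] by (rule indefinite_integral_AC_loc[OF I h])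
    have "C G0"
      using AC_loc_continuous_on[OF I G0AC] R ID(7) by (simp add: C_def AE_lebesgue_on_iff r_def G0_def)
    then have "C G" by (rule some)
    have "AE t\<in>I in lborel. G t = G0 t"
      using \<open>C G\<close> \<open>C G0\<close> ID(7) unfolding C_def by (auto simp: AE_lebesgue_on_iff elim: eventually_elim2)
    then have eq: "G t = G0 t" if "t \<in> I" for t
      using continuous_on_AE_eq_interval[OF I _ _ _ that] \<open>C G\<close> \<open>C G0\<close> by (auto simp: C_def)
    have "(LINT \<tau>:{a..a}|lborel. h \<tau>) = 0" by (simp add: set_lebesgue_integral_def integral_eq_zero_AE
        AE_mp[OF AE_lborel_singleton[of a]])
    then have "G a = c" using eq[OF ID(1)] by (simp add: G0_def)
    moreover from this have "\<forall>t\<in>I. G t = G a + (LINT \<tau>:{a..t}|lborel. h \<tau>)"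
      using eq by (simp add: G0_def)
    ultimately show ?L unfolding G_def[symmetric] using AC_loc_deriv_iff[OF I h, of G] by blast
  }
qed

section \<open>The kernel of fractional integration\<close>

text \<open>The value 0 at arguments that are not positive makes the kernel causal: integrals over
  \<open>{a..t}\<close> become convolutions over the whole line of functions that vanish before
  \<open>a\<close>.\<close>

definition rl_kernel :: "real \<Rightarrow> real \<Rightarrow> real" where
  "rl_kernel \<alpha> x = (if 0 < x then x powr (\<alpha> - 1) / Gamma \<alpha> else 0)"

definition rl_int :: "real \<Rightarrow> (real \<Rightarrow> real) \<Rightarrow> real \<Rightarrow> real" where
  "rl_int \<alpha> f t = (LINT \<tau>|lborel. rl_kernel \<alpha> (t - \<tau>) * f \<tau>)"

lemma rl_kernel_measurable[measurable]: "rl_kernel \<alpha> \<in> borel_measurable borel"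
  unfolding rl_kernel_def[abs_def] by measurable

lemma rl_int_measurable[measurable]:
  assumes [measurable]: "f \<in> borel_measurable borel"
  shows "rl_int \<alpha> f \<in> borel_measurable borel"
  unfolding rl_int_def[abs_def] by (rule lborel.borel_measurable_lebesgue_integral) measurable

lemma rl_kernel_nonneg: "0 < \<alpha> \<Longrightarrow> 0 \<le> rl_kernel \<alpha> x"
  by (simp add: rl_kernel_def Gamma_real_pos less_imp_le)

lemma rl_kernel_nonpos_arg[simp]: "x \<le> 0 \<Longrightarrow> rl_kernel \<alpha> x = 0"
  by (simp add: rl_kernel_def)

lemma rl_kernel_1: "rl_kernel 1 x = indicator {0<..} x"
  by (simp add: rl_kernel_def indicator_def)

text \<open>Substituting \<open>\<tau> = t * x\<close> produces the Beta integral, whose value turns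
  the two Gamma factors into the single one of order \<open>\<alpha> + \<beta>\<close>.\<close>

lemma rl_kernel_conv_0:
  assumes \<alpha>: "0 < \<alpha>" "0 < \<beta>"
  shows "(\<integral>\<^sup>+\<tau>. ennreal (rl_kernel \<alpha> (t - \<tau>)) * ennreal (rl_kernel \<beta> \<tau>) \<partial>lborel) = ennreal (rl_kernel (\<alpha> + \<beta>) t)"
proof (cases "t \<le> 0")
  case True
  have "(\<integral>\<^sup>+\<tau>. ennreal (rl_kernel \<alpha> (t - \<tau>)) * ennreal (rl_kernel \<beta> \<tau>) \<partial>lborel) = (\<integral>\<^sup>+(\<tau>::real). 0 \<partial>lborel)"
    by (rule nn_integral_cong) (use True in \<open>auto simp: rl_kernel_def\<close>)
  with True show ?thesis by simp
next
  case False
  then have t: "0 < t" by simp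
  have G: "Gamma \<alpha> > 0" "Gamma \<beta> > 0" "Gamma (\<alpha> + \<beta>) > 0" using \<alpha> by (auto intro: Gamma_real_pos)
  \<comment> \<open>What the substitution takes out of the two kernels; the Jacobian contributes one
    more factor \<open>t\<close>.\<close>
  define C where "C = t powr (\<alpha> + \<beta> - 2) / (Gamma \<alpha> * Gamma \<beta>)"
  have C: "0 \<le> C" using G by (simp add: C_def)
  have eq: "rl_kernel \<alpha> (t - (0 + t * x)) * rl_kernel \<beta> (0 + t * x) =
      C * (indicator {0..1} x * (x powr (\<beta> - 1) * (1 - x) powr (\<alpha> - 1)))" for x
  proof (cases "0 < x \<and> x < 1")
    case True
    have e: "t - t * x = t * (1 - x)" by (simp add: algebra_simps)
    have p: "t powr (\<alpha> - 1) * t powr (\<beta> - 1) = t powr (\<alpha> + \<beta> - 2)"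
      using t by (simp add: powr_add[symmetric])
    have "rl_kernel \<alpha> (t * (1 - x)) * rl_kernel \<beta> (t * x) = (t powr (\<alpha> - 1) * t powr (\<beta> - 1)) / (Gamma \<alpha> * Gamma \<beta>) *
        (x powr (\<beta> - 1) * (1 - x) powr (\<alpha> - 1))"
      using True t by (simp add: rl_kernel_def powr_mult)
    then show ?thesis using True by (simp add: e p C_def)
  next
    case False
    then consider "x \<le> 0" | "x \<ge> 1" by linarith
    then show ?thesis
    proof cases
      case 1
      then have "t * x \<le> 0" using t by (simp add: mult_le_0_iff)
      then show ?thesis using 1 by (cases "x = 0") auto
    next
      case 2
      then have "t - t * x \<le> 0" using t by simp
      then show ?thesis using 2 by (cases "x = 1") auto
    qed
  qed
  have B: "(\<integral>\<^sup>+x. ennreal (indicator {0..1} x * (x powr (\<beta> - 1) * (1 - x) powr (\<alpha> - 1))) \<partial>lborel) = ennreal (Beta \<beta> \<alpha>)"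
    using nn_integral_has_integral_lebesgue[OF _ has_integral_Beta_real[OF \<alpha>(2,1)]] by simp
  have "(\<integral>\<^sup>+\<tau>. ennreal (rl_kernel \<alpha> (t - \<tau>)) * ennreal (rl_kernel \<beta> \<tau>) \<partial>lborel)
      = (\<integral>\<^sup>+\<tau>. ennreal (rl_kernel \<alpha> (t - \<tau>) * rl_kernel \<beta> \<tau>) \<partial>lborel)"
    using \<alpha> by (simp add: ennreal_mult rl_kernel_nonneg)
  also have "\<dots> = ennreal \<bar>t\<bar> * (\<integral>\<^sup>+x. ennreal (rl_kernel \<alpha> (t - (0 + t * x)) * rl_kernel \<beta> (0 + t * x)) \<partial>lborel)"
    by (rule nn_integral_real_affine) (use t in auto)
  also have "\<dots> = ennreal t * (ennreal C * ennreal (Beta \<beta> \<alpha>))"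
    unfolding eq B[symmetric] using t C by (subst nn_integral_cmult[symmetric]) (auto simp: ennreal_mult')
  also have "\<dots> = ennreal (t * (C * Beta \<beta> \<alpha>))"
  proof -
    have "0 \<le> Beta \<beta> \<alpha>" using G by (simp add: Beta_def add.commute)
    then show ?thesis using t C by (simp add: ennreal_mult)
  qed
  also have "t * (C * Beta \<beta> \<alpha>) = rl_kernel (\<alpha> + \<beta>) t"
  proof -
    have "t * t powr (\<alpha> + \<beta> - 2) = t powr (\<alpha> + \<beta> - 1)"
      using t powr_add[of t 1 "\<alpha> + \<beta> - 2"] by simp
    then show ?thesis using t G by (simp add: C_def Beta_def rl_kernel_def add.commute field_simps)
  qed
  finally show ?thesis .
qed

lemma rl_kernel_conv:
  assumes \<alpha>: "0 < \<alpha>" "0 < \<beta>"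
  shows "(\<integral>\<^sup>+\<tau>. ennreal (rl_kernel \<alpha> (t - \<tau>)) * ennreal (rl_kernel \<beta> (\<tau> - s)) \<partial>lborel) = ennreal (rl_kernel (\<alpha> + \<beta>) (t - s))"
proof -
  have "(\<integral>\<^sup>+\<tau>. ennreal (rl_kernel \<alpha> (t - \<tau>)) * ennreal (rl_kernel \<beta> (\<tau> - s)) \<partial>lborel) =
      ennreal \<bar>1\<bar> * (\<integral>\<^sup>+x. ennreal (rl_kernel \<alpha> (t - (s + 1 * x))) * ennreal (rl_kernel \<beta> ((s + 1 * x) - s)) \<partial>lborel)"
    by (rule nn_integral_real_affine) auto
  also have "\<dots> = (\<integral>\<^sup>+x. ennreal (rl_kernel \<alpha> ((t - s) - x)) * ennreal (rl_kernel \<beta> x) \<partial>lborel)"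
    by (simp add: algebra_simps)
  also have "\<dots> = ennreal (rl_kernel (\<alpha> + \<beta>) (t - s))" by (rule rl_kernel_conv_0[OF \<alpha>])
  finally show ?thesis .
qed

lemma rl_kernel_conv_real:
  assumes \<alpha>: "0 < \<alpha>" "0 < \<beta>"
  shows "integrable lborel (\<lambda>\<tau>. rl_kernel \<alpha> (t - \<tau>) * rl_kernel \<beta> (\<tau> - s))"
    and "(LINT \<tau>|lborel. rl_kernel \<alpha> (t - \<tau>) * rl_kernel \<beta> (\<tau> - s)) = rl_kernel (\<alpha> + \<beta>) (t - s)"
proof -
  have nn: "(\<integral>\<^sup>+\<tau>. ennreal (rl_kernel \<alpha> (t - \<tau>) * rl_kernel \<beta> (\<tau> - s)) \<partial>lborel) = ennreal (rl_kernel (\<alpha> + \<beta>) (t - s))"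
    using rl_kernel_conv[OF \<alpha>, of t s] \<alpha> by (simp add: ennreal_mult rl_kernel_nonneg)
  then show "integrable lborel (\<lambda>\<tau>. rl_kernel \<alpha> (t - \<tau>) * rl_kernel \<beta> (\<tau> - s))"
    using \<alpha> by (intro integrableI_bounded) (auto simp: rl_kernel_nonneg)
  show "(LINT \<tau>|lborel. rl_kernel \<alpha> (t - \<tau>) * rl_kernel \<beta> (\<tau> - s)) = rl_kernel (\<alpha> + \<beta>) (t - s)"
    using \<alpha> nn by (subst integral_eq_nn_integral) (auto simp: rl_kernel_nonneg)
qed

text \<open>Associativity of convolution by Tonelli; in \<open>ennreal\<close> it presupposes no
  integrability and can therefore be used to prove it.\<close>

lemma rl_kernel_assoc_nn:
  assumes \<alpha>: "0 < \<alpha>" "0 < \<beta>" and [measurable]: "u \<in> borel_measurable borel"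
  shows "(\<integral>\<^sup>+\<tau>. ennreal (rl_kernel \<alpha> (t - \<tau>)) * (\<integral>\<^sup>+\<sigma>. ennreal (rl_kernel \<beta> (\<tau> - \<sigma>)) * u \<sigma> \<partial>lborel) \<partial>lborel)
    = (\<integral>\<^sup>+\<sigma>. ennreal (rl_kernel (\<alpha> + \<beta>) (t - \<sigma>)) * u \<sigma> \<partial>lborel)"
proof -
  have "(\<integral>\<^sup>+\<tau>. ennreal (rl_kernel \<alpha> (t - \<tau>)) * (\<integral>\<^sup>+\<sigma>. ennreal (rl_kernel \<beta> (\<tau> - \<sigma>)) * u \<sigma> \<partial>lborel) \<partial>lborel)
      = (\<integral>\<^sup>+\<tau>. \<integral>\<^sup>+\<sigma>. ennreal (rl_kernel \<alpha> (t - \<tau>)) * (ennreal (rl_kernel \<beta> (\<tau> - \<sigma>)) * u \<sigma>) \<partial>lborel \<partial>lborel)"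
    by (intro nn_integral_cong nn_integral_cmult[symmetric]) measurable
  also have "\<dots> = (\<integral>\<^sup>+\<sigma>. \<integral>\<^sup>+\<tau>. ennreal (rl_kernel \<alpha> (t - \<tau>)) * (ennreal (rl_kernel \<beta> (\<tau> - \<sigma>)) * u \<sigma>) \<partial>lborel \<partial>lborel)"
    by (rule lborel_pair.Fubini') measurable
  also have "\<dots> = (\<integral>\<^sup>+\<sigma>. (\<integral>\<^sup>+\<tau>. ennreal (rl_kernel \<alpha> (t - \<tau>)) * ennreal (rl_kernel \<beta> (\<tau> - \<sigma>)) \<partial>lborel) * u \<sigma> \<partial>lborel)"
    by (intro nn_integral_cong) (simp add: nn_integral_multc[symmetric] mult.assoc)
  finally show ?thesis by (simp only: rl_kernel_conv[OF \<alpha>])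
qed

lemma rl_kernel_bounded:
  assumes "1 \<le> \<gamma>" "x \<le> L"
  shows "rl_kernel \<gamma> x \<le> L powr (\<gamma> - 1) / Gamma \<gamma>"
proof (cases "0 < x")
  case True
  have "Gamma \<gamma> > 0" using assms by (auto intro: Gamma_real_pos)
  moreover have "x powr (\<gamma> - 1) \<le> L powr (\<gamma> - 1)" using assms True by (intro powr_mono2) auto
  ultimately show ?thesis using True by (simp add: rl_kernel_def divide_right_mono)
next
  case False
  have "Gamma \<gamma> > 0" using assms by (auto intro: Gamma_real_pos)
  with False show ?thesis by simp
qed

section \<open>Fractional integrals of locally integrable functions\<close>

lemma loc_int_measurable: "loc_int I f \<Longrightarrow> f \<in> borel_measurable borel"
  by (simp add: loc_int_def)

lemma loc_int_below:
  assumes "I \<in> intervals_from a" "loc_int I f" "x < a"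
  shows "f x = 0"
  using assms intervals_fromD(2)[OF assms(1)] by (force simp: loc_int_def)

text \<open>From order 1 on the kernel is bounded on \<open>{..t - a}\<close>, so the convolution
  converges absolutely at every \<open>t\<close>, not just at almost every one.\<close>

lemma rl_int_abs_finite:
  assumes I: "I \<in> intervals_from a" and f: "loc_int I f" and t: "t \<in> I" and \<gamma>: "1 \<le> \<gamma>"
  shows "(\<integral>\<^sup>+\<sigma>. ennreal (rl_kernel \<gamma> (t - \<sigma>)) * ennreal \<bar>f \<sigma>\<bar> \<partial>lborel) < \<infinity>"
proof -
  note [measurable] = loc_int_measurable[OF f]
  define C where "C = (t - a) powr (\<gamma> - 1) / Gamma \<gamma>"
  have C: "0 \<le> C" using \<gamma> by (simp add: C_def Gamma_real_pos less_imp_le)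
  have int: "integrable lborel (\<lambda>x. indicator {..t} x * f x)" using f t by (simp add: loc_int_def)
  have "(\<integral>\<^sup>+\<sigma>. ennreal (rl_kernel \<gamma> (t - \<sigma>)) * ennreal \<bar>f \<sigma>\<bar> \<partial>lborel)
      \<le> (\<integral>\<^sup>+\<sigma>. ennreal C * ennreal (norm (indicator {..t} \<sigma> * f \<sigma>)) \<partial>lborel)"
  proof (rule nn_integral_mono)
    fix \<sigma>
    show "ennreal (rl_kernel \<gamma> (t - \<sigma>)) * ennreal \<bar>f \<sigma>\<bar> \<le> ennreal C * ennreal (norm (indicator {..t} \<sigma> * f \<sigma>))"
    proof (cases "a \<le> \<sigma> \<and> \<sigma> \<le> t")
      case True
      then have "rl_kernel \<gamma> (t - \<sigma>) \<le> C" unfolding C_def by (intro rl_kernel_bounded \<gamma>) auto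
      then show ?thesis using True by (auto intro!: mult_right_mono ennreal_leI)
    next
      case False
      then show ?thesis using loc_int_below[OF I f, of \<sigma>] by auto
    qed
  qed
  also have "\<dots> = ennreal C * (\<integral>\<^sup>+\<sigma>. ennreal (norm (indicator {..t} \<sigma> * f \<sigma>)) \<partial>lborel)"
    by (rule nn_integral_cmult) measurable
  also have "\<dots> < \<infinity>" using int by (simp add: integrable_iff_bounded ennreal_mult_less_top)
  finally show ?thesis .
qed

text \<open>Fubini, with absolute integrability supplied by the total order, which is at least 1.
  The identity thus holds at every \<open>t\<close>, even though the inner integral may diverge at
  some times.\<close>

lemma rl_int_assoc:
  assumes I: "I \<in> intervals_from a" and f: "loc_int I f" and t: "t \<in> I"
    and \<alpha>: "0 < \<alpha>" "0 < \<beta>" "1 \<le> \<alpha> + \<beta>"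
  shows "integrable lborel (\<lambda>\<tau>. rl_kernel \<alpha> (t - \<tau>) * rl_int \<beta> f \<tau>)" and "rl_int \<alpha> (rl_int \<beta> f) t = rl_int (\<alpha> + \<beta>) f t"
proof -
  note [measurable] = loc_int_measurable[OF f]
  let ?F = "\<lambda>\<tau> \<sigma>. rl_kernel \<alpha> (t - \<tau>) * (rl_kernel \<beta> (\<tau> - \<sigma>) * f \<sigma>)"
  have int: "integrable (lborel \<Otimes>\<^sub>M lborel) (\<lambda>(\<tau>, \<sigma>). ?F \<tau> \<sigma>)"
  proof (rule integrableI_bounded)
    have "(\<integral>\<^sup>+p. ennreal (norm (case p of (\<tau>, \<sigma>) \<Rightarrow> ?F \<tau> \<sigma>)) \<partial>(lborel \<Otimes>\<^sub>M lborel))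
        = (\<integral>\<^sup>+\<tau>. \<integral>\<^sup>+\<sigma>. ennreal (norm (?F \<tau> \<sigma>)) \<partial>lborel \<partial>lborel)"
      by (subst lborel.nn_integral_fst[symmetric]) (auto simp: case_prod_unfold)
    also have "\<dots> = (\<integral>\<^sup>+\<tau>. ennreal (rl_kernel \<alpha> (t - \<tau>)) * (\<integral>\<^sup>+\<sigma>. ennreal (rl_kernel \<beta> (\<tau> - \<sigma>)) * ennreal \<bar>f \<sigma>\<bar> \<partial>lborel) \<partial>lborel)"
      using \<alpha> by (subst nn_integral_cmult[symmetric]) (auto simp: abs_mult rl_kernel_nonneg ennreal_mult)
    also have "\<dots> = (\<integral>\<^sup>+\<sigma>. ennreal (rl_kernel (\<alpha> + \<beta>) (t - \<sigma>)) * ennreal \<bar>f \<sigma>\<bar> \<partial>lborel)"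
      by (rule rl_kernel_assoc_nn[OF \<alpha>(1,2)]) measurable
    also have "\<dots> < \<infinity>" by (rule rl_int_abs_finite[OF I f t \<alpha>(3)])
    finally show "(\<integral>\<^sup>+p. ennreal (norm (case p of (\<tau>, \<sigma>) \<Rightarrow> ?F \<tau> \<sigma>)) \<partial>(lborel \<Otimes>\<^sub>M lborel)) < \<infinity>" .
  qed measurable
  have inner: "(LINT \<sigma>|lborel. ?F \<tau> \<sigma>) = rl_kernel \<alpha> (t - \<tau>) * rl_int \<beta> f \<tau>" for \<tau>
    by (simp add: rl_int_def)
  show "integrable lborel (\<lambda>\<tau>. rl_kernel \<alpha> (t - \<tau>) * rl_int \<beta> f \<tau>)"
    using lborel_pair.integrable_fst[OF int] by (simp only: inner)
  have "rl_int \<alpha> (rl_int \<beta> f) t = (LINT \<tau>|lborel. LINT \<sigma>|lborel. ?F \<tau> \<sigma>)"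
    by (simp only: inner) (simp only: rl_int_def)
  also have "\<dots> = (LINT \<sigma>|lborel. LINT \<tau>|lborel. ?F \<tau> \<sigma>)"
    by (rule lborel_pair.Fubini_integral[OF int, symmetric])
  also have "\<dots> = (LINT \<sigma>|lborel. (LINT \<tau>|lborel. rl_kernel \<alpha> (t - \<tau>) * rl_kernel \<beta> (\<tau> - \<sigma>)) * f \<sigma>)"
    by (simp add: mult.assoc[symmetric])
  finally show "rl_int \<alpha> (rl_int \<beta> f) t = rl_int (\<alpha> + \<beta>) f t"
    by (simp only: rl_kernel_conv_real(2)[OF \<alpha>(1,2)]) (simp only: rl_int_def)
qed

lemma rl_int_below:
  assumes "\<And>x. x < a \<Longrightarrow> f x = 0" "t \<le> a"
  shows "rl_int \<alpha> f t = 0"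
proof -
  have "(\<lambda>\<tau>. rl_kernel \<alpha> (t - \<tau>) * f \<tau>) = (\<lambda>_. 0)"
    using assms by (intro ext) (metis diff_le_0_iff_le rl_kernel_nonpos_arg linorder_not_le mult_eq_0_iff order_trans)
  then show ?thesis by (simp add: rl_int_def)
qed

text \<open>Times after \<open>t\<close> do not matter because the kernel vanishes there, so
  agreement on \<open>I\<close> and before \<open>a\<close> suffices.\<close>

lemma rl_int_cong_AE:
  assumes I: "I \<in> intervals_from a" and t: "t \<in> I"
    and [measurable]: "f \<in> borel_measurable borel" "g \<in> borel_measurable borel"
    and AE: "AE \<tau>\<in>I in lborel. f \<tau> = g \<tau>" and below: "\<And>x. x < a \<Longrightarrow> f x = g x"
  shows "rl_int \<alpha> f t = rl_int \<alpha> g t"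
  unfolding rl_int_def
proof (rule integral_cong_AE)
  show "AE \<tau> in lborel. rl_kernel \<alpha> (t - \<tau>) * f \<tau> = rl_kernel \<alpha> (t - \<tau>) * g \<tau>"
    using AE
  proof eventually_elim
    case (elim \<tau>)
    then show ?case using below[of \<tau>] intervals_fromD(3)[OF I t]
      by (cases "\<tau> < a"; cases "\<tau> \<le> t") (auto simp: subset_iff)
  qed
qed measurable

lemma rl_int_1_eq:
  assumes I: "I \<in> intervals_from a" and h: "h \<in> borel_measurable borel" "\<And>x. x < a \<Longrightarrow> h x = 0"
  shows "rl_int 1 h t = (LINT \<tau>:{a..t}|lborel. h \<tau>)"
  unfolding rl_int_def set_lebesgue_integral_def
proof (rule integral_cong_AE)
  show "AE \<tau> in lborel. rl_kernel 1 (t - \<tau>) * h \<tau> = indicator {a..t} \<tau> *\<^sub>R h \<tau>"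
    using AE_lborel_singleton[of t] by eventually_elim (use h(2) in \<open>auto simp: rl_kernel_1 indicator_def\<close>)
qed (use h in measurable)

lemma RL_integral_raw_eq:
  assumes I: "I \<in> intervals_from a" and g: "loc_int I g" "AE x\<in>I in lborel. q x = g x"
    and t: "t \<in> I" and \<gamma>: "0 < \<gamma>"
  shows "RL_integral_raw a \<gamma> q t = rl_int \<gamma> g t"
proof -
  note [measurable] = loc_int_measurable[OF g(1)]
  have "RL_integral_raw a \<gamma> q t = (LINT \<tau>:{a..t}|lebesgue. 1 / Gamma \<gamma> * (t - \<tau>) powr (\<gamma> - 1) * q \<tau>)"
    using \<gamma> by (simp add: RL_integral_raw_def)
  also have "\<dots> = (LINT \<tau>:{a..t}|lborel. rl_kernel \<gamma> (t - \<tau>) * g \<tau>)"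
  proof (rule set_integral_lebesgue_lborel_eq)
    \<comment> \<open>At \<open>x = t\<close> the left side is 0 as well, because
      \<open>0 powr y = 0\<close>.\<close>
    show "AE x in lborel. x \<in> {a..t} \<longrightarrow> 1 / Gamma \<gamma> * (t - x) powr (\<gamma> - 1) * q x = rl_kernel \<gamma> (t - x) * g x"
      using g(2) by eventually_elim (use intervals_fromD(3)[OF I t] in \<open>auto simp: rl_kernel_def subset_iff\<close>)
  qed measurable
  also have "\<dots> = rl_int \<gamma> g t"
    unfolding rl_int_def set_lebesgue_integral_def
  proof (rule Bochner_Integration.integral_cong)
    fix x show "indicator {a..t} x *\<^sub>R (rl_kernel \<gamma> (t - x) * g x) = rl_kernel \<gamma> (t - x) * g x"
      using loc_int_below[OF I g(1), of x] by (cases "x < a"; cases "x \<le> t") auto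
  qed simp
  finally show ?thesis .
qed

section \<open>Inversion of the fractional integral\<close>

lemma rl_int_add_rl_kernel:
  assumes I: "I \<in> intervals_from a" and h: "loc_int I h" and t: "t \<in> I"
    and \<alpha>: "0 < \<alpha>" "0 < \<beta>" "1 \<le> \<alpha> + \<beta>"
  shows "rl_int \<alpha> (\<lambda>\<tau>. c * rl_kernel \<beta> (\<tau> - a) + rl_int \<beta> h \<tau>) t = c * rl_kernel (\<alpha> + \<beta>) (t - a) + rl_int (\<alpha> + \<beta>) h t"
    and "integrable lborel (\<lambda>\<tau>. rl_kernel \<alpha> (t - \<tau>) * (c * rl_kernel \<beta> (\<tau> - a) + rl_int \<beta> h \<tau>))"
proof -
  have eq: "rl_kernel \<alpha> (t - \<tau>) * (c * rl_kernel \<beta> (\<tau> - a) + rl_int \<beta> h \<tau>)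
      = c * (rl_kernel \<alpha> (t - \<tau>) * rl_kernel \<beta> (\<tau> - a)) + rl_kernel \<alpha> (t - \<tau>) * rl_int \<beta> h \<tau>" for \<tau> by (simp add: algebra_simps)
  have i1: "integrable lborel (\<lambda>\<tau>. c * (rl_kernel \<alpha> (t - \<tau>) * rl_kernel \<beta> (\<tau> - a)))"
    using rl_kernel_conv_real(1)[OF \<alpha>(1,2)] by simp
  note i2 = rl_int_assoc(1)[OF I h t \<alpha>]
  show "integrable lborel (\<lambda>\<tau>. rl_kernel \<alpha> (t - \<tau>) * (c * rl_kernel \<beta> (\<tau> - a) + rl_int \<beta> h \<tau>))"
    unfolding eq using i1 i2 by simp
  have "rl_int \<alpha> (\<lambda>\<tau>. c * rl_kernel \<beta> (\<tau> - a) + rl_int \<beta> h \<tau>) t =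
      (LINT \<tau>|lborel. c * (rl_kernel \<alpha> (t - \<tau>) * rl_kernel \<beta> (\<tau> - a))) + (LINT \<tau>|lborel. rl_kernel \<alpha> (t - \<tau>) * rl_int \<beta> h \<tau>)"
    unfolding rl_int_def[of \<alpha>] eq by (rule Bochner_Integration.integral_add[OF i1 i2])
  also have "\<dots> = c * rl_kernel (\<alpha> + \<beta>) (t - a) + rl_int (\<alpha> + \<beta>) h t"
    using rl_kernel_conv_real(2)[OF \<alpha>(1,2)] rl_int_assoc(2)[OF I h t \<alpha>] by (simp add: rl_int_def)
  finally show "rl_int \<alpha> (\<lambda>\<tau>. c * rl_kernel \<beta> (\<tau> - a) + rl_int \<beta> h \<tau>) t = c * rl_kernel (\<alpha> + \<beta>) (t - a) + rl_int (\<alpha> + \<beta>) h t" .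
qed

text \<open>Almost everywhere \<open>d\<close> is the derivative of its integral, which is constant.
  The half-open cutoff \<open>{..<t}\<close> is the shape that \<open>rl_kernel 1\<close>
  produces.\<close>

lemma indefinite_integral_zero_AE:
  fixes d :: "real \<Rightarrow> real"
  assumes I: "I \<in> intervals_from a" and d: "d \<in> borel_measurable borel"
    and int: "\<And>T. T \<in> I \<Longrightarrow> integrable lborel (\<lambda>x. indicator {..<T} x * d x)"
    and z: "\<And>t. t \<in> I \<Longrightarrow> (LINT x|lborel. indicator {..<t} x * d x) = 0"
    and below: "\<And>x. x < a \<Longrightarrow> d x = 0"
  shows "AE x\<in>I in lborel. d x = 0"
proof (rule AE_on_interval[OF I])
  note ID = intervals_fromD[OF I]
  fix T assume T: "T \<in> I"
  let ?h = "\<lambda>x. indicator {..<T} x * d x"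
  show "AE x\<in>I in lborel. x \<le> T \<longrightarrow> d x = 0"
    using indefinite_integral_derivative[OF int[OF T], of a] AE_lborel_singleton[of a] AE_lborel_singleton[of T]
  proof eventually_elim
    case (elim x)
    show ?case
    proof (intro impI)
      assume "x \<in> I" "x \<le> T"
      then have x: "a < x" "x < T" using elim ID(2)[of x] by auto
      with elim have "((\<lambda>t. LINT \<tau>:{a..t}|lborel. ?h \<tau>) has_real_derivative d x) (at x)" by simp
      then have "((\<lambda>t. 0) has_real_derivative d x) (at x)"
      proof (rule has_field_derivative_transform_within_open[of _ _ _ "{a<..<T}"])
        fix t assume t: "t \<in> {a<..<T}"
        then have "t \<in> I" using ID(3)[OF T] by auto
        have "(LINT \<tau>:{a..t}|lborel. ?h \<tau>) = (LINT x|lborel. indicator {..<t} x * d x)"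
          unfolding set_lebesgue_integral_def
        proof (rule integral_cong_AE)
          show "AE x in lborel. indicator {a..t} x *\<^sub>R ?h x = indicator {..<t} x * d x"
            using AE_lborel_singleton[of t]
            by eventually_elim (use t below in \<open>auto simp: indicator_def\<close>)
        qed (use d in measurable)
        then show "(LINT \<tau>:{a..t}|lborel. ?h \<tau>) = 0" using z[OF \<open>t \<in> I\<close>] by simp
      qed (use x in auto)
      from DERIV_unique[OF this DERIV_const] show "d x = 0" .
    qed
  qed
qed

text \<open>From right to left, convolve with the kernel of order \<open>1 - \<alpha>\<close>. From
  left to right, convolving with order \<open>\<alpha>\<close> turns both sides into integrals of
  order 1, which are then differentiated. The order 1 stands apart, since a kernel of order 0 would
  be a point mass.\<close>

lemma RL_inversion:
  assumes I: "I \<in> intervals_from a" and \<alpha>: "0 < \<alpha>" "\<alpha> \<le> 1" and q: "loc_int I q" and h: "loc_int I h"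
  shows "(AE t\<in>I in lborel. (if \<alpha> = 1 then q t else rl_int (1 - \<alpha>) q t) = c + rl_int 1 h t) \<longleftrightarrow>
    (AE t\<in>I in lborel. q t = c * rl_kernel \<alpha> (t - a) + rl_int \<alpha> h t)"
proof (cases "\<alpha> = 1")
  note ID = intervals_fromD[OF I]
  case True
  have "AE t\<in>I in lborel. rl_kernel 1 (t - a) = 1"
    using AE_lborel_singleton[of a] by eventually_elim (use ID(2) in \<open>force simp: rl_kernel_1\<close>)
  then have "AE t in lborel. (t \<in> I \<longrightarrow> q t = c + rl_int 1 h t) \<longleftrightarrow> (t \<in> I \<longrightarrow> q t = c * rl_kernel 1 (t - a) + rl_int 1 h t)"
    by eventually_elim auto
  then have "(AE t\<in>I in lborel. q t = c + rl_int 1 h t) \<longleftrightarrow> (AE t\<in>I in lborel. q t = c * rl_kernel 1 (t - a) + rl_int 1 h t)"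
    by (rule eventually_subst)
  with True show ?thesis by simp
next
  case False
  note ID = intervals_fromD[OF I]
  note [measurable] = loc_int_measurable[OF q] loc_int_measurable[OF h]
  have \<alpha>': "0 < 1 - \<alpha>" using \<alpha> False by simp
  let ?g = "\<lambda>\<tau>. c * rl_kernel \<alpha> (\<tau> - a) + rl_int \<alpha> h \<tau>"
  have below: "?g x = 0" if "x \<le> a" for x
    using rl_int_below[of a h x \<alpha>] loc_int_below[OF I h] that by simp
  have kf1: "AE t\<in>I in lborel. rl_kernel 1 (t - a) = 1"
    using AE_lborel_singleton[of a] by eventually_elim (use ID(2) in \<open>force simp: rl_kernel_1\<close>)
  show ?thesis
  proof
    assume "AE t\<in>I in lborel. q t = ?g t"
    then have "rl_int (1 - \<alpha>) q t = c * rl_kernel 1 (t - a) + rl_int 1 h t" if "t \<in> I" for t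
      using rl_int_cong_AE[OF I that, of q ?g "1 - \<alpha>"] below loc_int_below[OF I q]
        rl_int_add_rl_kernel(1)[OF I h that \<alpha>' \<alpha>(1), of c] by simp
    then show "AE t\<in>I in lborel. (if \<alpha> = 1 then q t else rl_int (1 - \<alpha>) q t) = c + rl_int 1 h t"
      using kf1 by (auto elim: eventually_mono simp: False)
  next
    assume asm: "AE t\<in>I in lborel. (if \<alpha> = 1 then q t else rl_int (1 - \<alpha>) q t) = c + rl_int 1 h t"
    have "AE t\<in>I in lborel. rl_int (1 - \<alpha>) q t = c * rl_kernel 1 (t - a) + rl_int 1 h t"
      using asm kf1 by eventually_elim (auto simp: False)
    moreover have "rl_int (1 - \<alpha>) q x = 0" "c * rl_kernel 1 (x - a) + rl_int 1 h x = 0" if "x < a" for x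
      using that rl_int_below[of a q x] rl_int_below[of a h x] loc_int_below[OF I q] loc_int_below[OF I h] by auto
    ultimately have "rl_int \<alpha> (rl_int (1 - \<alpha>) q) t = rl_int \<alpha> (\<lambda>t. c * rl_kernel 1 (t - a) + rl_int 1 h t) t" if "t \<in> I" for t
      using that by (intro rl_int_cong_AE[OF I]) auto
    \<comment> \<open>The common value is \<open>c * rl_kernel (1 + \<alpha>) (t - a) + rl_int (1 +
      \<alpha>) h t\<close>.\<close>
    then have eq: "rl_int 1 q t = rl_int 1 ?g t" if "t \<in> I" for t
      using rl_int_assoc(2)[OF I q that \<alpha>(1) \<alpha>'] rl_int_add_rl_kernel(1)[OF I h that \<alpha>(1) zero_less_one, of c]
        rl_int_add_rl_kernel(1)[OF I h that zero_less_one \<alpha>(1), of c] \<alpha> that by (simp add: add.commute)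
    have kfi: "rl_kernel 1 (t - x) = indicator {..<t} x" for t x
      by (simp add: rl_kernel_1 indicator_def)
    have iq: "integrable lborel (\<lambda>x. indicator {..<t} x * q x)" if "t \<in> I" for t
    proof -
      have "integrable lborel (\<lambda>x. indicator {..t} x * q x)" using q that by (simp add: loc_int_def)
      from integrable_mult_indicator[OF _ this, of "{..<t}"] show ?thesis
        by (rule back_subst[where P="integrable lborel"]) (auto simp: indicator_def)
    qed
    have ig: "integrable lborel (\<lambda>x. indicator {..<t} x * ?g x)" if "t \<in> I" for t
      using rl_int_add_rl_kernel(2)[OF I h that zero_less_one \<alpha>(1), of c] \<alpha> by (simp add: kfi)
    have "AE x\<in>I in lborel. q x - ?g x = 0"
    proof (rule indefinite_integral_zero_AE[OF I])
      show "integrable lborel (\<lambda>x. indicator {..<T} x * (q x - ?g x))" if "T \<in> I" for T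
        using iq[OF that] ig[OF that] by (simp only: right_diff_distrib) simp
      show "(LINT x|lborel. indicator {..<t} x * (q x - ?g x)) = 0" if "t \<in> I" for t
        using Bochner_Integration.integral_diff[OF iq[OF that] ig[OF that]] eq[OF that]
        by (simp only: right_diff_distrib rl_int_def kfi)
      show "q x - ?g x = 0" if "x < a" for x using below[of x] loc_int_below[OF I q that] that by simp
    qed measurable
    then show "AE t\<in>I in lborel. q t = ?g t" by eventually_elim simp
  qed
qed

section \<open>Reduction to integral equations\<close>

text \<open>Counterpart of \<open>loc_int\<close> for coefficients. Since they vanish off
  \<open>I\<close>, the other factor of a product needs no control there.\<close>

definition loc_bdd :: "real set \<Rightarrow> (real \<Rightarrow> real) \<Rightarrow> bool" where
  "loc_bdd I f \<longleftrightarrow> f \<in> borel_measurable borel \<and> (\<forall>x. x \<notin> I \<longrightarrow> f x = 0) \<and>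
     (\<forall>T\<in>I. \<exists>C. AE x in lborel. x \<le> T \<longrightarrow> \<bar>f x\<bar> \<le> C)"

lemma eventually_all_finite_iff:
  "(\<forall>\<^sub>F x in F. \<forall>i::'i::finite. P x i) \<longleftrightarrow> (\<forall>i. \<forall>\<^sub>F x in F. P x i)"
  by (auto intro: eventually_all_finite elim: eventually_mono)

lemma loc_bdd_measurable: "loc_bdd I f \<Longrightarrow> f \<in> borel_measurable borel"
  by (simp add: loc_bdd_def)

lemma loc_int_add: "loc_int I f \<Longrightarrow> loc_int I g \<Longrightarrow> loc_int I (\<lambda>x. f x + g x)"
  by (auto simp: loc_int_def distrib_left)

lemma loc_int_diff: "loc_int I f \<Longrightarrow> loc_int I g \<Longrightarrow> loc_int I (\<lambda>x. f x - g x)"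
  by (auto simp: loc_int_def right_diff_distrib)

lemma loc_int_zero: "loc_int I (\<lambda>x. 0)"
  by (simp add: loc_int_def)

lemma loc_int_sum: "(\<And>j. j \<in> S \<Longrightarrow> loc_int I (f j)) \<Longrightarrow> loc_int I (\<lambda>x. \<Sum>j\<in>S. f j x)"
  by (induction S rule: infinite_finite_induct) (auto intro: loc_int_add loc_int_zero)

lemma loc_int_mult_bdd:
  assumes f: "loc_bdd I f" and g: "loc_int I g"
  shows "loc_int I (\<lambda>x. f x * g x)"
  unfolding loc_int_def
proof (intro conjI ballI allI impI)
  note [measurable] = loc_int_measurable[OF g] loc_bdd_measurable[OF f]
  show "(\<lambda>x. f x * g x) \<in> borel_measurable borel" by measurable
  show "f x * g x = 0" if "x \<notin> I" for x using g that by (simp add: loc_int_def)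
  fix T assume T: "T \<in> I"
  then obtain C where C: "AE x in lborel. x \<le> T \<longrightarrow> \<bar>f x\<bar> \<le> C" using f by (auto simp: loc_bdd_def)
  have "integrable lborel (\<lambda>x. C * (indicator {..T} x * g x))" using g T by (simp add: loc_int_def)
  then show "integrable lborel (\<lambda>x. indicator {..T} x * (f x * g x))"
  proof (rule Bochner_Integration.integrable_bound)
    show "AE x in lborel. norm (indicator {..T} x * (f x * g x)) \<le> norm (C * (indicator {..T} x * g x))"
      using C by eventually_elim (auto simp: indicator_def abs_mult intro!: mult_right_mono)
  qed measurable
qed

lemma loc_bdd_loc_int:
  assumes I: "I \<in> intervals_from a" and f: "loc_bdd I f"
  shows "loc_int I f"
  unfolding loc_int_def
proof (intro conjI ballI)
  note ID = intervals_fromD[OF I]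
  note [measurable] = loc_bdd_measurable[OF f]
  show "f \<in> borel_measurable borel" by measurable
  show f0: "\<forall>x. x \<notin> I \<longrightarrow> f x = 0" using f by (simp add: loc_bdd_def)
  fix T assume T: "T \<in> I"
  then obtain C where C: "AE x in lborel. x \<le> T \<longrightarrow> \<bar>f x\<bar> \<le> C" using f by (auto simp: loc_bdd_def)
  have "integrable lborel (\<lambda>x. C * indicator {a..T} x)"
    by (intro integrable_mult_right integrable_real_indicator) (auto simp: emeasure_lborel_Icc_eq)
  then show "integrable lborel (\<lambda>x. indicator {..T} x * f x)"
  proof (rule Bochner_Integration.integrable_bound)
    show "AE x in lborel. norm (indicator {..T} x * f x) \<le> norm (C * indicator {a..T} x)"
      using C by eventually_elim (use f0 ID(2) in \<open>force simp: indicator_def\<close>)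
  qed measurable
qed

text \<open>\<open>l\<close> stands for a coordinate; the bound by the norm lets one essential bound
  serve all coordinates.\<close>

lemma Linf_loc_representative:
  fixes f :: "real \<Rightarrow> 'b::euclidean_space" and l :: "'b \<Rightarrow> real"
  assumes I: "I \<in> intervals_from a" and f: "f \<in> Linf_loc I"
    and l: "continuous_on UNIV l" "\<And>x. \<bar>l x\<bar> \<le> norm x"
  shows "\<exists>g. loc_bdd I g \<and> (AE x\<in>I in lborel. l (f x) = g x)"
proof -
  note ID = intervals_fromD[OF I]
  have "(\<lambda>x. indicator {a..T} x * l (f x)) \<in> borel_measurable lebesgue" if T: "T \<in> I" for T
  proof -
    have "f \<in> borel_measurable (lebesgue_on {a..T})" using f ID(3)[OF T] by (simp add: Linf_loc_def)
    then have "(\<lambda>x. l (f x)) \<in> borel_measurable (lebesgue_on {a..T})"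
      by (rule measurable_compose[OF _ borel_measurable_continuous_onI[OF l(1)]])
    then show ?thesis by (subst (asm) borel_measurable_restrict_space_iff) auto
  qed
  from borel_representative[OF I this] obtain g where
    g: "g \<in> borel_measurable borel" "\<And>x. x \<notin> I \<Longrightarrow> g x = 0" "AE x\<in>I in lborel. l (f x) = g x"
    by blast
  have "\<exists>C. AE x in lborel. x \<le> T \<longrightarrow> \<bar>g x\<bar> \<le> C" if T: "T \<in> I" for T
  proof -
    obtain C where "AE t in lebesgue_on {a..T}. norm (f t) \<le> C"
      using f ID(3)[OF T] unfolding Linf_loc_def by blast
    then have C: "AE t in lborel. t \<in> {a..T} \<longrightarrow> norm (f t) \<le> C" by (subst (asm) AE_lebesgue_on_iff) auto
    \<comment> \<open>The maximum with 0 covers the points off \<open>I\<close>, where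
      \<open>g\<close> is 0; \<open>C\<close> may be negative, for instance if
      \<open>T = a\<close>.\<close>
    have "AE x in lborel. x \<le> T \<longrightarrow> \<bar>g x\<bar> \<le> max C 0"
      using C g(3)
    proof eventually_elim
      case (elim x)
      show ?case
      proof
        assume "x \<le> T"
        show "\<bar>g x\<bar> \<le> max C 0"
        proof (cases "x \<in> I")
          case True
          then have "norm (f x) \<le> C" "l (f x) = g x" using elim \<open>x \<le> T\<close> ID(2) by auto
          with l(2)[of "f x"] show ?thesis by simp
        qed (simp add: g(2))
      qed
    qed
    then show ?thesis by blast
  qed
  with g show ?thesis by (auto simp: loc_bdd_def)
qed

lemma vec_representative:
  fixes B :: "real \<Rightarrow> real^'m"
  assumes I: "I \<in> intervals_from a" and B: "B \<in> Linf_loc I"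
  shows "\<exists>B'. (\<forall>i. loc_bdd I (\<lambda>t. B' t $ i)) \<and> (AE t\<in>I in lborel. B t = B' t)"
proof -
  have "\<forall>i. \<exists>g. loc_bdd I g \<and> (AE x\<in>I in lborel. B x $ i = g x)"
    by (intro allI Linf_loc_representative[OF I B]) (auto intro!: continuous_intros component_le_norm_cart)
  then obtain g where g: "\<And>i. loc_bdd I (g i)" "\<And>i. AE x\<in>I in lborel. B x $ i = g i x" by metis
  have "AE x in lborel. \<forall>i. x \<in> I \<longrightarrow> B x $ i = g i x" using g(2) by (simp only: eventually_all_finite_iff) blast
  then have "AE t\<in>I in lborel. B t = (\<chi> i. g i t)" by eventually_elim (simp add: vec_eq_iff)
  then show ?thesis using g(1) by (intro exI[of _ "\<lambda>t. \<chi> i. g i t"]) simp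
qed

lemma mat_representative:
  fixes A :: "real \<Rightarrow> real^'m^'n"
  assumes I: "I \<in> intervals_from a" and A: "A \<in> Linf_loc I"
  shows "\<exists>A'. (\<forall>i j. loc_bdd I (\<lambda>t. A' t $ i $ j)) \<and> (AE t\<in>I in lborel. A t = A' t)"
proof -
  have n: "\<bar>x $ i $ j\<bar> \<le> norm x" for x :: "real^'m^'n" and i j
    using component_le_norm_cart[of "x $ i" j] Finite_Cartesian_Product.norm_nth_le[of x i] by linarith
  have "\<forall>i j. \<exists>g. loc_bdd I g \<and> (AE x\<in>I in lborel. A x $ i $ j = g x)"
    by (intro allI Linf_loc_representative[OF I A] n continuous_intros)
  then obtain g where g: "\<And>i j. loc_bdd I (g i j)" "\<And>i j. AE x\<in>I in lborel. A x $ i $ j = g i j x"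
    unfolding choice_iff by blast
  have "AE x in lborel. \<forall>i j. x \<in> I \<longrightarrow> A x $ i $ j = g i j x" using g(2) by (simp only: eventually_all_finite_iff) blast
  then have "AE t\<in>I in lborel. A t = (\<chi> i j. g i j t)" by eventually_elim (simp add: vec_eq_iff)
  then show ?thesis using g(1) by (intro exI[of _ "\<lambda>t. \<chi> i j. g i j t"]) simp
qed

section \<open>Vector and matrix problems as systems of integral equations\<close>

definition vec_loc_int :: "real set \<Rightarrow> (real \<Rightarrow> real^'m) \<Rightarrow> bool" where
  "vec_loc_int I v \<longleftrightarrow> (\<forall>i. loc_int I (\<lambda>t. v t $ i))"

definition rl_int_vec :: "real^'m \<Rightarrow> (real \<Rightarrow> real^'m) \<Rightarrow> real \<Rightarrow> real^'m" where
  "rl_int_vec \<alpha> f t = (\<chi> i. rl_int (\<alpha> $ i) (\<lambda>\<tau>. f \<tau> $ i) t)"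

definition rl_kernel_vec :: "real^'m \<Rightarrow> real \<Rightarrow> real^'m \<Rightarrow> real^'m" where
  "rl_kernel_vec \<alpha> x q = (\<chi> i. q $ i * rl_kernel (\<alpha> $ i) x)"

lemma vec_loc_int_matrix_mult:
  assumes "\<And>i j. loc_bdd I (\<lambda>t. A t $ i $ j)" "vec_loc_int I v"
  shows "vec_loc_int I (\<lambda>t. A t *v v t)"
  using assms unfolding vec_loc_int_def matrix_vector_mult_def
  by (auto intro!: loc_int_sum loc_int_mult_bdd)

lemma vec_loc_int_add: "vec_loc_int I f \<Longrightarrow> vec_loc_int I g \<Longrightarrow> vec_loc_int I (\<lambda>x. f x + g x)"
  by (auto simp: vec_loc_int_def intro: loc_int_add)

lemma vec_loc_int_diff: "vec_loc_int I f \<Longrightarrow> vec_loc_int I g \<Longrightarrow> vec_loc_int I (\<lambda>x. f x - g x)"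
  by (auto simp: vec_loc_int_def intro: loc_int_diff)

text \<open>A single component, with the right-hand side \<open>h\<close> treated as given; the
  coupling of the components is hidden in \<open>h\<close>.\<close>

lemma RL_component_iff:
  assumes I: "I \<in> intervals_from a" and \<alpha>: "0 < \<alpha>" "\<alpha> \<le> 1"
    and v: "loc_int I v" "AE t\<in>I in lborel. q t = v t" and h: "loc_int I h"
  shows "RL_integral a I (1 - \<alpha>) q \<in> AC_loc I \<and> (AE t\<in>I in lborel. RL_deriv a I \<alpha> q t = h t) \<and>
      RL_integral a I (1 - \<alpha>) q a = c \<longleftrightarrow>
    (AE t\<in>I in lborel. v t = c * rl_kernel \<alpha> (t - a) + rl_int \<alpha> h t)"
proof -
  have "AE t in lborel. (t \<in> I \<longrightarrow> RL_integral_raw a (1 - \<alpha>) q t = c + (LINT \<tau>:{a..t}|lborel. h \<tau>)) \<longleftrightarrow>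
      (t \<in> I \<longrightarrow> (if \<alpha> = 1 then v t else rl_int (1 - \<alpha>) v t) = c + rl_int 1 h t)"
    using v(2)
  proof eventually_elim
    case (elim t)
    have "(LINT \<tau>:{a..t}|lborel. h \<tau>) = rl_int 1 h t"
      using rl_int_1_eq[OF I loc_int_measurable[OF h], of t] loc_int_below[OF I h] by simp
    moreover have "RL_integral_raw a (1 - \<alpha>) q t = (if \<alpha> = 1 then v t else rl_int (1 - \<alpha>) v t)" if "t \<in> I"
      using RL_integral_raw_eq[OF I v that, of "1 - \<alpha>"] elim that \<alpha> by (auto simp: RL_integral_raw_def)
    ultimately show ?case by auto
  qed
  then have "(AE t\<in>I in lborel. RL_integral_raw a (1 - \<alpha>) q t = c + (LINT \<tau>:{a..t}|lborel. h \<tau>)) \<longleftrightarrow>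
      (AE t\<in>I in lborel. (if \<alpha> = 1 then v t else rl_int (1 - \<alpha>) v t) = c + rl_int 1 h t)"
    by (rule eventually_subst)
  then show ?thesis
    unfolding RL_deriv_def using RL_integral_AC_iff[OF I h, of "1 - \<alpha>" q c] RL_inversion[OF I \<alpha> v(1) h, of c] by simp
qed

text \<open>The hinge between the Cauchy problem and the integral equation. \<open>v\<close> is
  quantified because \<open>q\<close> itself need not be Borel and is determined only up to a null
  set.\<close>

lemma RL_vector_solution_iff:
  fixes A A' :: "real \<Rightarrow> real^'m^'m"
  assumes I: "I \<in> intervals_from a" and \<alpha>: "\<And>i. 0 < \<alpha> $ i \<and> \<alpha> $ i \<le> 1"
    and A': "\<And>i j. loc_bdd I (\<lambda>t. A' t $ i $ j)" "AE t\<in>I in lborel. A t = A' t"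
    and B': "\<And>i. loc_bdd I (\<lambda>t. B' t $ i)" "AE t\<in>I in lborel. B t = B' t"
  shows "RL_vector_solution a I \<alpha> A B qa q \<longleftrightarrow>
    (\<exists>v. vec_loc_int I v \<and> (AE t\<in>I in lborel. q t = v t) \<and>
      (AE t\<in>I in lborel. v t = rl_kernel_vec \<alpha> (t - a) qa + rl_int_vec \<alpha> (\<lambda>\<tau>. A' \<tau> *v v \<tau> + B' \<tau>) t))"
proof -
  note ID = intervals_fromD[OF I]
  have L1: "(\<forall>i. (\<lambda>t. q t $ i) \<in> L1_loc I) \<longleftrightarrow> (\<exists>v. vec_loc_int I v \<and> (AE t\<in>I in lborel. q t = v t))"
  proof
    assume "\<forall>i. (\<lambda>t. q t $ i) \<in> L1_loc I"
    then obtain v where v: "\<And>i. loc_int I (v i)" "\<And>i. AE t\<in>I in lborel. q t $ i = v i t"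
      unfolding L1_loc_iff_representative[OF I] by metis
    have "AE t in lborel. \<forall>i. t \<in> I \<longrightarrow> q t $ i = v i t" using v(2) by (simp only: eventually_all_finite_iff) blast
    then have "AE t\<in>I in lborel. q t = (\<chi> i. v i t)" by eventually_elim (simp add: vec_eq_iff)
    then show "\<exists>v. vec_loc_int I v \<and> (AE t\<in>I in lborel. q t = v t)"
      using v(1) by (intro exI[of _ "\<lambda>t. \<chi> i. v i t"]) (simp add: vec_loc_int_def)
  next
    assume "\<exists>v. vec_loc_int I v \<and> (AE t\<in>I in lborel. q t = v t)"
    then obtain v where v: "vec_loc_int I v" "AE t\<in>I in lborel. q t = v t" by blast
    show "\<forall>i. (\<lambda>t. q t $ i) \<in> L1_loc I"
      unfolding L1_loc_iff_representative[OF I]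
    proof
      fix i
      have "AE t\<in>I in lborel. q t $ i = v t $ i" using v(2) by eventually_elim simp
      then show "\<exists>g. loc_int I g \<and> (AE t\<in>I in lborel. q t $ i = g t)"
        using v(1) by (intro exI[of _ "\<lambda>t. v t $ i"]) (simp add: vec_loc_int_def)
    qed
  qed
  have main: "(\<forall>i. RL_integral a I (1 - \<alpha> $ i) (\<lambda>t. q t $ i) \<in> AC_loc I) \<and>
      (AE t in lebesgue_on I. (\<chi> i. RL_deriv a I (\<alpha> $ i) (\<lambda>t. q t $ i) t) = A t *v q t + B t) \<and>
      (\<chi> i. RL_integral a I (1 - \<alpha> $ i) (\<lambda>t. q t $ i) a) = qa \<longleftrightarrow>
      (AE t\<in>I in lborel. v t = rl_kernel_vec \<alpha> (t - a) qa + rl_int_vec \<alpha> (\<lambda>\<tau>. A' \<tau> *v v \<tau> + B' \<tau>) t)"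
    if v: "vec_loc_int I v" "AE t\<in>I in lborel. q t = v t" for v
  proof -
    \<comment> \<open>The coupled right-hand side is frozen as a function of time, after which the
      components separate.\<close>
    define h where "h i t = (A' t *v v t + B' t) $ i" for i t
    have "vec_loc_int I B'" using B'(1) loc_bdd_loc_int[OF I] by (simp add: vec_loc_int_def)
    with v have h: "loc_int I (h i)" for i
      using vec_loc_int_add[OF vec_loc_int_matrix_mult[OF A'(1) v(1)]] by (simp add: vec_loc_int_def h_def[abs_def])
    have "AE t in lborel. (t \<in> I \<longrightarrow> (\<chi> i. RL_deriv a I (\<alpha> $ i) (\<lambda>t. q t $ i) t) = A t *v q t + B t) \<longleftrightarrow>
        (\<forall>i. t \<in> I \<longrightarrow> RL_deriv a I (\<alpha> $ i) (\<lambda>t. q t $ i) t = h i t)"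
      using v(2) A'(2) B'(2)
    proof eventually_elim
      case (elim t)
      show ?case
      proof (cases "t \<in> I")
        case True
        then have "A t *v q t + B t = A' t *v v t + B' t" using elim by simp
        then show ?thesis by (simp add: vec_eq_iff h_def)
      qed simp
    qed
    then have 1: "(AE t in lebesgue_on I. (\<chi> i. RL_deriv a I (\<alpha> $ i) (\<lambda>t. q t $ i) t) = A t *v q t + B t) \<longleftrightarrow>
        (\<forall>i. AE t\<in>I in lborel. RL_deriv a I (\<alpha> $ i) (\<lambda>t. q t $ i) t = h i t)"
      unfolding AE_lebesgue_on_iff[OF ID(7)] eventually_all_finite_iff[symmetric] by (rule eventually_subst)
    have 2: "RL_integral a I (1 - \<alpha> $ i) (\<lambda>t. q t $ i) \<in> AC_loc I \<and>
        (AE t\<in>I in lborel. RL_deriv a I (\<alpha> $ i) (\<lambda>t. q t $ i) t = h i t) \<and>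
        RL_integral a I (1 - \<alpha> $ i) (\<lambda>t. q t $ i) a = qa $ i \<longleftrightarrow>
        (AE t\<in>I in lborel. v t $ i = qa $ i * rl_kernel (\<alpha> $ i) (t - a) + rl_int (\<alpha> $ i) (h i) t)" for i
    proof (rule RL_component_iff[OF I])
      show "AE t\<in>I in lborel. q t $ i = v t $ i" using v(2) by eventually_elim simp
    qed (use \<alpha> v(1) h in \<open>auto simp: vec_loc_int_def\<close>)
    have 3: "(AE t\<in>I in lborel. v t = rl_kernel_vec \<alpha> (t - a) qa + rl_int_vec \<alpha> (\<lambda>\<tau>. A' \<tau> *v v \<tau> + B' \<tau>) t) \<longleftrightarrow>
        (\<forall>i. AE t\<in>I in lborel. v t $ i = qa $ i * rl_kernel (\<alpha> $ i) (t - a) + rl_int (\<alpha> $ i) (h i) t)"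
      unfolding eventually_all_finite_iff[symmetric]
      by (intro arg_cong[where f="\<lambda>P. eventually P (ae_filter lborel)"] ext)
        (auto simp: vec_eq_iff rl_kernel_vec_def rl_int_vec_def h_def[abs_def])
    show ?thesis unfolding 1 3 2[symmetric] by (auto simp: vec_eq_iff)
  qed
  show ?thesis
  proof
    assume sol: "RL_vector_solution a I \<alpha> A B qa q"
    then obtain v where v: "vec_loc_int I v" "AE t\<in>I in lborel. q t = v t"
      using L1 by (auto simp: RL_vector_solution_def RL_AC_def)
    with main[OF v] sol show "\<exists>v. vec_loc_int I v \<and> (AE t\<in>I in lborel. q t = v t) \<and>
      (AE t\<in>I in lborel. v t = rl_kernel_vec \<alpha> (t - a) qa + rl_int_vec \<alpha> (\<lambda>\<tau>. A' \<tau> *v v \<tau> + B' \<tau>) t)"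
      by (auto simp: RL_vector_solution_def RL_AC_def)
  next
    assume "\<exists>v. vec_loc_int I v \<and> (AE t\<in>I in lborel. q t = v t) \<and>
      (AE t\<in>I in lborel. v t = rl_kernel_vec \<alpha> (t - a) qa + rl_int_vec \<alpha> (\<lambda>\<tau>. A' \<tau> *v v \<tau> + B' \<tau>) t)"
    then obtain v where v: "vec_loc_int I v" "AE t\<in>I in lborel. q t = v t"
      "AE t\<in>I in lborel. v t = rl_kernel_vec \<alpha> (t - a) qa + rl_int_vec \<alpha> (\<lambda>\<tau>. A' \<tau> *v v \<tau> + B' \<tau>) t" by blast
    with main[OF v(1,2)] L1 show "RL_vector_solution a I \<alpha> A B qa q"
      by (auto simp: RL_vector_solution_def RL_AC_def)
  qed
qed

text \<open>Row constancy gives every column the orders \<open>\<alpha>\<close>; as multiplication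
  by \<open>A t\<close> acts column by column, the matrix problem splits into vector problems whose
  initial data are the unit vectors.\<close>

lemma RL_matrix_solution_iff:
  "RL_matrix_solution s I (row_constant \<alpha>) A Z \<longleftrightarrow>
    (\<forall>j. RL_vector_solution s I \<alpha> A (\<lambda>_. 0) (axis j 1) (\<lambda>t. column j (Z t)))"
proof -
  have "(AE t in lebesgue_on I. (\<chi> i j. RL_deriv s I (row_constant \<alpha> $ i $ j) (\<lambda>t. Z t $ i $ j) t) = A t ** Z t) \<longleftrightarrow>
      (\<forall>j. AE t in lebesgue_on I. (\<chi> i. RL_deriv s I (\<alpha> $ i) (\<lambda>t. column j (Z t) $ i) t) = A t *v column j (Z t) + 0)"
    unfolding eventually_all_finite_iff[symmetric]
    by (intro arg_cong[where f="\<lambda>P. eventually P (ae_filter (lebesgue_on I))"] ext)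
      (auto simp: vec_eq_iff row_constant_def column_def matrix_matrix_mult_def matrix_vector_mult_def)
  moreover have "(\<chi> i j. RL_integral s I (1 - row_constant \<alpha> $ i $ j) (\<lambda>t. Z t $ i $ j) s) = mat 1 \<longleftrightarrow>
      (\<forall>j. (\<chi> i. RL_integral s I (1 - \<alpha> $ i) (\<lambda>t. column j (Z t) $ i) s) = axis j 1)"
    by (auto simp: vec_eq_iff row_constant_def column_def mat_def axis_def)
  ultimately show ?thesis
    unfolding RL_matrix_solution_def RL_vector_solution_def by (auto simp: row_constant_def column_def)
qed

section \<open>Volterra equations with weakly singular kernels\<close>

text \<open>Rescaling by \<open>1 / l\<close> reduces this to Euler's integral for Gamma. The
  negative power of \<open>l\<close> is the source of the contraction.\<close>

lemma rl_kernel_laplace: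
  assumes \<beta>: "0 < \<beta>" and l: "0 < l"
  shows "(\<integral>\<^sup>+x. ennreal (exp (- l * x) * rl_kernel \<beta> x) \<partial>lborel) = ennreal (l powr (- \<beta>))"
proof -
  have G: "Gamma \<beta> > 0" using \<beta> by (rule Gamma_real_pos)
  have eq: "ennreal (exp (- l * (0 + 1 / l * x)) * rl_kernel \<beta> (0 + 1 / l * x)) =
      ennreal (l powr (1 - \<beta>) / Gamma \<beta>) * ennreal (indicator {0..} x * x powr (\<beta> - 1) / exp x)" for x
  proof (cases "0 < x")
    case True
    have "(x / l) powr (\<beta> - 1) = x powr (\<beta> - 1) * l powr (1 - \<beta>)"
      using True l by (simp add: powr_divide powr_diff field_simps)
    then show ?thesis using True l G
      by (simp add: rl_kernel_def exp_minus ennreal_mult'[symmetric] field_simps)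
  next
    case False
    then have "1 / l * x \<le> 0" using l by (simp add: divide_nonpos_pos)
    then show ?thesis using False by (cases "x = 0") auto
  qed
  have "(\<integral>\<^sup>+x. ennreal (exp (- l * x) * rl_kernel \<beta> x) \<partial>lborel) =
      ennreal \<bar>1 / l\<bar> * (\<integral>\<^sup>+x. ennreal (exp (- l * (0 + 1 / l * x)) * rl_kernel \<beta> (0 + 1 / l * x)) \<partial>lborel)"
    by (rule nn_integral_real_affine) (use l in auto)
  also have "\<dots> = ennreal (1 / l) * (ennreal (l powr (1 - \<beta>) / Gamma \<beta>) * ennreal (Gamma \<beta>))"
    unfolding eq Gamma_conv_nn_integral_real[OF \<beta>] using l by (subst nn_integral_cmult) auto
  also have "\<dots> = ennreal (1 / l * (l powr (1 - \<beta>)))"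
    using l G by (simp add: ennreal_mult[symmetric])
  also have "1 / l * l powr (1 - \<beta>) = l powr (- \<beta>)"
    using l by (simp add: powr_diff powr_minus field_simps)
  finally show ?thesis .
qed

text \<open>The weight \<open>exp (- l * t)\<close> makes \<open>majorant\<close> below a contraction when \<open>l\<close> is large.\<close>

definition weighted_int :: "real \<Rightarrow> real \<Rightarrow> (real \<Rightarrow> ennreal) \<Rightarrow> ennreal" where
  "weighted_int T l u = (\<integral>\<^sup>+t. ennreal (indicator {..T} t * exp (- l * t)) * u t \<partial>lborel)"

definition kernel_sum :: "real^'m \<Rightarrow> real \<Rightarrow> real" where
  "kernel_sum \<alpha> x = (\<Sum>i\<in>UNIV. rl_kernel (\<alpha> $ i) x)"

definition entry_sum :: "(real \<Rightarrow> real^'m^'m) \<Rightarrow> real \<Rightarrow> real" where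
  "entry_sum A \<tau> = (\<Sum>i\<in>UNIV. \<Sum>j\<in>UNIV. \<bar>A \<tau> $ i $ j\<bar>)"

text \<open>A scalar operator that dominates the norm of the convolution of the kernels with
  \<open>A *v v\<close> when \<open>u\<close> is the norm of \<open>v\<close>. With values in
  \<open>ennreal\<close> it can be applied before any convergence is known.\<close>

definition majorant :: "real^'m \<Rightarrow> (real \<Rightarrow> real^'m^'m) \<Rightarrow> (real \<Rightarrow> ennreal) \<Rightarrow> real \<Rightarrow> ennreal" where
  "majorant \<alpha> A u t = (\<integral>\<^sup>+\<tau>. ennreal (kernel_sum \<alpha> (t - \<tau>)) * (ennreal (entry_sum A \<tau>) * u \<tau>) \<partial>lborel)"

lemma kernel_sum_measurable[measurable]: "kernel_sum \<alpha> \<in> borel_measurable borel"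
  unfolding kernel_sum_def[abs_def] by measurable

lemma entry_sum_measurable:
  assumes "\<And>i j. (\<lambda>t. A t $ i $ j) \<in> borel_measurable borel"
  shows "entry_sum A \<in> borel_measurable borel"
  unfolding entry_sum_def[abs_def] using assms by measurable

lemma entry_sum_nonneg: "0 \<le> entry_sum A \<tau>"
  unfolding entry_sum_def by (intro sum_nonneg) auto

lemma kernel_sum_nonneg: "(\<And>i. 0 < \<alpha> $ i) \<Longrightarrow> 0 \<le> kernel_sum \<alpha> x"
  unfolding kernel_sum_def by (auto intro!: sum_nonneg rl_kernel_nonneg)

lemma kernel_sum_nonpos_arg: "x \<le> 0 \<Longrightarrow> kernel_sum \<alpha> x = 0"
  by (simp add: kernel_sum_def)

lemma majorant_measurable:
  assumes "\<And>i j. (\<lambda>t. A t $ i $ j) \<in> borel_measurable borel" and [measurable]: "u \<in> borel_measurable borel"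
  shows "majorant \<alpha> A u \<in> borel_measurable borel"
proof -
  note [measurable] = entry_sum_measurable[of A, OF assms(1)]
  show ?thesis unfolding majorant_def[abs_def] by measurable
qed

lemma weighted_int_mono_AE:
  "(AE t in lborel. t \<le> T \<longrightarrow> u t \<le> v t) \<Longrightarrow> weighted_int T l u \<le> weighted_int T l v"
  unfolding weighted_int_def by (intro nn_integral_mono_AE) (auto elim!: eventually_mono simp: indicator_def intro!: mult_left_mono)

lemma weighted_int_zero_AE:
  assumes "u \<in> borel_measurable borel" "weighted_int T l u = 0"
  shows "AE t in lborel. t \<le> T \<longrightarrow> u t = 0"
proof -
  have "AE t in lborel. ennreal (indicator {..T} t * exp (- l * t)) * u t = 0"
    using assms by (subst nn_integral_0_iff_AE[symmetric]) (auto simp: weighted_int_def)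
  then show ?thesis by eventually_elim (auto simp: indicator_def)
qed

lemma weighted_int_finite_AE:
  assumes "u \<in> borel_measurable borel" "weighted_int T l u < \<infinity>"
  shows "AE t in lborel. t \<le> T \<longrightarrow> u t < \<infinity>"
proof -
  have "AE t in lborel. ennreal (indicator {..T} t * exp (- l * t)) * u t \<noteq> \<infinity>"
    using assms by (intro nn_integral_PInf_AE) (auto simp: weighted_int_def)
  then show ?thesis by eventually_elim (auto simp: indicator_def ennreal_mult_eq_top_iff less_top)
qed

text \<open>Tonelli: for fixed \<open>\<tau>\<close>, shifting the exponential weight by
  \<open>\<tau>\<close> leaves \<open>exp (- l * \<tau>)\<close> times the Laplace transforms of the
  kernels.\<close>

lemma weighted_int_majorant_le:
  fixes \<alpha> :: "real^'m"
  assumes \<alpha>: "\<And>i. 0 < \<alpha> $ i" and A: "\<And>i j. (\<lambda>t. A t $ i $ j) \<in> borel_measurable borel"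
    and C: "AE t in lborel. t \<le> T \<longrightarrow> entry_sum A t \<le> C" and C0: "0 \<le> C" and l: "0 < l"
    and u[measurable]: "u \<in> borel_measurable borel"
  shows "weighted_int T l (majorant \<alpha> A u) \<le> ennreal (C * (\<Sum>i\<in>UNIV. l powr (- \<alpha> $ i))) * weighted_int T l u"
proof -
  note [measurable] = entry_sum_measurable[of A, OF A]
  define R where "R = (\<Sum>i\<in>UNIV. l powr (- \<alpha> $ i))"
  have R: "0 \<le> R" by (simp add: R_def sum_nonneg)
  let ?w = "\<lambda>t. ennreal (indicator {..T} t * exp (- l * t))"
  have inner: "(\<integral>\<^sup>+t. ?w t * ennreal (kernel_sum \<alpha> (t - \<tau>)) \<partial>lborel) \<le> ?w \<tau> * ennreal R" for \<tau>
  proof (cases "\<tau> \<le> T")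
    case True
    have "(\<integral>\<^sup>+t. ?w t * ennreal (kernel_sum \<alpha> (t - \<tau>)) \<partial>lborel) \<le> (\<integral>\<^sup>+t. ennreal (exp (- l * t)) * ennreal (kernel_sum \<alpha> (t - \<tau>)) \<partial>lborel)"
      by (intro nn_integral_mono mult_right_mono) (auto simp: indicator_def)
    also have "\<dots> = ennreal \<bar>1\<bar> * (\<integral>\<^sup>+x. ennreal (exp (- l * (\<tau> + 1 * x))) * ennreal (kernel_sum \<alpha> ((\<tau> + 1 * x) - \<tau>)) \<partial>lborel)"
      by (rule nn_integral_real_affine) auto
    also have "\<dots> = (\<integral>\<^sup>+x. ennreal (exp (- l * \<tau>)) * ennreal (exp (- l * x) * kernel_sum \<alpha> x) \<partial>lborel)"
      using kernel_sum_nonneg[of \<alpha>, OF \<alpha>]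
      by (auto intro!: nn_integral_cong simp: ennreal_mult[symmetric] exp_add[symmetric] algebra_simps)
    also have "\<dots> = ennreal (exp (- l * \<tau>)) * (\<integral>\<^sup>+x. (\<Sum>i\<in>UNIV. ennreal (exp (- l * x) * rl_kernel (\<alpha> $ i) x)) \<partial>lborel)"
      using rl_kernel_nonneg[OF \<alpha>] by (subst nn_integral_cmult) (auto simp: kernel_sum_def sum_distrib_left)
    also have "\<dots> = ennreal (exp (- l * \<tau>)) * (\<Sum>i\<in>UNIV. ennreal (l powr (- \<alpha> $ i)))"
      by (subst nn_integral_sum) (simp_all only: rl_kernel_laplace[OF \<alpha> l], measurable)
    also have "\<dots> = ?w \<tau> * ennreal R" using True by (simp add: R_def)
    finally show ?thesis .
  next
    case False
    have "(\<integral>\<^sup>+t. ?w t * ennreal (kernel_sum \<alpha> (t - \<tau>)) \<partial>lborel) = (\<integral>\<^sup>+(t::real). 0 \<partial>lborel)"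
    proof (rule nn_integral_cong)
      fix t show "?w t * ennreal (kernel_sum \<alpha> (t - \<tau>)) = 0"
        using False by (cases "t \<le> T") (auto simp: kernel_sum_nonpos_arg)
    qed
    then show ?thesis by simp
  qed
  have "weighted_int T l (majorant \<alpha> A u) = (\<integral>\<^sup>+t. \<integral>\<^sup>+\<tau>. ?w t * (ennreal (kernel_sum \<alpha> (t - \<tau>)) * (ennreal (entry_sum A \<tau>) * u \<tau>)) \<partial>lborel \<partial>lborel)"
    unfolding weighted_int_def majorant_def by (intro nn_integral_cong nn_integral_cmult[symmetric]) measurable
  also have "\<dots> = (\<integral>\<^sup>+\<tau>. \<integral>\<^sup>+t. ?w t * (ennreal (kernel_sum \<alpha> (t - \<tau>)) * (ennreal (entry_sum A \<tau>) * u \<tau>)) \<partial>lborel \<partial>lborel)"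
    by (rule lborel_pair.Fubini') measurable
  also have "\<dots> = (\<integral>\<^sup>+\<tau>. (\<integral>\<^sup>+t. ?w t * ennreal (kernel_sum \<alpha> (t - \<tau>)) \<partial>lborel) * (ennreal (entry_sum A \<tau>) * u \<tau>) \<partial>lborel)"
    by (intro nn_integral_cong) (simp add: nn_integral_multc[symmetric] mult.assoc)
  also have "\<dots> \<le> (\<integral>\<^sup>+\<tau>. (?w \<tau> * ennreal R) * (ennreal (entry_sum A \<tau>) * u \<tau>) \<partial>lborel)"
    by (intro nn_integral_mono mult_right_mono inner) auto
  also have "\<dots> \<le> (\<integral>\<^sup>+\<tau>. ennreal (C * R) * (?w \<tau> * u \<tau>) \<partial>lborel)"
  proof (rule nn_integral_mono_AE)
    show "AE \<tau> in lborel. (?w \<tau> * ennreal R) * (ennreal (entry_sum A \<tau>) * u \<tau>) \<le> ennreal (C * R) * (?w \<tau> * u \<tau>)"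
      using C
    proof eventually_elim
      case (elim \<tau>)
      show ?case
      proof (cases "\<tau> \<le> T")
        case True
        then have "ennreal (entry_sum A \<tau>) \<le> ennreal C" using elim by (intro ennreal_leI) simp
        then have "ennreal (entry_sum A \<tau>) * (?w \<tau> * ennreal R * u \<tau>) \<le> ennreal C * (?w \<tau> * ennreal R * u \<tau>)"
          by (rule mult_right_mono) simp
        then show ?thesis using C0 R by (simp add: ennreal_mult mult_ac)
      qed simp
    qed
  qed
  also have "\<dots> = ennreal (C * R) * weighted_int T l u"
    unfolding weighted_int_def by (rule nn_integral_cmult) measurable
  finally show ?thesis by (simp add: R_def)
qed

lemma entry_sum_bounded:
  assumes A: "\<And>i j. loc_bdd I (\<lambda>t. A t $ i $ j)" and T: "T \<in> I"
  shows "\<exists>C\<ge>0. AE t in lborel. t \<le> T \<longrightarrow> entry_sum A t \<le> C"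
proof -
  have "\<forall>i j. \<exists>C. AE x in lborel. x \<le> T \<longrightarrow> \<bar>A x $ i $ j\<bar> \<le> C" using A T unfolding loc_bdd_def by blast
  then obtain C where C: "\<And>i j. AE x in lborel. x \<le> T \<longrightarrow> \<bar>A x $ i $ j\<bar> \<le> C i j"
    unfolding choice_iff by blast
  then have "AE x in lborel. \<forall>i j. x \<le> T \<longrightarrow> \<bar>A x $ i $ j\<bar> \<le> C i j" by (simp only: eventually_all_finite_iff) blast
  then have "AE x in lborel. x \<le> T \<longrightarrow> entry_sum A x \<le> max 0 (\<Sum>i\<in>UNIV. \<Sum>j\<in>UNIV. C i j)"
    unfolding entry_sum_def by eventually_elim (auto intro!: max.coboundedI2 sum_mono)
  then show ?thesis by (intro exI[of _ "max 0 (\<Sum>i\<in>UNIV. \<Sum>j\<in>UNIV. C i j)"]) auto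
qed

text \<open>Each \<open>l powr (- \<alpha> $ i)\<close> tends to 0 as \<open>l\<close> grows. Any
  factor below 1 would serve as well as 1/2; what matters is that \<open>l\<close> depends on no
  initial time.\<close>

lemma majorant_contraction:
  fixes \<alpha> :: "real^'m"
  assumes \<alpha>: "\<And>i. 0 < \<alpha> $ i" and A: "\<And>i j. loc_bdd I (\<lambda>t. A t $ i $ j)" and T: "T \<in> I"
  shows "\<exists>l>0. \<forall>u\<in>borel_measurable borel. weighted_int T l (majorant \<alpha> A u) \<le> ennreal (1/2) * weighted_int T l u"
proof -
  obtain C where C: "C \<ge> 0" "AE t in lborel. t \<le> T \<longrightarrow> entry_sum A t \<le> C" using entry_sum_bounded[OF A T] by blast
  have "((\<lambda>l. C * (\<Sum>i\<in>UNIV. l powr (- \<alpha> $ i))) \<longlongrightarrow> C * (\<Sum>i\<in>(UNIV::'m set). 0)) at_top"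
  proof (intro tendsto_mult tendsto_sum tendsto_const)
    show "((\<lambda>l. l powr (- \<alpha> $ i)) \<longlongrightarrow> 0) at_top" for i
      by (rule tendsto_neg_powr[OF _ filterlim_ident]) (use \<alpha>[of i] in simp)
  qed
  then have "\<forall>\<^sub>F l in at_top. C * (\<Sum>i\<in>UNIV. l powr (- \<alpha> $ i)) < 1/2"
    by (intro order_tendstoD(2)) auto
  then have "\<forall>\<^sub>F l in at_top. C * (\<Sum>i\<in>UNIV. l powr (- \<alpha> $ i)) < 1/2 \<and> 0 < l"
    using eventually_gt_at_top[of "0::real"] by eventually_elim simp
  then obtain l where l: "C * (\<Sum>i\<in>UNIV. l powr (- \<alpha> $ i)) < 1/2" "0 < l"
    by (auto simp: eventually_at_top_linorder)
  have "weighted_int T l (majorant \<alpha> A u) \<le> ennreal (1/2) * weighted_int T l u" if "u \<in> borel_measurable borel" for u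
  proof -
    have "weighted_int T l (majorant \<alpha> A u) \<le> ennreal (C * (\<Sum>i\<in>UNIV. l powr (- \<alpha> $ i))) * weighted_int T l u"
      using C that l \<alpha> A by (intro weighted_int_majorant_le) (auto simp: loc_bdd_def)
    also have "\<dots> \<le> ennreal (1/2) * weighted_int T l u"
      using l by (intro mult_right_mono ennreal_leI) auto
    finally show ?thesis .
  qed
  with l show ?thesis by blast
qed

section \<open>Domination by the majorant, and uniqueness\<close>

lemma matrix_vector_mult_component_le:
  "\<bar>(A \<tau> *v x) $ i\<bar> \<le> entry_sum A \<tau> * norm x"
proof -
  have "\<bar>(A \<tau> *v x) $ i\<bar> \<le> (\<Sum>j\<in>UNIV. \<bar>A \<tau> $ i $ j\<bar> * \<bar>x $ j\<bar>)"
    unfolding matrix_vector_mult_def by (simp add: abs_mult[symmetric])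
  also have "\<dots> \<le> (\<Sum>j\<in>UNIV. \<bar>A \<tau> $ i $ j\<bar>) * norm x"
    unfolding sum_distrib_right by (intro sum_mono mult_left_mono component_le_norm_cart) auto
  also have "(\<Sum>j\<in>UNIV. \<bar>A \<tau> $ i $ j\<bar>) \<le> entry_sum A \<tau>"
    unfolding entry_sum_def by (rule member_le_sum) (auto intro: sum_nonneg)
  finally show ?thesis by (simp add: mult_right_mono)
qed

text \<open>A function that is not integrable has integral 0, so none of the estimates by
  \<open>majorant\<close> has to assume convergence.\<close>

lemma ennreal_abs_integral_le:
  fixes f :: "'a \<Rightarrow> real"
  shows "ennreal \<bar>integral\<^sup>L M f\<bar> \<le> (\<integral>\<^sup>+x. ennreal \<bar>f x\<bar> \<partial>M)"
proof (cases "integrable M f")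
  case True
  then show ?thesis using integral_norm_bound_ennreal[OF True] by simp
qed (simp add: not_integrable_integral_eq)

lemma norm_rl_int_vec_le:
  fixes \<alpha> :: "real^'m"
  assumes \<alpha>: "\<And>i. 0 < \<alpha> $ i" and A: "\<And>i j. (\<lambda>t. A t $ i $ j) \<in> borel_measurable borel"
    and v: "\<And>i. (\<lambda>t. v t $ i) \<in> borel_measurable borel"
  shows "ennreal (norm (rl_int_vec \<alpha> (\<lambda>\<tau>. A \<tau> *v v \<tau>) t)) \<le> majorant \<alpha> A (\<lambda>\<tau>. ennreal (norm (v \<tau>))) t"
proof -
  have m: "(\<lambda>\<tau>. (A \<tau> *v v \<tau>) $ i) \<in> borel_measurable borel" for i
    unfolding matrix_vector_mult_def using A v by simp
  have "ennreal (norm (rl_int_vec \<alpha> (\<lambda>\<tau>. A \<tau> *v v \<tau>) t)) \<le> ennreal (\<Sum>i\<in>UNIV. \<bar>rl_int (\<alpha> $ i) (\<lambda>\<tau>. (A \<tau> *v v \<tau>) $ i) t\<bar>)"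
    using norm_le_l1_cart[of "rl_int_vec \<alpha> (\<lambda>\<tau>. A \<tau> *v v \<tau>) t"] by (intro ennreal_leI) (simp add: rl_int_vec_def)
  also have "\<dots> = (\<Sum>i\<in>UNIV. ennreal \<bar>rl_int (\<alpha> $ i) (\<lambda>\<tau>. (A \<tau> *v v \<tau>) $ i) t\<bar>)"
    by (simp add: sum_ennreal)
  also have "\<dots> \<le> (\<Sum>i\<in>UNIV. \<integral>\<^sup>+\<tau>. ennreal \<bar>rl_kernel (\<alpha> $ i) (t - \<tau>) * (A \<tau> *v v \<tau>) $ i\<bar> \<partial>lborel)"
    unfolding rl_int_def by (intro sum_mono ennreal_abs_integral_le)
  also have "\<dots> = (\<integral>\<^sup>+\<tau>. (\<Sum>i\<in>UNIV. ennreal \<bar>rl_kernel (\<alpha> $ i) (t - \<tau>) * (A \<tau> *v v \<tau>) $ i\<bar>) \<partial>lborel)"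
    using m by (intro nn_integral_sum[symmetric]) measurable
  also have "\<dots> \<le> majorant \<alpha> A (\<lambda>\<tau>. ennreal (norm (v \<tau>))) t"
    unfolding majorant_def
  proof (rule nn_integral_mono)
    fix \<tau>
    have "(\<Sum>i\<in>UNIV. \<bar>rl_kernel (\<alpha> $ i) (t - \<tau>) * (A \<tau> *v v \<tau>) $ i\<bar>) \<le> (\<Sum>i\<in>UNIV. rl_kernel (\<alpha> $ i) (t - \<tau>) * (entry_sum A \<tau> * norm (v \<tau>)))"
      using rl_kernel_nonneg[OF \<alpha>] by (intro sum_mono) (auto simp: abs_mult intro!: mult_left_mono matrix_vector_mult_component_le)
    also have "\<dots> = kernel_sum \<alpha> (t - \<tau>) * (entry_sum A \<tau> * norm (v \<tau>))" by (simp add: kernel_sum_def sum_distrib_right)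
    finally have "ennreal (\<Sum>i\<in>UNIV. \<bar>rl_kernel (\<alpha> $ i) (t - \<tau>) * (A \<tau> *v v \<tau>) $ i\<bar>) \<le> ennreal (kernel_sum \<alpha> (t - \<tau>) * (entry_sum A \<tau> * norm (v \<tau>)))"
      by (rule ennreal_leI)
    then show "(\<Sum>i\<in>UNIV. ennreal \<bar>rl_kernel (\<alpha> $ i) (t - \<tau>) * (A \<tau> *v v \<tau>) $ i\<bar>) \<le> ennreal (kernel_sum \<alpha> (t - \<tau>)) * (ennreal (entry_sum A \<tau>) * ennreal (norm (v \<tau>)))"
      using kernel_sum_nonneg[of \<alpha>, OF \<alpha>] entry_sum_nonneg[of A] by (simp add: sum_ennreal ennreal_mult[symmetric])
  qed
  finally show ?thesis .
qed

lemma norm_measurable_vec: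
  fixes v :: "'a \<Rightarrow> real^'m"
  assumes "\<And>i. (\<lambda>t. v t $ i) \<in> borel_measurable M"
  shows "(\<lambda>t. norm (v t)) \<in> borel_measurable M"
  unfolding norm_vec_def L2_set_def using assms by measurable

lemma vec_loc_int_measurable: "vec_loc_int I v \<Longrightarrow> (\<lambda>t. v t $ i) \<in> borel_measurable borel"
  by (simp add: vec_loc_int_def loc_int_def)

lemma vec_loc_int_zero: "vec_loc_int I v \<Longrightarrow> x \<notin> I \<Longrightarrow> v x = 0"
  by (simp add: vec_loc_int_def loc_int_def vec_eq_iff)

lemma vec_loc_int_below: "I \<in> intervals_from a \<Longrightarrow> vec_loc_int I v \<Longrightarrow> x < a \<Longrightarrow> v x = 0"
  using intervals_fromD(2)[of I a x] by (intro vec_loc_int_zero[of I]) force+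

lemma vec_loc_int_norm_finite:
  fixes v :: "real \<Rightarrow> real^'m"
  assumes v: "vec_loc_int I v" and T: "T \<in> I"
  shows "(\<integral>\<^sup>+t. ennreal (indicator {..T} t * norm (v t)) \<partial>lborel) < \<infinity>"
proof -
  have i: "integrable lborel (\<lambda>t. \<bar>indicator {..T} t * v t $ i\<bar>)" for i
    using v T by (simp add: vec_loc_int_def loc_int_def)
  then have "integrable lborel (\<lambda>t. \<Sum>i\<in>UNIV. \<bar>indicator {..T} t * v t $ i\<bar>)" by (rule Bochner_Integration.integrable_sum)
  then have "(\<integral>\<^sup>+t. ennreal (norm (\<Sum>i\<in>UNIV. \<bar>indicator {..T} t * v t $ i\<bar>)) \<partial>lborel) < \<infinity>"
    by (simp add: integrable_iff_bounded)
  moreover have "(\<integral>\<^sup>+t. ennreal (indicator {..T} t * norm (v t)) \<partial>lborel) \<le> (\<integral>\<^sup>+t. ennreal (norm (\<Sum>i\<in>UNIV. \<bar>indicator {..T} t * v t $ i\<bar>)) \<partial>lborel)"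
    using norm_le_l1_cart by (intro nn_integral_mono ennreal_leI) (auto simp: indicator_def)
  ultimately show ?thesis by (rule le_less_trans[rotated])
qed

text \<open>With the next lemma: on \<open>{a..T}\<close> the weight lies between positive
  constants, so for functions that vanish before \<open>a\<close> weighted and unweighted integrals
  are finite together.\<close>

lemma weighted_int_le_integral:
  assumes l: "0 \<le> l" and u: "u \<in> borel_measurable borel" "\<And>t. t < a \<Longrightarrow> u t = 0"
  shows "weighted_int T l u \<le> ennreal (exp (- l * a)) * (\<integral>\<^sup>+t. indicator {..T} t * u t \<partial>lborel)"
proof -
  have "weighted_int T l u \<le> (\<integral>\<^sup>+t. ennreal (exp (- l * a)) * (indicator {..T} t * u t) \<partial>lborel)"
    unfolding weighted_int_def
  proof (rule nn_integral_mono)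
    fix t show "ennreal (indicator {..T} t * exp (- l * t)) * u t \<le> ennreal (exp (- l * a)) * (indicator {..T} t * u t)"
      using l by (cases "t < a") (auto simp: u(2) indicator_def intro!: mult_right_mono ennreal_leI mult_left_mono)
  qed
  also have "\<dots> = ennreal (exp (- l * a)) * (\<integral>\<^sup>+t. indicator {..T} t * u t \<partial>lborel)"
    using u(1) by (intro nn_integral_cmult) measurable
  finally show ?thesis .
qed

lemma integral_le_weighted_int:
  assumes l: "0 \<le> l" and u: "u \<in> borel_measurable borel"
  shows "(\<integral>\<^sup>+t. indicator {..T} t * u t \<partial>lborel) \<le> ennreal (exp (l * T)) * weighted_int T l u"
proof -
  have "(\<integral>\<^sup>+t. indicator {..T} t * u t \<partial>lborel) \<le> (\<integral>\<^sup>+t. ennreal (exp (l * T)) * (ennreal (indicator {..T} t * exp (- l * t)) * u t) \<partial>lborel)"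
  proof (rule nn_integral_mono)
    fix t show "indicator {..T} t * u t \<le> ennreal (exp (l * T)) * (ennreal (indicator {..T} t * exp (- l * t)) * u t)"
    proof (cases "t \<le> T")
      case True
      then have "l * t \<le> l * T" using l by (rule mult_left_mono)
      then have "1 \<le> exp (l * T) * exp (- l * t)" by (simp add: exp_add[symmetric])
      then have "1 \<le> ennreal (exp (l * T) * exp (- l * t))" using ennreal_leI by fastforce
      then have "1 * u t \<le> ennreal (exp (l * T) * exp (- l * t)) * u t" by (rule mult_right_mono) simp
      with True show ?thesis by (simp add: ennreal_mult mult.assoc)
    qed simp
  qed
  also have "\<dots> = ennreal (exp (l * T)) * weighted_int T l u"
    unfolding weighted_int_def using u by (intro nn_integral_cmult) measurable
  finally show ?thesis .
qed

text \<open>The weighted integral of the norm is at most half of itself, hence 0, because local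
  integrability of \<open>v\<close> makes it finite.\<close>

lemma volterra_unique_zero:
  fixes \<alpha> :: "real^'m"
  assumes I: "I \<in> intervals_from a" and \<alpha>: "\<And>i. 0 < \<alpha> $ i" and A: "\<And>i j. loc_bdd I (\<lambda>t. A t $ i $ j)"
    and v: "vec_loc_int I v" and eq: "AE t\<in>I in lborel. v t = rl_int_vec \<alpha> (\<lambda>\<tau>. A \<tau> *v v \<tau>) t"
  shows "AE t\<in>I in lborel. v t = 0"
proof (rule AE_on_interval[OF I])
  note ID = intervals_fromD[OF I]
  fix T assume T: "T \<in> I"
  obtain l where l: "l > 0" "\<And>u. u \<in> borel_measurable borel \<Longrightarrow> weighted_int T l (majorant \<alpha> A u) \<le> ennreal (1/2) * weighted_int T l u"
    using majorant_contraction[of \<alpha>, OF \<alpha> A T] by blast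
  define u where "u t = ennreal (norm (v t))" for t
  have u[measurable]: "u \<in> borel_measurable borel"
    unfolding u_def[abs_def] using norm_measurable_vec[of v] vec_loc_int_measurable[OF v] by measurable
  have Am: "(\<lambda>t. A t $ i $ j) \<in> borel_measurable borel" for i j using A by (simp add: loc_bdd_def)
  have "weighted_int T l u \<le> ennreal (exp (- l * a)) * (\<integral>\<^sup>+t. indicator {..T} t * u t \<partial>lborel)"
    using l(1) by (intro weighted_int_le_integral u) (auto simp: u_def vec_loc_int_below[OF I v])
  also have "(\<integral>\<^sup>+t. indicator {..T} t * u t \<partial>lborel) = (\<integral>\<^sup>+t. ennreal (indicator {..T} t * norm (v t)) \<partial>lborel)"
    by (intro nn_integral_cong) (auto simp: u_def indicator_def)
  finally have fin: "weighted_int T l u < \<infinity>"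
    using vec_loc_int_norm_finite[OF v T] by (auto simp: ennreal_mult_less_top intro: le_less_trans)
  have "weighted_int T l u \<le> weighted_int T l (majorant \<alpha> A u)"
  proof (rule weighted_int_mono_AE)
    show "AE t in lborel. t \<le> T \<longrightarrow> u t \<le> majorant \<alpha> A u t"
      using eq
    proof eventually_elim
      case (elim t)
      show ?case
      proof (intro impI, cases "t < a")
        case True
        then show "u t \<le> majorant \<alpha> A u t" by (simp add: u_def vec_loc_int_below[OF I v])
      next
        case False
        assume "t \<le> T"
        then have "t \<in> I" using False ID(3)[OF T] by auto
        then have "v t = rl_int_vec \<alpha> (\<lambda>\<tau>. A \<tau> *v v \<tau>) t" using elim by simp
        then show "u t \<le> majorant \<alpha> A u t"
          using norm_rl_int_vec_le[of \<alpha> A v t, OF \<alpha> Am vec_loc_int_measurable[OF v]] by (simp add: u_def[abs_def])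
      qed
    qed
  qed
  also have "\<dots> \<le> ennreal (1/2) * weighted_int T l u" using l(2)[OF u] .
  finally have "weighted_int T l u \<le> ennreal (1/2) * weighted_int T l u" .
  moreover obtain r where r: "0 \<le> r" "weighted_int T l u = ennreal r" using fin by (cases "weighted_int T l u") auto
  ultimately have "ennreal r \<le> ennreal (1/2 * r)" by (simp only: ennreal_mult'[symmetric])
  then have "r = 0" using r(1) by (simp add: ennreal_le_iff)
  then have "weighted_int T l u = 0" using r by simp
  from weighted_int_zero_AE[OF u this] show "AE t\<in>I in lborel. t \<le> T \<longrightarrow> v t = 0"
    by eventually_elim (simp add: u_def)
qed

text \<open>Integrating once more raises the order to \<open>1 + \<alpha>\<close>, where the
  convolution is finite at \<open>T\<close>; so the inner integral is finite at almost every earlier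
  time.\<close>

lemma rl_int_integrable_AE:
  assumes I: "I \<in> intervals_from a" and h: "loc_int I h" and \<alpha>: "0 < \<alpha>"
  shows "AE t\<in>I in lborel. integrable lborel (\<lambda>\<tau>. rl_kernel \<alpha> (t - \<tau>) * h \<tau>)"
proof (rule AE_on_interval[OF I])
  note [measurable] = loc_int_measurable[OF h]
  fix T assume T: "T \<in> I"
  define w where "w t = (\<integral>\<^sup>+\<sigma>. ennreal (rl_kernel \<alpha> (t - \<sigma>)) * ennreal \<bar>h \<sigma>\<bar> \<partial>lborel)" for t
  have [measurable]: "w \<in> borel_measurable borel" unfolding w_def[abs_def] by measurable
  have "(\<integral>\<^sup>+\<tau>. ennreal (rl_kernel 1 (T - \<tau>)) * w \<tau> \<partial>lborel) = (\<integral>\<^sup>+\<sigma>. ennreal (rl_kernel (1 + \<alpha>) (T - \<sigma>)) * ennreal \<bar>h \<sigma>\<bar> \<partial>lborel)"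
    unfolding w_def by (rule rl_kernel_assoc_nn) (use \<alpha> in auto)
  also have "\<dots> < \<infinity>" by (rule rl_int_abs_finite[OF I h T]) (use \<alpha> in auto)
  finally have "AE \<tau> in lborel. ennreal (rl_kernel 1 (T - \<tau>)) * w \<tau> \<noteq> \<infinity>" by (intro nn_integral_PInf_AE) auto
  then show "AE t\<in>I in lborel. t \<le> T \<longrightarrow> integrable lborel (\<lambda>\<tau>. rl_kernel \<alpha> (t - \<tau>) * h \<tau>)"
    using AE_lborel_singleton[of T]
  proof eventually_elim
    case (elim t)
    show ?case
    proof (intro impI)
      assume "t \<le> T"
      then have "w t < \<infinity>" using elim by (auto simp: rl_kernel_1 less_top)
      then show "integrable lborel (\<lambda>\<tau>. rl_kernel \<alpha> (t - \<tau>) * h \<tau>)"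
        using rl_kernel_nonneg[OF \<alpha>] by (intro integrableI_bounded) (auto simp: w_def abs_mult ennreal_mult)
    qed
  qed
qed

text \<open>Linearity can fail where a convolution diverges and its integral defaults to 0, hence
  the exceptional null set.\<close>

lemma rl_int_vec_diff_AE:
  fixes \<alpha> :: "real^'m"
  assumes I: "I \<in> intervals_from a" and \<alpha>: "\<And>i. 0 < \<alpha> $ i" and f: "vec_loc_int I f" and g: "vec_loc_int I g"
  shows "AE t\<in>I in lborel. rl_int_vec \<alpha> (\<lambda>\<tau>. f \<tau> - g \<tau>) t = rl_int_vec \<alpha> f t - rl_int_vec \<alpha> g t"
proof -
  have "AE t in lborel. \<forall>i. t \<in> I \<longrightarrow> integrable lborel (\<lambda>\<tau>. rl_kernel (\<alpha> $ i) (t - \<tau>) * f \<tau> $ i)"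
    using rl_int_integrable_AE[OF I _ \<alpha>] f by (simp only: eventually_all_finite_iff vec_loc_int_def) blast
  moreover have "AE t in lborel. \<forall>i. t \<in> I \<longrightarrow> integrable lborel (\<lambda>\<tau>. rl_kernel (\<alpha> $ i) (t - \<tau>) * g \<tau> $ i)"
    using rl_int_integrable_AE[OF I _ \<alpha>] g by (simp only: eventually_all_finite_iff vec_loc_int_def) blast
  ultimately show ?thesis
    by eventually_elim (simp add: vec_eq_iff rl_int_vec_def rl_int_def right_diff_distrib)
qed

lemma volterra_unique:
  fixes \<alpha> :: "real^'m"
  assumes I: "I \<in> intervals_from a" and \<alpha>: "\<And>i. 0 < \<alpha> $ i" and A: "\<And>i j. loc_bdd I (\<lambda>t. A t $ i $ j)"
    and B: "vec_loc_int I B" and v: "vec_loc_int I v" and w: "vec_loc_int I w"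
    and eqv: "AE t\<in>I in lborel. v t = f t + rl_int_vec \<alpha> (\<lambda>\<tau>. A \<tau> *v v \<tau> + B \<tau>) t"
    and eqw: "AE t\<in>I in lborel. w t = f t + rl_int_vec \<alpha> (\<lambda>\<tau>. A \<tau> *v w \<tau> + B \<tau>) t"
  shows "AE t\<in>I in lborel. v t = w t"
proof -
  have "AE t\<in>I in lborel. rl_int_vec \<alpha> (\<lambda>\<tau>. (A \<tau> *v v \<tau> + B \<tau>) - (A \<tau> *v w \<tau> + B \<tau>)) t =
      rl_int_vec \<alpha> (\<lambda>\<tau>. A \<tau> *v v \<tau> + B \<tau>) t - rl_int_vec \<alpha> (\<lambda>\<tau>. A \<tau> *v w \<tau> + B \<tau>) t"
    by (intro rl_int_vec_diff_AE[OF I \<alpha>] vec_loc_int_add vec_loc_int_matrix_mult A B v w)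
  then have "AE t\<in>I in lborel. v t - w t = rl_int_vec \<alpha> (\<lambda>\<tau>. A \<tau> *v (v \<tau> - w \<tau>)) t"
    using eqv eqw by eventually_elim (auto simp: matrix_vector_mult_diff_distrib)
  from volterra_unique_zero[OF I \<alpha> A vec_loc_int_diff[OF v w] this]
  show ?thesis by eventually_elim simp
qed

section \<open>The Picard series, jointly in initial and current time\<close>

primrec picard :: "real^'m \<Rightarrow> (real \<Rightarrow> real^'m^'m) \<Rightarrow> (real \<Rightarrow> real \<Rightarrow> real^'m) \<Rightarrow> nat \<Rightarrow> real \<Rightarrow> real \<Rightarrow> real^'m" where
  "picard \<alpha> A F 0 = F"
| "picard \<alpha> A F (Suc n) = (\<lambda>s. rl_int_vec \<alpha> (\<lambda>\<tau>. A \<tau> *v picard \<alpha> A F n s \<tau>))"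

definition picard_sum :: "real^'m \<Rightarrow> (real \<Rightarrow> real^'m^'m) \<Rightarrow> (real \<Rightarrow> real \<Rightarrow> real^'m) \<Rightarrow> real \<Rightarrow> real \<Rightarrow> real^'m" where
  "picard_sum \<alpha> A F s t = (\<chi> i. \<Sum>n. picard \<alpha> A F n s t $ i)"

text \<open>Where this is finite, the componentwise limit \<open>picard_sum\<close> is meaningful;
  elsewhere that limit may be an unspecified value.\<close>

definition picard_norms :: "real^'m \<Rightarrow> (real \<Rightarrow> real^'m^'m) \<Rightarrow> (real \<Rightarrow> real \<Rightarrow> real^'m) \<Rightarrow> real \<Rightarrow> real \<Rightarrow> ennreal" where
  "picard_norms \<alpha> A F s t = (\<Sum>n. ennreal (norm (picard \<alpha> A F n s t)))"

text \<open>Integrals of jointly Borel functions stay Borel in their parameters. Carrying the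
  initial time as a parameter therefore yields joint measurability, which solving separately for
  each \<open>s\<close> would not.\<close>

lemma picard_measurable:
  fixes \<alpha> :: "real^'m"
  assumes A: "\<And>i j. (\<lambda>t. A t $ i $ j) \<in> borel_measurable borel"
    and F: "\<And>i. (\<lambda>p. F (fst p) (snd p) $ i) \<in> borel_measurable (borel \<Otimes>\<^sub>M borel)"
  shows "(\<lambda>p. picard \<alpha> A F n (fst p) (snd p) $ i) \<in> borel_measurable (borel \<Otimes>\<^sub>M borel)"
proof (induction n arbitrary: i)
  case 0
  then show ?case using F by simp
next
  case (Suc n)
  have p: "(\<lambda>q. picard \<alpha> A F n (fst (fst q)) (snd q) $ j) \<in> borel_measurable ((borel \<Otimes>\<^sub>M borel) \<Otimes>\<^sub>M lborel)" for j
    by (rule measurable_compose[of "\<lambda>q. (fst (fst q), snd q)" _ "borel \<Otimes>\<^sub>M borel", OF _ Suc, simplified]) measurable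
  have "(\<lambda>p. LINT \<tau>|lborel. rl_kernel (\<alpha> $ i) (snd p - \<tau>) * (\<Sum>j\<in>UNIV. A \<tau> $ i $ j * picard \<alpha> A F n (fst p) \<tau> $ j))
      \<in> borel_measurable (borel \<Otimes>\<^sub>M borel)"
  proof (rule lborel.borel_measurable_lebesgue_integral)
    note [measurable] = p A
    show "(\<lambda>(p, \<tau>). rl_kernel (\<alpha> $ i) (snd p - \<tau>) * (\<Sum>j\<in>UNIV. A \<tau> $ i $ j * picard \<alpha> A F n (fst p) \<tau> $ j))
      \<in> borel_measurable ((borel \<Otimes>\<^sub>M borel) \<Otimes>\<^sub>M lborel)"
      unfolding case_prod_unfold by measurable
  qed
  then show ?case by (simp add: rl_int_vec_def rl_int_def matrix_vector_mult_def)
qed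

lemma picard_sum_measurable:
  fixes \<alpha> :: "real^'m"
  assumes A: "\<And>i j. (\<lambda>t. A t $ i $ j) \<in> borel_measurable borel"
    and F: "\<And>i. (\<lambda>p. F (fst p) (snd p) $ i) \<in> borel_measurable (borel \<Otimes>\<^sub>M borel)"
  shows "(\<lambda>p. picard_sum \<alpha> A F (fst p) (snd p) $ i) \<in> borel_measurable (borel \<Otimes>\<^sub>M borel)"
  unfolding picard_sum_def using picard_measurable[OF A F] by (simp add: borel_measurable_suminf)

lemma section_measurable:
  assumes "(\<lambda>p. f (fst p) (snd p)) \<in> borel_measurable (borel \<Otimes>\<^sub>M borel)"
  shows "(\<lambda>t. f s t) \<in> borel_measurable borel"
  using measurable_compose[of "\<lambda>t. (s, t)" borel "borel \<Otimes>\<^sub>M borel", OF _ assms] by simp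

lemma picard_zero:
  assumes "\<And>s t. t \<le> s \<Longrightarrow> F s t = 0" "t \<le> s"
  shows "picard \<alpha> A F n s t = 0"
  using assms(2)
proof (induction n arbitrary: t)
  case (Suc n)
  have "rl_int (\<alpha> $ i) (\<lambda>\<tau>. (A \<tau> *v picard \<alpha> A F n s \<tau>) $ i) t = 0" for i
    by (rule rl_int_below[of s]) (use Suc in auto)
  then show ?case by (simp add: rl_int_vec_def vec_eq_iff)
qed (use assms(1) in simp)

lemma picard_sum_zero: "(\<And>s t. t \<le> s \<Longrightarrow> F s t = 0) \<Longrightarrow> t \<le> s \<Longrightarrow> picard_sum \<alpha> A F s t = 0"
  by (simp add: picard_sum_def picard_zero vec_eq_iff)

lemma weighted_int_suminf:
  assumes "\<And>n. u n \<in> borel_measurable borel"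
  shows "weighted_int T l (\<lambda>t. \<Sum>n. u n t) = (\<Sum>n. weighted_int T l (u n))"
  unfolding weighted_int_def ennreal_suminf_cmult[symmetric] using assms by (intro nn_integral_suminf) measurable

lemma majorant_suminf:
  assumes A: "\<And>i j. (\<lambda>t. A t $ i $ j) \<in> borel_measurable borel" and u: "\<And>n. u n \<in> borel_measurable borel"
  shows "majorant \<alpha> A (\<lambda>t. \<Sum>n. u n t) t = (\<Sum>n. majorant \<alpha> A (u n) t)"
proof -
  note [measurable] = entry_sum_measurable[of A, OF A] u
  show ?thesis
    unfolding majorant_def ennreal_suminf_cmult[symmetric] by (intro nn_integral_suminf) measurable
qed

lemma picard_sum_sums:
  assumes "picard_norms \<alpha> A F s t < \<infinity>"
  shows "(\<lambda>n. picard \<alpha> A F n s t $ i) sums (picard_sum \<alpha> A F s t $ i)"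
    and "ennreal (norm (picard_sum \<alpha> A F s t)) \<le> picard_norms \<alpha> A F s t"
proof -
  have sm: "summable (\<lambda>n. norm (picard \<alpha> A F n s t))"
  proof (rule summable_suminf_not_top)
    show "(\<Sum>n. ennreal (norm (picard \<alpha> A F n s t))) \<noteq> top"
      using assms unfolding picard_norms_def by (simp only: less_top infinity_ennreal_def)
  qed simp
  then have "summable (\<lambda>n. picard \<alpha> A F n s t)" by (rule summable_norm_cancel)
  then have s: "(\<lambda>n. picard \<alpha> A F n s t) sums (\<Sum>n. picard \<alpha> A F n s t)" by (rule summable_sums)
  then have si: "(\<lambda>n. picard \<alpha> A F n s t $ i) sums ((\<Sum>n. picard \<alpha> A F n s t) $ i)" for i
    by (rule bounded_linear.sums[OF bounded_linear_vec_nth])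
  then have eq: "picard_sum \<alpha> A F s t = (\<Sum>n. picard \<alpha> A F n s t)"
    by (simp add: picard_sum_def vec_eq_iff sums_iff)
  show "(\<lambda>n. picard \<alpha> A F n s t $ i) sums (picard_sum \<alpha> A F s t $ i)" using si eq by simp
  have "ennreal (norm (picard_sum \<alpha> A F s t)) \<le> ennreal (\<Sum>n. norm (picard \<alpha> A F n s t))"
    unfolding eq by (intro ennreal_leI summable_norm sm)
  also have "\<dots> = picard_norms \<alpha> A F s t"
    unfolding picard_norms_def using sm by (intro suminf_ennreal2[symmetric]) auto
  finally show "ennreal (norm (picard_sum \<alpha> A F s t)) \<le> picard_norms \<alpha> A F s t" .
qed

text \<open>Each iteration at least halves the weighted integral, so the series is bounded by a
  geometric one, whose sum is 2.\<close>

lemma picard_norms_weighted_int: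
  fixes \<alpha> :: "real^'m"
  assumes \<alpha>: "\<And>i. 0 < \<alpha> $ i" and A: "\<And>i j. (\<lambda>t. A t $ i $ j) \<in> borel_measurable borel"
    and p: "\<And>n i. (\<lambda>t. picard \<alpha> A F n s t $ i) \<in> borel_measurable borel"
    and l: "\<And>u. u \<in> borel_measurable borel \<Longrightarrow> weighted_int T l (majorant \<alpha> A u) \<le> ennreal (1/2) * weighted_int T l u"
  shows "weighted_int T l (picard_norms \<alpha> A F s) \<le> 2 * weighted_int T l (\<lambda>t. ennreal (norm (F s t)))"
proof -
  define u where "u n t = ennreal (norm (picard \<alpha> A F n s t))" for n t
  have u[measurable]: "u n \<in> borel_measurable borel" for n
    unfolding u_def[abs_def] using norm_measurable_vec[OF p] by measurable
  have b: "weighted_int T l (u n) \<le> ennreal ((1/2) ^ n) * weighted_int T l (u 0)" for n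
  proof (induction n)
    case (Suc n)
    have "weighted_int T l (u (Suc n)) \<le> weighted_int T l (majorant \<alpha> A (u n))"
    proof (intro weighted_int_mono_AE AE_I2 impI)
      fix t show "u (Suc n) t \<le> majorant \<alpha> A (u n) t"
        using norm_rl_int_vec_le[of \<alpha> A "picard \<alpha> A F n s" t, OF \<alpha> A p] by (simp add: u_def[abs_def])
    qed
    also have "\<dots> \<le> ennreal (1/2) * weighted_int T l (u n)" by (rule l[OF u])
    also have "\<dots> \<le> ennreal (1/2) * (ennreal ((1/2) ^ n) * weighted_int T l (u 0))" by (rule mult_left_mono[OF Suc]) simp
    also have "\<dots> = ennreal ((1/2) ^ Suc n) * weighted_int T l (u 0)"
      unfolding mult.assoc[symmetric] by (subst ennreal_mult[symmetric]) auto
    finally show ?case .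
  qed simp
  have "weighted_int T l (picard_norms \<alpha> A F s) = (\<Sum>n. weighted_int T l (u n))"
    using weighted_int_suminf[OF u, of T l] by (simp add: picard_norms_def[abs_def] u_def)
  also have "\<dots> \<le> (\<Sum>n. ennreal ((1/2) ^ n) * weighted_int T l (u 0))" by (intro suminf_le b) auto
  also have "\<dots> = (\<Sum>n. ennreal ((1/2) ^ n)) * weighted_int T l (u 0)" by (rule ennreal_suminf_multc)
  also have "(\<Sum>n. ennreal ((1/2) ^ n)) = ennreal 2"
    using geometric_sums[of "1/2::real"] by (intro suminf_ennreal_eq) auto
  finally show ?thesis by (simp add: u_def[abs_def])
qed

text \<open>Sum and integral are exchanged at times where the series of norms and its majorant are
  both finite, that is at almost every time up to \<open>T\<close>.\<close>

lemma picard_sum_solves: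
  fixes \<alpha> :: "real^'m"
  assumes \<alpha>: "\<And>i. 0 < \<alpha> $ i" and A: "\<And>i j. (\<lambda>t. A t $ i $ j) \<in> borel_measurable borel"
    and p: "\<And>n i. (\<lambda>t. picard \<alpha> A F n s t $ i) \<in> borel_measurable borel"
    and l: "\<And>u. u \<in> borel_measurable borel \<Longrightarrow> weighted_int T l (majorant \<alpha> A u) \<le> ennreal (1/2) * weighted_int T l u"
    and F: "weighted_int T l (\<lambda>t. ennreal (norm (F s t))) < \<infinity>"
  shows "AE t in lborel. t \<le> T \<longrightarrow> picard_sum \<alpha> A F s t = F s t + rl_int_vec \<alpha> (\<lambda>\<tau>. A \<tau> *v picard_sum \<alpha> A F s \<tau>) t"
    and "weighted_int T l (\<lambda>t. ennreal (norm (picard_sum \<alpha> A F s t))) \<le> 2 * weighted_int T l (\<lambda>t. ennreal (norm (F s t)))"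
proof -
  define u where "u n t = ennreal (norm (picard \<alpha> A F n s t))" for n t
  have u[measurable]: "u n \<in> borel_measurable borel" for n
    unfolding u_def[abs_def] using norm_measurable_vec[OF p] by measurable
  let ?S = "picard_norms \<alpha> A F s"
  have S_eq: "?S = (\<lambda>t. \<Sum>n. u n t)" by (simp add: picard_norms_def[abs_def] u_def)
  have Sm: "?S \<in> borel_measurable borel" unfolding S_eq by measurable
  note bound = picard_norms_weighted_int[of \<alpha> A F s T l, OF \<alpha> A p l]
  have fin: "weighted_int T l ?S < \<infinity>" using bound F by (auto simp: ennreal_mult_less_top intro: le_less_trans)
  have Sfin: "AE t in lborel. t \<le> T \<longrightarrow> ?S t < \<infinity>" by (rule weighted_int_finite_AE[OF Sm fin])
  have "weighted_int T l (\<lambda>t. ennreal (norm (picard_sum \<alpha> A F s t))) \<le> weighted_int T l ?S"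
    by (rule weighted_int_mono_AE) (use Sfin in \<open>eventually_elim, auto intro: picard_sum_sums(2)\<close>)
  also note bound
  finally show "weighted_int T l (\<lambda>t. ennreal (norm (picard_sum \<alpha> A F s t))) \<le> 2 * weighted_int T l (\<lambda>t. ennreal (norm (F s t)))" .
  have "weighted_int T l (majorant \<alpha> A ?S) < \<infinity>"
    by (rule le_less_trans[OF l[OF Sm]]) (use fin in \<open>auto simp only: ennreal_mult_less_top ennreal_less_top infinity_ennreal_def\<close>)
  then have Kfin: "AE t in lborel. t \<le> T \<longrightarrow> majorant \<alpha> A ?S t < \<infinity>"
    by (rule weighted_int_finite_AE[OF majorant_measurable[OF A Sm]])
  have psm: "(\<lambda>t. picard_sum \<alpha> A F s t $ i) \<in> borel_measurable borel" for i
    unfolding picard_sum_def using p by (simp add: borel_measurable_suminf)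
  show "AE t in lborel. t \<le> T \<longrightarrow> picard_sum \<alpha> A F s t = F s t + rl_int_vec \<alpha> (\<lambda>\<tau>. A \<tau> *v picard_sum \<alpha> A F s \<tau>) t"
    using Sfin Kfin
  proof eventually_elim
    case (elim t)
    show ?case
    proof
      assume t: "t \<le> T"
      then have St: "?S t < \<infinity>" and Kt: "majorant \<alpha> A ?S t < \<infinity>" using elim by auto
      have "picard_sum \<alpha> A F s t $ i = F s t $ i + rl_int (\<alpha> $ i) (\<lambda>\<tau>. (A \<tau> *v picard_sum \<alpha> A F s \<tau>) $ i) t" for i
      proof -
        define f where "f n \<tau> = rl_kernel (\<alpha> $ i) (t - \<tau>) * (A \<tau> *v picard \<alpha> A F n s \<tau>) $ i" for n \<tau>
        define b where "b n \<tau> = ennreal (kernel_sum \<alpha> (t - \<tau>)) * (ennreal (entry_sum A \<tau>) * u n \<tau>)" for n \<tau>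
        note [measurable] = entry_sum_measurable[of A, OF A] A p psm
        have fm[measurable]: "f n \<in> borel_measurable borel" for n
          unfolding f_def[abs_def] matrix_vector_mult_def by simp
        have bm[measurable]: "b n \<in> borel_measurable borel" for n
          unfolding b_def[abs_def] by measurable
        have fb: "ennreal (norm (f n \<tau>)) \<le> b n \<tau>" for n \<tau>
        proof -
          have "rl_kernel (\<alpha> $ i) (t - \<tau>) \<le> kernel_sum \<alpha> (t - \<tau>)"
            unfolding kernel_sum_def by (rule member_le_sum) (use rl_kernel_nonneg[OF \<alpha>] in auto)
          then have "norm (f n \<tau>) \<le> kernel_sum \<alpha> (t - \<tau>) * (entry_sum A \<tau> * norm (picard \<alpha> A F n s \<tau>))"
            unfolding f_def using matrix_vector_mult_component_le[of A \<tau> "picard \<alpha> A F n s \<tau>" i] rl_kernel_nonneg[OF \<alpha>] kernel_sum_nonneg[of \<alpha>, OF \<alpha>]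
            by (simp add: abs_mult mult_mono)
          then have "ennreal (norm (f n \<tau>)) \<le> ennreal (kernel_sum \<alpha> (t - \<tau>) * (entry_sum A \<tau> * norm (picard \<alpha> A F n s \<tau>)))"
            by (rule ennreal_leI)
          then show ?thesis unfolding b_def u_def
            using kernel_sum_nonneg[of \<alpha>, OF \<alpha>] entry_sum_nonneg[of A] by (simp add: ennreal_mult)
        qed
        \<comment> \<open>The dominating integrals add up to the majorant of the series of norms,
          which is finite at this \<open>t\<close>.\<close>
        have sumb: "(\<Sum>n. \<integral>\<^sup>+\<tau>. b n \<tau> \<partial>lborel) < \<infinity>"
          using Kt majorant_suminf[where A=A and u=u and \<alpha>=\<alpha> and t=t, OF A u] unfolding S_eq majorant_def b_def by simp
        have bfin: "(\<integral>\<^sup>+\<tau>. b n \<tau> \<partial>lborel) < \<infinity>" for n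
          using sum_le_suminf[of "\<lambda>n. \<integral>\<^sup>+\<tau>. b n \<tau> \<partial>lborel" "{n}"] sumb by (auto intro: le_less_trans)
        have fint: "integrable lborel (f n)" for n
        proof (rule integrableI_bounded)
          have "(\<integral>\<^sup>+\<tau>. ennreal (norm (f n \<tau>)) \<partial>lborel) \<le> (\<integral>\<^sup>+\<tau>. b n \<tau> \<partial>lborel)" by (intro nn_integral_mono fb)
          also note bfin
          finally show "(\<integral>\<^sup>+\<tau>. ennreal (norm (f n \<tau>)) \<partial>lborel) < \<infinity>" .
        qed simp
        have AEsum: "AE \<tau> in lborel. summable (\<lambda>n. norm (f n \<tau>))"
        proof -
          have "(\<integral>\<^sup>+\<tau>. (\<Sum>n. b n \<tau>) \<partial>lborel) \<noteq> \<infinity>" using sumb by (subst nn_integral_suminf) auto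
          then have "AE \<tau> in lborel. (\<Sum>n. b n \<tau>) \<noteq> \<infinity>" by (intro nn_integral_PInf_AE) auto
          then show ?thesis
          proof eventually_elim
            case (elim \<tau>)
            have "(\<Sum>n. ennreal (norm (f n \<tau>))) \<le> (\<Sum>n. b n \<tau>)" by (intro suminf_le fb) auto
            then have "(\<Sum>n. ennreal (norm (f n \<tau>))) \<noteq> top" using elim by (auto simp: top_unique)
            then show ?case by (rule summable_suminf_not_top[OF norm_ge_zero])
          qed
        qed
        have sumint: "summable (\<lambda>n. LINT \<tau>|lborel. norm (f n \<tau>))"
        proof (rule summable_suminf_not_top)
          have "(\<Sum>n. ennreal (LINT \<tau>|lborel. norm (f n \<tau>))) = (\<Sum>n. \<integral>\<^sup>+\<tau>. ennreal (norm (f n \<tau>)) \<partial>lborel)"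
            using fint by (intro arg_cong[where f=suminf] ext nn_integral_eq_integral[symmetric]) auto
          also have "\<dots> \<le> (\<Sum>n. \<integral>\<^sup>+\<tau>. b n \<tau> \<partial>lborel)" by (intro suminf_le nn_integral_mono fb) auto
          finally show "(\<Sum>n. ennreal (LINT \<tau>|lborel. norm (f n \<tau>))) \<noteq> top" using sumb by (auto simp: top_unique)
        qed simp
        have "(\<Sum>n. LINT \<tau>|lborel. f n \<tau>) = (LINT \<tau>|lborel. (\<Sum>n. f n \<tau>))"
          by (rule integral_suminf[OF fint AEsum sumint, symmetric])
        also have "\<dots> = rl_int (\<alpha> $ i) (\<lambda>\<tau>. (A \<tau> *v picard_sum \<alpha> A F s \<tau>) $ i) t"
          unfolding rl_int_def
        proof (rule integral_cong_AE)
          show "(\<lambda>\<tau>. rl_kernel (\<alpha> $ i) (t - \<tau>) * (A \<tau> *v picard_sum \<alpha> A F s \<tau>) $ i) \<in> borel_measurable lborel"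
            unfolding matrix_vector_mult_def by simp
          show "AE \<tau> in lborel. (\<Sum>n. f n \<tau>) = rl_kernel (\<alpha> $ i) (t - \<tau>) * (A \<tau> *v picard_sum \<alpha> A F s \<tau>) $ i"
            using Sfin
          proof eventually_elim
            case (elim \<tau>)
            show ?case
            proof (cases "\<tau> \<le> T")
              case True
              with elim have "?S \<tau> < \<infinity>" by simp
              note sums = picard_sum_sums(1)[OF this]
              have "(\<lambda>n. rl_kernel (\<alpha> $ i) (t - \<tau>) * (\<Sum>j\<in>UNIV. A \<tau> $ i $ j * picard \<alpha> A F n s \<tau> $ j)) sums
                  (rl_kernel (\<alpha> $ i) (t - \<tau>) * (\<Sum>j\<in>UNIV. A \<tau> $ i $ j * picard_sum \<alpha> A F s \<tau> $ j))"
                by (intro sums_mult sums_sum sums)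
              then show ?thesis by (simp add: f_def matrix_vector_mult_def sums_iff)
            next
              \<comment> \<open>Beyond \<open>T\<close> the series is not controlled, but
                \<open>t \<le> T < \<tau>\<close> makes the kernel vanish.\<close>
              case False
              then have "rl_kernel (\<alpha> $ i) (t - \<tau>) = 0" using t by simp
              then show ?thesis by (simp add: f_def)
            qed
          qed
        qed measurable
        finally have "(\<Sum>n. picard \<alpha> A F (Suc n) s t $ i) = rl_int (\<alpha> $ i) (\<lambda>\<tau>. (A \<tau> *v picard_sum \<alpha> A F s \<tau>) $ i) t"
          by (simp add: rl_int_vec_def rl_int_def f_def)
        moreover have "(\<Sum>n. picard \<alpha> A F (Suc n) s t $ i) = picard_sum \<alpha> A F s t $ i - picard \<alpha> A F 0 s t $ i"
          using suminf_split_head[of "\<lambda>n. picard \<alpha> A F n s t $ i"] picard_sum_sums(1)[OF St, of i]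
          by (simp add: sums_iff)
        ultimately show ?thesis by simp
      qed
      then show "picard_sum \<alpha> A F s t = F s t + rl_int_vec \<alpha> (\<lambda>\<tau>. A \<tau> *v picard_sum \<alpha> A F s \<tau>) t"
        by (simp add: vec_eq_iff rl_int_vec_def)
    qed
  qed
qed

section \<open>The resolvent: a Borel version of the state-transition matrix\<close>

text \<open>As in the paper the arguments are the current time and the initial time, in this order, whereas
  \<^const>\<open>picard\<close> and the series built from it take the initial time first.\<close>

definition resolvent :: "real set \<Rightarrow> real^'m \<Rightarrow> (real \<Rightarrow> real^'m^'m) \<Rightarrow> real \<Rightarrow> real \<Rightarrow> real^'m^'m" where
  "resolvent I \<alpha> A t s = (\<chi> i j. if t \<in> I \<and> s \<in> I
     then picard_sum \<alpha> A (\<lambda>s t. rl_kernel_vec \<alpha> (t - s) (axis j 1)) s t $ i else 0)"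

lemma rl_kernel_vec_measurable: "(\<lambda>p. rl_kernel_vec \<alpha> (snd p - fst p) x $ i) \<in> borel_measurable (borel \<Otimes>\<^sub>M borel)"
  unfolding rl_kernel_vec_def by simp

lemma resolvent_measurable:
  assumes A: "\<And>i j. (\<lambda>t. A t $ i $ j) \<in> borel_measurable borel" and I[measurable]: "I \<in> sets borel"
  shows "(\<lambda>p. resolvent I \<alpha> A (fst p) (snd p) $ i $ j) \<in> borel_measurable (borel \<Otimes>\<^sub>M borel)"
proof -
  have "(\<lambda>p. picard_sum \<alpha> A (\<lambda>s t. rl_kernel_vec \<alpha> (t - s) (axis j 1)) (snd p) (fst p) $ i) \<in> borel_measurable (borel \<Otimes>\<^sub>M borel)"
    by (rule measurable_compose[of "\<lambda>q. (snd q, fst q)" _ "borel \<Otimes>\<^sub>M borel", OF _ picard_sum_measurable[OF A rl_kernel_vec_measurable], simplified]) measurable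
  then show ?thesis unfolding resolvent_def by simp
qed

lemma resolvent_zero:
  assumes "t \<notin> I \<or> s \<notin> I \<or> t \<le> s"
  shows "resolvent I \<alpha> A t s = 0"
  using assms by (auto simp: resolvent_def vec_eq_iff picard_sum_zero rl_kernel_vec_def)

lemma rl_kernel_vec_axis_norm: "(\<And>i. 0 < \<alpha> $ i) \<Longrightarrow> norm (rl_kernel_vec \<alpha> x (axis j 1)) = rl_kernel (\<alpha> $ j) x"
proof -
  assume \<alpha>: "\<And>i. 0 < \<alpha> $ i"
  have "rl_kernel_vec \<alpha> x (axis j 1) = rl_kernel (\<alpha> $ j) x *\<^sub>R axis j 1" by (auto simp: rl_kernel_vec_def vec_eq_iff axis_def)
  then show ?thesis using rl_kernel_nonneg[OF \<alpha>] by (simp add: norm_axis_1)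
qed

lemma resolvent_column:
  assumes "s \<in> I" "t \<in> I"
  shows "column j (resolvent I \<alpha> A t s) = picard_sum \<alpha> A (\<lambda>s t. rl_kernel_vec \<alpha> (t - s) (axis j 1)) s t"
  using assms by (simp add: column_def resolvent_def vec_eq_iff)

text \<open>The \<open>l\<close> of \<open>majorant_contraction\<close> serves all initial times,
  and \<open>wF\<close> estimates the first term with \<open>T - a\<close> in place of
  \<open>T - s\<close>. So \<open>M\<close> is uniform in \<open>s\<close>, as the later integration
  over \<open>s\<close> requires.\<close>

lemma
  fixes \<alpha> :: "real^'m"
  assumes I: "I \<in> intervals_from a" and \<alpha>: "\<And>i. 0 < \<alpha> $ i" and A: "\<And>i j. loc_bdd I (\<lambda>t. A t $ i $ j)"
  shows resolvent_solves: "s \<in> I \<Longrightarrow> AE t\<in>I in lborel. column j (resolvent I \<alpha> A t s) =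
      rl_kernel_vec \<alpha> (t - s) (axis j 1) + rl_int_vec \<alpha> (\<lambda>\<tau>. A \<tau> *v column j (resolvent I \<alpha> A \<tau> s)) t" (is "?s \<Longrightarrow> ?P")
    and resolvent_bounded: "T \<in> I \<Longrightarrow> \<exists>M. \<forall>s\<in>I. (\<integral>\<^sup>+t. indicator {..T} t * ennreal (norm (column j (resolvent I \<alpha> A t s))) \<partial>lborel) \<le> ennreal M"
proof -
  note ID = intervals_fromD[OF I]
  have Am: "(\<lambda>t. A t $ i $ j) \<in> borel_measurable borel" for i j using A by (simp add: loc_bdd_def)
  define F where "F s t = rl_kernel_vec \<alpha> (t - s) (axis j 1)" for s t
  have Fm: "(\<lambda>p. F (fst p) (snd p) $ i) \<in> borel_measurable (borel \<Otimes>\<^sub>M borel)" for i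
    unfolding F_def by (rule rl_kernel_vec_measurable)
  have pm: "(\<lambda>t. picard \<alpha> A F n s t $ i) \<in> borel_measurable borel" for n i s
    by (rule section_measurable[OF picard_measurable[OF Am Fm]])
  have psm: "(\<lambda>t. picard_sum \<alpha> A F s t $ i) \<in> borel_measurable borel" for i s
    by (rule section_measurable[OF picard_sum_measurable[OF Am Fm]])
  have F0: "F s t = 0" if "t \<le> s" for s t using that by (simp add: F_def rl_kernel_vec_def vec_eq_iff)
  have nF: "norm (F s t) = rl_kernel (\<alpha> $ j) (t - s)" for s t unfolding F_def by (rule rl_kernel_vec_axis_norm[OF \<alpha>])
  have col: "column j (resolvent I \<alpha> A t s) = picard_sum \<alpha> A F s t" if "s \<in> I" "t \<in> I" for s t
    by (simp add: resolvent_column[OF that] F_def[abs_def])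
  have wF: "weighted_int T l (\<lambda>t. ennreal (norm (F s t))) \<le> ennreal (exp (- l * a)) * ennreal ((T - a) powr (\<alpha> $ j) / Gamma (1 + \<alpha> $ j))"
    if l: "0 \<le> l" and s: "s \<in> I" and T: "T \<in> I" for l s T
  proof -
    have "weighted_int T l (\<lambda>t. ennreal (norm (F s t))) \<le> ennreal (exp (- l * a)) * (\<integral>\<^sup>+t. indicator {..T} t * ennreal (norm (F s t)) \<partial>lborel)"
      by (rule weighted_int_le_integral[OF l]) (use ID(2)[OF s] F0 in \<open>auto simp: nF\<close>)
    \<comment> \<open>Integrating a kernel up to \<open>T\<close> is convolution with the kernel of
      order 1.\<close>
    also have "(\<integral>\<^sup>+t. indicator {..T} t * ennreal (norm (F s t)) \<partial>lborel) = (\<integral>\<^sup>+t. ennreal (rl_kernel 1 (T - t)) * ennreal (rl_kernel (\<alpha> $ j) (t - s)) \<partial>lborel)"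
    proof (rule nn_integral_cong_AE)
      show "AE t in lborel. indicator {..T} t * ennreal (norm (F s t)) = ennreal (rl_kernel 1 (T - t)) * ennreal (rl_kernel (\<alpha> $ j) (t - s))"
        using AE_lborel_singleton[of T] by eventually_elim (auto simp: nF rl_kernel_1 indicator_def)
    qed
    also have "\<dots> = ennreal (rl_kernel (1 + \<alpha> $ j) (T - s))" by (rule rl_kernel_conv) (use \<alpha> in auto)
    also have "\<dots> \<le> ennreal ((T - a) powr (\<alpha> $ j) / Gamma (1 + \<alpha> $ j))"
      using rl_kernel_bounded[of "1 + \<alpha> $ j" "T - s" "T - a"] \<alpha>[of j] ID(2)[OF s] by (intro ennreal_leI) simp
    finally show ?thesis by (simp add: mult_left_mono)
  qed
  have wF_fin: "weighted_int T l (\<lambda>t. ennreal (norm (F s t))) < \<infinity>" if "0 \<le> l" "s \<in> I" "T \<in> I" for l s T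
    using wF[OF that] by (rule le_less_trans) (simp add: ennreal_mult_less_top)
  {
    assume s: "s \<in> I"
    show ?P
    proof (rule AE_on_interval[OF I])
      fix T assume T: "T \<in> I"
      obtain l where l: "l > 0" "\<And>u. u \<in> borel_measurable borel \<Longrightarrow> weighted_int T l (majorant \<alpha> A u) \<le> ennreal (1/2) * weighted_int T l u"
        using majorant_contraction[of \<alpha>, OF \<alpha> A T] by blast
      \<comment> \<open>Cutting the resolvent off outside \<open>I\<close> does not affect the
        equation, as the coefficient vanishes there too.\<close>
      have cong: "A \<tau> *v column j (resolvent I \<alpha> A \<tau> s) = A \<tau> *v picard_sum \<alpha> A F s \<tau>" for \<tau>
      proof (cases "\<tau> \<in> I")
        case False
        then have "A \<tau> = 0" using A by (simp add: loc_bdd_def vec_eq_iff)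
        then show ?thesis by simp
      qed (use s col in simp)
      show "AE t\<in>I in lborel. t \<le> T \<longrightarrow> column j (resolvent I \<alpha> A t s) =
          rl_kernel_vec \<alpha> (t - s) (axis j 1) + rl_int_vec \<alpha> (\<lambda>\<tau>. A \<tau> *v column j (resolvent I \<alpha> A \<tau> s)) t"
        using picard_sum_solves(1)[of \<alpha> A F s T l, OF \<alpha> Am pm l(2) wF_fin[OF _ s T]] l(1)
        by (auto elim!: eventually_mono simp: cong col[OF s] F_def)
    qed
  }
  {
    assume T: "T \<in> I"
    obtain l where l: "l > 0" "\<And>u. u \<in> borel_measurable borel \<Longrightarrow> weighted_int T l (majorant \<alpha> A u) \<le> ennreal (1/2) * weighted_int T l u"
      using majorant_contraction[of \<alpha>, OF \<alpha> A T] by blast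
    define M where "M = exp (l * T) * (2 * (exp (- l * a) * ((T - a) powr (\<alpha> $ j) / Gamma (1 + \<alpha> $ j))))"
    have "(\<integral>\<^sup>+t. indicator {..T} t * ennreal (norm (column j (resolvent I \<alpha> A t s))) \<partial>lborel) \<le> ennreal M" if s: "s \<in> I" for s
    proof -
      have "(\<integral>\<^sup>+t. indicator {..T} t * ennreal (norm (column j (resolvent I \<alpha> A t s))) \<partial>lborel)
          \<le> (\<integral>\<^sup>+t. indicator {..T} t * ennreal (norm (picard_sum \<alpha> A F s t)) \<partial>lborel)"
      proof (intro nn_integral_mono mult_left_mono ennreal_leI)
        fix t show "norm (column j (resolvent I \<alpha> A t s)) \<le> norm (picard_sum \<alpha> A F s t)"
        proof (cases "t \<in> I")
          case False
          then have "column j (resolvent I \<alpha> A t s) = 0" using resolvent_zero[of t I s \<alpha> A] by (simp add: column_def vec_eq_iff)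
          then show ?thesis by simp
        qed (use col s in simp)
      qed simp
      also have "\<dots> \<le> ennreal (exp (l * T)) * weighted_int T l (\<lambda>t. ennreal (norm (picard_sum \<alpha> A F s t)))"
        using l(1) norm_measurable_vec[OF psm] by (intro integral_le_weighted_int) auto
      also have "\<dots> \<le> ennreal (exp (l * T)) * (2 * weighted_int T l (\<lambda>t. ennreal (norm (F s t))))"
        using picard_sum_solves(2)[of \<alpha> A F s T l, OF \<alpha> Am pm l(2) wF_fin[OF _ s T]] l(1) by (intro mult_left_mono) auto
      also have "\<dots> \<le> ennreal (exp (l * T)) * (2 * (ennreal (exp (- l * a)) * ennreal ((T - a) powr (\<alpha> $ j) / Gamma (1 + \<alpha> $ j))))"
        using wF[OF _ s T, of l] l(1) by (intro mult_left_mono) auto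
      also have "\<dots> = ennreal M"
      proof -
        have "0 \<le> (T - a) powr (\<alpha> $ j) / Gamma (1 + \<alpha> $ j)" using \<alpha>[of j] by (simp add: Gamma_real_pos less_imp_le)
        moreover have "(2::ennreal) = ennreal 2" by simp
        ultimately show ?thesis unfolding M_def by (simp only: ennreal_mult[symmetric] exp_ge_zero mult_nonneg_nonneg zero_le_numeral)
      qed
      finally show ?thesis .
    qed
    then show "\<exists>M. \<forall>s\<in>I. (\<integral>\<^sup>+t. indicator {..T} t * ennreal (norm (column j (resolvent I \<alpha> A t s))) \<partial>lborel) \<le> ennreal M" by blast
  }
qed

section \<open>State-transition matrix\<close>

lemma borel_measurable_vec:
  fixes f :: "'a \<Rightarrow> real^'m"
  assumes "\<And>i. (\<lambda>x. f x $ i) \<in> borel_measurable M"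
  shows "f \<in> borel_measurable M"
proof (subst borel_measurable_euclidean_space, rule ballI)
  fix b :: "real^'m" assume "b \<in> Basis"
  then obtain i where "b = axis i 1" by (auto simp: Basis_vec_def)
  then show "(\<lambda>x. f x \<bullet> b) \<in> borel_measurable M" using assms by (simp add: inner_axis)
qed

lemma borel_measurable_mat:
  fixes f :: "'a \<Rightarrow> real^'m^'n"
  assumes "\<And>i j. (\<lambda>x. f x $ i $ j) \<in> borel_measurable M"
  shows "f \<in> borel_measurable M"
proof (subst borel_measurable_euclidean_space, rule ballI)
  fix b :: "real^'m^'n" assume "b \<in> Basis"
  then obtain i j where "b = axis i (axis j 1)" by (auto simp: Basis_vec_def)
  then show "(\<lambda>x. f x \<bullet> b) \<in> borel_measurable M" using assms by (simp add: inner_axis)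
qed

lemma borel_measurable_vec_nth:
  "f \<in> borel_measurable M \<Longrightarrow> (\<lambda>x. f x $ i) \<in> borel_measurable M" for f :: "'a \<Rightarrow> real^'m"
  by (rule measurable_compose[OF _ borel_measurable_continuous_onI]) (auto intro!: continuous_intros)

text \<open>The sections of a Lebesgue measurable set need not be measurable, so Tonelli's theorem is applied
  to its Borel part.\<close>

lemma lebesgue_null_sections:
  fixes E :: "(real \<times> real) set"
  assumes E: "E \<in> sets lebesgue" and null: "\<And>s. AE t in lborel. (t, s) \<notin> E"
  shows "AE t in lborel. AE s in lborel. (t, s) \<notin> E"
proof -
  obtain S N N' where *: "E = S \<union> N" "N \<subseteq> N'" "N' \<in> null_sets lborel" "S \<in> sets lborel"
    by (rule sets_completionE[OF E]) (rule that)
  have Sm: "S \<in> sets (lborel \<Otimes>\<^sub>M lborel)" using *(4) by (simp only: lborel_prod)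
  have "emeasure lborel ((\<lambda>t. (t, s)) -` S) = 0" for s
  proof -
    have "(\<lambda>t. (t, s)) -` S \<in> sets lborel" using sets_Pair2[OF Sm, of s] by simp
    moreover have "AE t in lborel. t \<notin> (\<lambda>t. (t, s)) -` S" using null[of s] by eventually_elim (use *(1) in auto)
    ultimately have "(\<lambda>t. (t, s)) -` S \<in> null_sets lborel" by (subst (asm) AE_iff_null_sets[symmetric]) auto
    then show ?thesis by auto
  qed
  then have "emeasure (lborel \<Otimes>\<^sub>M lborel) S = 0"
    using lborel_pair.emeasure_pair_measure_alt2[OF Sm] by simp
  then have "S \<in> null_sets (lborel \<Otimes>\<^sub>M lborel)" using Sm by (rule null_setsI)
  then have "S \<union> N' \<in> null_sets (lborel \<Otimes>\<^sub>M lborel)"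
    using *(3) unfolding lborel_prod by (rule null_sets.Un)
  then have "AE p in lborel \<Otimes>\<^sub>M lborel. p \<notin> S \<union> N'" by (rule AE_not_in)
  from lborel_pair.AE_pair[OF this] show ?thesis
  proof eventually_elim
    case (elim t)
    then show ?case by eventually_elim (use * in auto)
  qed
qed

lemma absolutely_integrable_AE_lborel:
  fixes f g :: "real \<Rightarrow> 'b::euclidean_space"
  assumes g: "integrable lborel g" and AE: "AE s in lborel. indicator S s *\<^sub>R f s = g s"
  shows "f absolutely_integrable_on S" "(LINT s:S|lebesgue. f s) = (LINT s|lborel. g s)"
proof -
  have gm: "g \<in> borel_measurable lborel" using g by auto
  have AE': "AE s in lebesgue. indicator S s *\<^sub>R f s = g s" using AE by (subst AE_completion_iff)
  have gl: "integrable lebesgue g" using g by (subst integrable_completion[OF gm])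
  have fm: "(\<lambda>s. indicator S s *\<^sub>R f s) \<in> borel_measurable lebesgue"
    by (rule borel_measurable_lebesgue_AE[OF measurable_completion[OF gm] AE'])
  show "f absolutely_integrable_on S"
    unfolding set_integrable_def
    by (rule integrable_cong_AE_imp[OF gl fm]) (use AE' in eventually_elim, simp)
  have "(LINT s:S|lebesgue. f s) = (LINT s|lebesgue. g s)"
    unfolding set_lebesgue_integral_def by (rule integral_cong_AE[OF fm measurable_completion[OF gm] AE'])
  also have "\<dots> = (LINT s|lborel. g s)" by (rule integral_completion[OF gm])
  finally show "(LINT s:S|lebesgue. f s) = (LINT s|lborel. g s)" .
qed

lemma intervals_from_tail:
  assumes I: "I \<in> intervals_from a" and s: "s \<in> I" "r \<in> I" "s < r"
  shows "I \<inter> {s..} \<in> intervals_from s"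
proof -
  have "is_interval (I \<inter> {s..})" using intervals_fromD(4)[OF I] by (intro is_interval_Int is_interval_ci)
  moreover have "{s} \<subset> I \<inter> {s..}" using s by auto
  ultimately show ?thesis by (simp add: intervals_from_def)
qed

lemma Linf_loc_subset: "A \<in> Linf_loc I \<Longrightarrow> J \<subseteq> I \<Longrightarrow> A \<in> Linf_loc J"
  unfolding Linf_loc_def by blast

lemma Linf_loc_zero: "(\<lambda>_. 0) \<in> Linf_loc I"
  unfolding Linf_loc_def by (auto intro!: exI[of _ 0])

lemma loc_bdd_vec_loc_int: "I \<in> intervals_from a \<Longrightarrow> (\<And>i. loc_bdd I (\<lambda>t. B t $ i)) \<Longrightarrow> vec_loc_int I B"
  by (simp add: vec_loc_int_def loc_bdd_loc_int)

lemma RL_vector_solution_unique: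
  fixes A :: "real \<Rightarrow> real^'m^'m"
  assumes I: "I \<in> intervals_from a" and \<alpha>: "\<And>i. 0 < \<alpha> $ i \<and> \<alpha> $ i \<le> 1"
    and A: "A \<in> Linf_loc I" and B: "B \<in> Linf_loc I"
    and p: "RL_vector_solution a I \<alpha> A B qa p" and q: "RL_vector_solution a I \<alpha> A B qa q"
  shows "AE t\<in>I in lborel. p t = q t"
proof -
  obtain A' where A': "\<And>i j. loc_bdd I (\<lambda>t. A' t $ i $ j)" "AE t\<in>I in lborel. A t = A' t"
    using mat_representative[OF I A] by blast
  obtain B' where B': "\<And>i. loc_bdd I (\<lambda>t. B' t $ i)" "AE t\<in>I in lborel. B t = B' t"
    using vec_representative[OF I B] by blast
  note iff = RL_vector_solution_iff[OF I \<alpha> A' B']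
  obtain v where v: "vec_loc_int I v" "AE t\<in>I in lborel. p t = v t"
    "AE t\<in>I in lborel. v t = rl_kernel_vec \<alpha> (t - a) qa + rl_int_vec \<alpha> (\<lambda>\<tau>. A' \<tau> *v v \<tau> + B' \<tau>) t"
    using p unfolding iff by blast
  obtain w where w: "vec_loc_int I w" "AE t\<in>I in lborel. q t = w t"
    "AE t\<in>I in lborel. w t = rl_kernel_vec \<alpha> (t - a) qa + rl_int_vec \<alpha> (\<lambda>\<tau>. A' \<tau> *v w \<tau> + B' \<tau>) t"
    using q unfolding iff by blast
  have "AE t\<in>I in lborel. v t = w t"
    by (rule volterra_unique[OF I _ A'(1) loc_bdd_vec_loc_int[OF I B'(1)] v(1) w(1) v(3) w(3)]) (use \<alpha> in auto)
  with v(2) w(2) show ?thesis by eventually_elim auto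
qed

text \<open>The rule for differences, applied to \<open>f + g\<close> and \<open>g\<close>.\<close>

lemma rl_int_vec_add_AE:
  fixes \<alpha> :: "real^'m"
  assumes I: "I \<in> intervals_from a" and \<alpha>: "\<And>i. 0 < \<alpha> $ i" and f: "vec_loc_int I f" and g: "vec_loc_int I g"
  shows "AE t\<in>I in lborel. rl_int_vec \<alpha> (\<lambda>\<tau>. f \<tau> + g \<tau>) t = rl_int_vec \<alpha> f t + rl_int_vec \<alpha> g t"
  using rl_int_vec_diff_AE[OF I \<alpha> vec_loc_int_add[OF f g] g] by eventually_elim auto

lemma vec_loc_int_sum_scaleR:
  assumes "\<And>j. vec_loc_int I (f j)"
  shows "vec_loc_int I (\<lambda>t. \<Sum>j\<in>S. c j *\<^sub>R f j t)"
proof -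
  have "loc_int I (\<lambda>t. c j * f j t $ i)" for i j using assms[of j]
    by (auto simp: vec_loc_int_def loc_int_def mult.left_commute intro!: borel_measurable_times)
  then show ?thesis unfolding vec_loc_int_def by (auto intro!: loc_int_sum)
qed

lemma matrix_vector_mult_columns: "M *v x = (\<Sum>j\<in>UNIV. x $ j *\<^sub>R column j M)" for M :: "real^'m^'n"
  by (simp add: vec_eq_iff matrix_vector_mult_def column_def mult.commute)

lemma resolvent_column_vec_loc_int:
  fixes \<alpha> :: "real^'m"
  assumes I: "I \<in> intervals_from a" and \<alpha>: "\<And>i. 0 < \<alpha> $ i" and A: "\<And>i j. loc_bdd I (\<lambda>t. A t $ i $ j)" and s: "s \<in> I"
  shows "vec_loc_int I (\<lambda>t. column j (resolvent I \<alpha> A t s))"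
  unfolding vec_loc_int_def
proof
  fix i
  have Am: "(\<lambda>t. A t $ i $ j) \<in> borel_measurable borel" for i j using A by (simp add: loc_bdd_def)
  have "(\<lambda>p. resolvent I \<alpha> A (snd p) (fst p) $ i $ j) \<in> borel_measurable (borel \<Otimes>\<^sub>M borel)"
    by (rule measurable_compose[of "\<lambda>q. (snd q, fst q)" _ "borel \<Otimes>\<^sub>M borel",
        OF _ resolvent_measurable[OF Am intervals_fromD(6)[OF I]], simplified]) measurable
  from section_measurable[OF this] have m: "(\<lambda>t. resolvent I \<alpha> A t s $ i $ j) \<in> borel_measurable borel" .
  have "integrable lborel (\<lambda>t. indicator {..T} t * resolvent I \<alpha> A t s $ i $ j)" if T: "T \<in> I" for T
  proof (rule integrableI_bounded)
    obtain M where M: "\<And>s. s \<in> I \<Longrightarrow> (\<integral>\<^sup>+t. indicator {..T} t * ennreal (norm (column j (resolvent I \<alpha> A t s))) \<partial>lborel) \<le> ennreal M"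
      using resolvent_bounded[OF I \<alpha> A T] by blast
    have "(\<integral>\<^sup>+t. ennreal (norm (indicator {..T} t * resolvent I \<alpha> A t s $ i $ j)) \<partial>lborel)
        \<le> (\<integral>\<^sup>+t. indicator {..T} t * ennreal (norm (column j (resolvent I \<alpha> A t s))) \<partial>lborel)"
    proof (rule nn_integral_mono)
      fix t
      have "\<bar>column j (resolvent I \<alpha> A t s) $ i\<bar> \<le> norm (column j (resolvent I \<alpha> A t s))" by (rule component_le_norm_cart)
      then show "ennreal (norm (indicator {..T} t * resolvent I \<alpha> A t s $ i $ j)) \<le> indicator {..T} t * ennreal (norm (column j (resolvent I \<alpha> A t s)))"
        by (auto simp: indicator_def column_def intro: ennreal_leI)
    qed
    also have "\<dots> \<le> ennreal M" by (rule M[OF s])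
    finally show "(\<integral>\<^sup>+t. ennreal (norm (indicator {..T} t * resolvent I \<alpha> A t s $ i $ j)) \<partial>lborel) < \<infinity>"
      by (rule le_less_trans) simp
  qed (use m in measurable)
  moreover have "resolvent I \<alpha> A t s $ i $ j = 0" if "t \<notin> I" for t using resolvent_zero[of t I s \<alpha> A] that by simp
  ultimately show "loc_int I (\<lambda>t. column j (resolvent I \<alpha> A t s) $ i)"
    using m by (simp add: loc_int_def column_def)
qed

text \<open>The column equations are combined linearly at times where all the integrals involved
  converge. All columns are convolved with the same kernels, so the first terms combine to the one
  of \<open>x\<close>.\<close>

lemma resolvent_vec_solves:
  fixes \<alpha> :: "real^'m"
  assumes I: "I \<in> intervals_from a" and \<alpha>: "\<And>i. 0 < \<alpha> $ i" and A: "\<And>i j. loc_bdd I (\<lambda>t. A t $ i $ j)" and s: "s \<in> I"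
  shows "vec_loc_int I (\<lambda>t. resolvent I \<alpha> A t s *v x)"
    and "AE t\<in>I in lborel. resolvent I \<alpha> A t s *v x = rl_kernel_vec \<alpha> (t - s) x + rl_int_vec \<alpha> (\<lambda>\<tau>. A \<tau> *v (resolvent I \<alpha> A \<tau> s *v x)) t"
proof -
  let ?c = "\<lambda>j t. column j (resolvent I \<alpha> A t s)"
  note cv = resolvent_column_vec_loc_int[OF I \<alpha> A s]
  show "vec_loc_int I (\<lambda>t. resolvent I \<alpha> A t s *v x)"
    unfolding matrix_vector_mult_columns[of "resolvent I \<alpha> A _ s"] by (rule vec_loc_int_sum_scaleR[OF cv])
  have "AE t in lborel. \<forall>i j. t \<in> I \<longrightarrow> integrable lborel (\<lambda>\<tau>. rl_kernel (\<alpha> $ i) (t - \<tau>) * (A \<tau> *v ?c j \<tau>) $ i)"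
    using rl_int_integrable_AE[OF I _ \<alpha>] vec_loc_int_matrix_mult[OF A cv]
    by (simp only: eventually_all_finite_iff vec_loc_int_def) blast
  moreover have "AE t in lborel. \<forall>j. t \<in> I \<longrightarrow> ?c j t = rl_kernel_vec \<alpha> (t - s) (axis j 1) + rl_int_vec \<alpha> (\<lambda>\<tau>. A \<tau> *v ?c j \<tau>) t"
    using resolvent_solves[OF I \<alpha> A s] by (simp only: eventually_all_finite_iff) blast
  ultimately show "AE t\<in>I in lborel. resolvent I \<alpha> A t s *v x = rl_kernel_vec \<alpha> (t - s) x + rl_int_vec \<alpha> (\<lambda>\<tau>. A \<tau> *v (resolvent I \<alpha> A \<tau> s *v x)) t"
  proof eventually_elim
    case (elim t)
    show ?case
    proof
      assume t: "t \<in> I"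
      have "(resolvent I \<alpha> A t s *v x) $ i = rl_kernel_vec \<alpha> (t - s) x $ i + rl_int_vec \<alpha> (\<lambda>\<tau>. A \<tau> *v (resolvent I \<alpha> A \<tau> s *v x)) t $ i" for i
      proof -
        have int: "integrable lborel (\<lambda>\<tau>. x $ j * (rl_kernel (\<alpha> $ i) (t - \<tau>) * (A \<tau> *v ?c j \<tau>) $ i))" for j
          using elim t by simp
        have "(resolvent I \<alpha> A t s *v x) $ i = (\<Sum>j\<in>UNIV. x $ j * ?c j t $ i)"
          by (subst matrix_vector_mult_columns) simp
        also have "\<dots> = (\<Sum>j\<in>UNIV. x $ j * rl_kernel_vec \<alpha> (t - s) (axis j 1) $ i + x $ j * rl_int (\<alpha> $ i) (\<lambda>\<tau>. (A \<tau> *v ?c j \<tau>) $ i) t)"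
        proof (rule sum.cong[OF refl])
          fix j
          have "?c j t = rl_kernel_vec \<alpha> (t - s) (axis j 1) + rl_int_vec \<alpha> (\<lambda>\<tau>. A \<tau> *v ?c j \<tau>) t" using elim t by blast
          then have "?c j t $ i = rl_kernel_vec \<alpha> (t - s) (axis j 1) $ i + rl_int (\<alpha> $ i) (\<lambda>\<tau>. (A \<tau> *v ?c j \<tau>) $ i) t"
            by (simp only: vector_add_component) (simp add: rl_int_vec_def)
          then show "x $ j * ?c j t $ i = x $ j * rl_kernel_vec \<alpha> (t - s) (axis j 1) $ i + x $ j * rl_int (\<alpha> $ i) (\<lambda>\<tau>. (A \<tau> *v ?c j \<tau>) $ i) t"
            by (simp only: distrib_left)
        qed
        also have "\<dots> = (\<Sum>j\<in>UNIV. x $ j * rl_kernel_vec \<alpha> (t - s) (axis j 1) $ i) + (\<Sum>j\<in>UNIV. LINT \<tau>|lborel. x $ j * (rl_kernel (\<alpha> $ i) (t - \<tau>) * (A \<tau> *v ?c j \<tau>) $ i))"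
          by (simp add: sum.distrib rl_int_def)
        also have "(\<Sum>j\<in>UNIV. x $ j * rl_kernel_vec \<alpha> (t - s) (axis j 1) $ i) = rl_kernel_vec \<alpha> (t - s) x $ i"
        proof -
          have "(\<Sum>j\<in>UNIV. x $ j * rl_kernel_vec \<alpha> (t - s) (axis j 1) $ i) = (\<Sum>j\<in>UNIV. if j = i then x $ j * rl_kernel (\<alpha> $ i) (t - s) else 0)"
            by (intro sum.cong) (auto simp: rl_kernel_vec_def axis_def)
          then show ?thesis by (simp add: rl_kernel_vec_def)
        qed
        also have "(\<Sum>j\<in>UNIV. LINT \<tau>|lborel. x $ j * (rl_kernel (\<alpha> $ i) (t - \<tau>) * (A \<tau> *v ?c j \<tau>) $ i))
            = (LINT \<tau>|lborel. (\<Sum>j\<in>UNIV. x $ j * (rl_kernel (\<alpha> $ i) (t - \<tau>) * (A \<tau> *v ?c j \<tau>) $ i)))"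
          using int by (rule Bochner_Integration.integral_sum[symmetric])
        also have "\<dots> = rl_int_vec \<alpha> (\<lambda>\<tau>. A \<tau> *v (resolvent I \<alpha> A \<tau> s *v x)) t $ i"
        proof -
          have "(A \<tau> *v (resolvent I \<alpha> A \<tau> s *v x)) $ i = (\<Sum>j\<in>UNIV. x $ j * (A \<tau> *v ?c j \<tau>) $ i)" for \<tau>
            by (subst matrix_vector_mult_columns[of "resolvent I \<alpha> A \<tau> s"])
              (simp add: linear_sum[OF matrix_vector_mul_linear] matrix_vector_mult_scaleR o_def)
          then show ?thesis by (simp add: rl_int_vec_def rl_int_def sum_distrib_left mult.left_commute)
        qed
        finally show ?thesis .
      qed
      then show "resolvent I \<alpha> A t s *v x = rl_kernel_vec \<alpha> (t - s) x + rl_int_vec \<alpha> (\<lambda>\<tau>. A \<tau> *v (resolvent I \<alpha> A \<tau> s *v x)) t"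
        by (simp add: vec_eq_iff)
    qed
  qed
qed

text \<open>The resolvent vanishes before \<open>s\<close>, so its equation on \<open>I\<close> is
  at the same time an equation on the tail of \<open>I\<close> with base point
  \<open>s\<close>.\<close>

lemma resolvent_matrix_solution:
  fixes A :: "real \<Rightarrow> real^'m^'m"
  assumes I: "I \<in> intervals_from a" and \<alpha>: "\<And>i. 0 < \<alpha> $ i \<and> \<alpha> $ i \<le> 1"
    and A': "\<And>i j. loc_bdd I (\<lambda>t. A' t $ i $ j)" "AE t\<in>I in lborel. A t = A' t"
    and s: "s \<in> I" "r \<in> I" "s < r"
  shows "RL_matrix_solution s (I \<inter> {s..}) (row_constant \<alpha>) A (\<lambda>t. resolvent I \<alpha> A' t s)"
  unfolding RL_matrix_solution_iff
proof
  fix j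
  let ?J = "I \<inter> {s..}"
  let ?c = "\<lambda>t. column j (resolvent I \<alpha> A' t s)"
  have \<alpha>0: "0 < \<alpha> $ i" for i using \<alpha> by blast
  note J = intervals_from_tail[OF I s]
  \<comment> \<open>\<open>loc_bdd\<close> on the tail demands that the coefficient vanish before
    \<open>s\<close>.\<close>
  define A2 where "A2 t = (if s \<le> t then A' t else 0)" for t
  have A2: "loc_bdd ?J (\<lambda>t. A2 t $ i $ k)" for i k
    unfolding loc_bdd_def
  proof (intro conjI ballI)
    have [measurable]: "(\<lambda>t. A' t $ i $ k) \<in> borel_measurable borel" using A'(1) by (simp add: loc_bdd_def)
    have "(\<lambda>t. if s \<le> t then A' t $ i $ k else 0) \<in> borel_measurable borel" by measurable
    then show "(\<lambda>t. A2 t $ i $ k) \<in> borel_measurable borel"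
      by (rule back_subst[where P="\<lambda>f. f \<in> borel_measurable borel"]) (auto simp: A2_def)
    show "\<forall>x. x \<notin> ?J \<longrightarrow> A2 x $ i $ k = 0" using A'(1)[of i k] by (auto simp: loc_bdd_def A2_def)
    fix T assume "T \<in> ?J"
    then obtain C where C: "AE x in lborel. x \<le> T \<longrightarrow> \<bar>A' x $ i $ k\<bar> \<le> C" using A'(1)[of i k] by (auto simp: loc_bdd_def)
    have "AE x in lborel. x \<le> T \<longrightarrow> \<bar>A2 x $ i $ k\<bar> \<le> max C 0"
      using C by eventually_elim (auto simp: A2_def)
    then show "\<exists>C. AE x in lborel. x \<le> T \<longrightarrow> \<bar>A2 x $ i $ k\<bar> \<le> C" by blast
  qed
  have A2A: "AE t\<in>?J in lborel. A t = A2 t" using A'(2) by eventually_elim (auto simp: A2_def)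
  have c0: "?c t = 0" if "t < s" for t using resolvent_zero[of t I s \<alpha> A'] that by (simp add: column_def vec_eq_iff)
  have vI: "vec_loc_int I ?c" by (rule resolvent_column_vec_loc_int[OF I \<alpha>0 A'(1) s(1)])
  have vJ: "vec_loc_int ?J ?c"
    using vI c0 unfolding vec_loc_int_def loc_int_def by (auto simp: not_le)
  have "A2 \<tau> *v ?c \<tau> = A' \<tau> *v ?c \<tau>" for \<tau> using c0[of \<tau>] by (simp add: A2_def)
  then have eq: "AE t\<in>?J in lborel. ?c t = rl_kernel_vec \<alpha> (t - s) (axis j 1) + rl_int_vec \<alpha> (\<lambda>\<tau>. A2 \<tau> *v ?c \<tau> + 0) t"
    using resolvent_solves[OF I \<alpha>0 A'(1) s(1), of j] by (auto elim!: eventually_mono)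
  have Z: "loc_bdd ?J (\<lambda>t. (0::real^'m) $ i)" for i by (auto simp: loc_bdd_def intro!: exI[of _ 0])
  show "RL_vector_solution s ?J \<alpha> A (\<lambda>_. 0) (axis j 1) ?c"
    unfolding RL_vector_solution_iff[OF J \<alpha> A2 A2A, of "\<lambda>_. 0" "\<lambda>_. 0", OF Z, simplified]
    using vJ eq by (intro exI[of _ ?c]) simp
qed

section \<open>The state-transition matrix agrees with the resolvent\<close>

lemma resolvent_joint_measurable:
  fixes \<alpha> :: "real^'m"
  assumes I: "I \<in> intervals_from a" and A: "\<And>i j. loc_bdd I (\<lambda>t. A t $ i $ j)"
  shows "(\<lambda>p. resolvent I \<alpha> A (fst p) (snd p)) \<in> borel_measurable (borel \<Otimes>\<^sub>M borel)"
  by (intro borel_measurable_mat resolvent_measurable intervals_fromD(6)[OF I]) (use A in \<open>simp add: loc_bdd_def\<close>)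

definition strict_triangle :: "real set \<Rightarrow> (real \<times> real) set" where
  "strict_triangle I = {(t, s). t \<in> I \<and> s \<in> I \<and> s < t}"

lemma strict_triangle_borel:
  assumes "I \<in> sets borel"
  shows "strict_triangle I \<in> sets borel"
proof -
  have "strict_triangle I = (I \<times> I) \<inter> {p. snd p < fst p}" by (auto simp: strict_triangle_def)
  moreover have "I \<times> I \<in> sets (borel \<Otimes>\<^sub>M borel)" using assms by auto
  moreover have "open {p::real\<times>real. snd p < fst p}" by (intro open_Collect_less continuous_intros)
  ultimately show ?thesis unfolding borel_prod by (simp add: sets.Int borel_open)
qed

text \<open>The existence behind the choice in \<open>RL_state_transition\<close>.\<close>

lemma resolvent_is_state_transition:
  fixes A :: "real \<Rightarrow> real^'m^'m"
  assumes I: "I \<in> intervals_from a" and \<alpha>: "\<And>i. 0 < \<alpha> $ i \<and> \<alpha> $ i \<le> 1"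
    and A': "\<And>i j. loc_bdd I (\<lambda>t. A' t $ i $ j)" "AE t\<in>I in lborel. A t = A' t"
  shows "is_RL_state_transition I A (row_constant \<alpha>) (resolvent I \<alpha> A')"
  unfolding is_RL_state_transition_def
proof (intro conjI ballI impI)
  fix s assume "s \<in> I" "\<exists>r\<in>I. s < r"
  then show "RL_matrix_solution s (I \<inter> {s..}) (row_constant \<alpha>) A (\<lambda>t. resolvent I \<alpha> A' t s)"
    using resolvent_matrix_solution[OF I \<alpha> A'] by blast
next
  have "(\<lambda>p. resolvent I \<alpha> A' (fst p) (snd p)) \<in> borel_measurable lborel"
    using resolvent_joint_measurable[OF I A'(1)] by (simp add: borel_prod)
  then have "(\<lambda>p. resolvent I \<alpha> A' (fst p) (snd p)) \<in> borel_measurable lebesgue" by (rule measurable_completion)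
  then show "(\<lambda>(t, s). resolvent I \<alpha> A' t s) \<in> borel_measurable (lebesgue_on {(t, s). t \<in> I \<and> s \<in> I \<and> s < t})"
    unfolding case_prod_unfold by (rule measurable_restrict_space1)
qed

lemma matrix_solution_unique:
  fixes A :: "real \<Rightarrow> real^'m^'m"
  assumes I: "I \<in> intervals_from s" and \<alpha>: "\<And>i. 0 < \<alpha> $ i \<and> \<alpha> $ i \<le> 1" and A: "A \<in> Linf_loc I"
    and "RL_matrix_solution s I (row_constant \<alpha>) A X" "RL_matrix_solution s I (row_constant \<alpha>) A Y"
  shows "AE t\<in>I in lborel. X t = Y t"
proof -
  have "AE t in lborel. \<forall>j. t \<in> I \<longrightarrow> column j (X t) = column j (Y t)"
    using RL_vector_solution_unique[OF I \<alpha> A Linf_loc_zero] assms(4,5)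
    unfolding RL_matrix_solution_iff eventually_all_finite_iff by blast
  then show ?thesis by eventually_elim (simp add: vec_eq_iff column_def)
qed

text \<open>For each \<open>s\<close> uniqueness gives equality at almost every \<open>t\<close>;
  joint measurability then allows the order to be exchanged. The initial time \<open>a\<close> needs
  a statement of its own, since the line \<open>s = a\<close> is a null set of the plane.\<close>

lemma state_transition_eq_resolvent:
  fixes A :: "real \<Rightarrow> real^'m^'m"
  assumes I: "I \<in> intervals_from a" and \<alpha>: "\<And>i. 0 < \<alpha> $ i \<and> \<alpha> $ i \<le> 1" and A: "A \<in> Linf_loc I"
    and A': "\<And>i j. loc_bdd I (\<lambda>t. A' t $ i $ j)" "AE t\<in>I in lborel. A t = A' t"
    and Z: "is_RL_state_transition I A (row_constant \<alpha>) Z"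
  shows "AE t\<in>I in lborel. Z t a = resolvent I \<alpha> A' t a"
    and "AE t in lborel. AE s in lborel. t \<in> I \<longrightarrow> s \<in> I \<longrightarrow> s < t \<longrightarrow> Z t s = resolvent I \<alpha> A' t s"
proof -
  note ID = intervals_fromD[OF I]
  let ?R = "resolvent I \<alpha> A'"
  have sec: "AE t\<in>I in lborel. s \<le> t \<longrightarrow> Z t s = ?R t s" if s: "s \<in> I" "r \<in> I" "s < r" for s r
  proof -
    have "RL_matrix_solution s (I \<inter> {s..}) (row_constant \<alpha>) A (\<lambda>t. Z t s)"
      using Z s unfolding is_RL_state_transition_def by blast
    from matrix_solution_unique[OF intervals_from_tail[OF I s] \<alpha> Linf_loc_subset[OF A] this
        resolvent_matrix_solution[OF I \<alpha> A' s]]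
    show ?thesis by (auto elim!: eventually_mono)
  qed
  obtain r where "r \<in> I" "a < r" using ID(5) by blast
  from sec[OF ID(1) this] show "AE t\<in>I in lborel. Z t a = ?R t a"
    by eventually_elim (use ID(2) in auto)
  let ?D = "strict_triangle I"
  define E where "E = {p\<in>?D. Z (fst p) (snd p) \<noteq> ?R (fst p) (snd p)}"
  have D: "?D \<in> sets lebesgue" using strict_triangle_borel[OF ID(6)] by simp
  have "(\<lambda>p. ?R (fst p) (snd p)) \<in> borel_measurable (lebesgue_on ?D)"
    using resolvent_is_state_transition[OF I \<alpha> A']
    by (simp add: is_RL_state_transition_def case_prod_unfold strict_triangle_def)
  moreover have "(\<lambda>p. Z (fst p) (snd p)) \<in> borel_measurable (lebesgue_on ?D)"
    using Z by (simp add: is_RL_state_transition_def case_prod_unfold strict_triangle_def)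
  ultimately have "(\<lambda>p. Z (fst p) (snd p) - ?R (fst p) (snd p)) \<in> borel_measurable (lebesgue_on ?D)"
    by (rule borel_measurable_diff[rotated])
  then have "{p\<in>space (lebesgue_on ?D). Z (fst p) (snd p) - ?R (fst p) (snd p) \<noteq> 0} \<in> sets (lebesgue_on ?D)"
    by measurable
  then have "E \<in> sets (lebesgue_on ?D)" by (simp add: E_def space_restrict_space)
  then have "E \<in> sets lebesgue" using D by (simp add: sets_restrict_space_iff)
  moreover have "AE t in lborel. (t, s) \<notin> E" for s
  proof (cases "s \<in> I \<and> (\<exists>r\<in>I. s < r)")
    case True
    then obtain r where "s \<in> I" "r \<in> I" "s < r" by blast
    from sec[OF this] show ?thesis by eventually_elim (auto simp: E_def strict_triangle_def)
  next
    \<comment> \<open>If \<open>s\<close> lies outside \<open>I\<close> or is its greatest element,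
      no point of the triangle has second coordinate \<open>s\<close>.\<close>
    case False
    then show ?thesis by (intro AE_I2) (auto simp: E_def strict_triangle_def)
  qed
  ultimately have "AE t in lborel. AE s in lborel. (t, s) \<notin> E" by (rule lebesgue_null_sections)
  then show "AE t in lborel. AE s in lborel. t \<in> I \<longrightarrow> s \<in> I \<longrightarrow> s < t \<longrightarrow> Z t s = ?R t s"
  proof eventually_elim
    case (elim t)
    then show ?case by eventually_elim (auto simp: E_def strict_triangle_def)
  qed
qed

section \<open>Variation of constants\<close>

lemma norm_matrix_vector_le_columns:
  fixes M :: "real^'m^'n"
  shows "norm (M *v x) \<le> (\<Sum>j\<in>UNIV. norm (column j M)) * norm x"
proof -
  have "norm (M *v x) \<le> (\<Sum>j\<in>UNIV. norm (x $ j *\<^sub>R column j M))"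
    unfolding matrix_vector_mult_columns by (rule norm_sum)
  also have "\<dots> \<le> (\<Sum>j\<in>UNIV. norm (column j M) * norm x)"
    by (intro sum_mono) (simp add: mult.commute[of _ "norm x"] component_le_norm_cart mult_right_mono)
  finally show ?thesis by (simp add: sum_distrib_right)
qed

context
  fixes a :: real and I :: "real set" and \<alpha> :: "real^'m" and A :: "real \<Rightarrow> real^'m^'m" and B :: "real \<Rightarrow> real^'m"
  assumes I: "I \<in> intervals_from a" and \<alpha>: "\<And>i. 0 < \<alpha> $ i"
    and A: "\<And>i j. loc_bdd I (\<lambda>t. A t $ i $ j)" and B: "vec_loc_int I B"
begin

text \<open>The resolvent vanishes unless both times lie in \<open>I\<close> and
  \<open>s < t\<close>, so the integral over \<open>{a..t}\<close> can be taken over the whole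
  line.\<close>

definition forced_integrand :: "real \<Rightarrow> real \<Rightarrow> real^'m" where
  "forced_integrand t s = resolvent I \<alpha> A t s *v B s"

definition forced :: "real \<Rightarrow> real^'m" where
  "forced t = (LINT s|lborel. forced_integrand t s)"

definition forced_norm :: "real \<Rightarrow> ennreal" where
  "forced_norm t = (\<integral>\<^sup>+s. ennreal (norm (forced_integrand t s)) \<partial>lborel)"

lemma coefficient_measurable: "(\<lambda>t. A t $ i $ j) \<in> borel_measurable borel"
  using A by (simp add: loc_bdd_def)

lemma forced_integrand_measurable:
  "(\<lambda>p. forced_integrand (fst p) (snd p)) \<in> borel_measurable (borel \<Otimes>\<^sub>M borel)"
proof (rule borel_measurable_vec)
  fix i
  note [measurable] = vec_loc_int_measurable[OF B] resolvent_measurable[OF coefficient_measurable intervals_fromD(6)[OF I]]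
  show "(\<lambda>p. forced_integrand (fst p) (snd p) $ i) \<in> borel_measurable (borel \<Otimes>\<^sub>M borel)"
    unfolding forced_integrand_def matrix_vector_mult_def by simp
qed

lemma forced_integrand_measurable_lborel:
  "(\<lambda>p. forced_integrand (fst p) (snd p)) \<in> borel_measurable (lborel \<Otimes>\<^sub>M lborel)"
  using forced_integrand_measurable by (simp add: borel_prod lborel_prod)

lemma forced_integrand_measurable_section: "forced_integrand t \<in> borel_measurable borel"
  using section_measurable[OF forced_integrand_measurable] .

lemma forced_integrand_zero: "t \<notin> I \<or> s \<notin> I \<or> t \<le> s \<Longrightarrow> forced_integrand t s = 0"
  using resolvent_zero[of t I s \<alpha> A] by (simp add: forced_integrand_def)

lemma forced_norm_measurable: "forced_norm \<in> borel_measurable borel"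
proof -
  have "(\<lambda>t. \<integral>\<^sup>+s. ennreal (norm (forced_integrand (fst (t, s)) (snd (t, s)))) \<partial>lborel) \<in> borel_measurable lborel"
    by (rule lborel.borel_measurable_nn_integral_fst)
      (use forced_integrand_measurable_lborel in measurable)
  then show ?thesis by (simp add: forced_norm_def[abs_def])
qed

lemma forced_measurable: "forced \<in> borel_measurable borel"
proof -
  have "(\<lambda>t. LINT s|lborel. forced_integrand t s) \<in> borel_measurable lborel"
    by (rule lborel.borel_measurable_lebesgue_integral)
      (use forced_integrand_measurable_lborel in \<open>simp add: case_prod_unfold\<close>)
  then show ?thesis by (simp add: forced_def[abs_def])
qed

text \<open>After swapping the integrals, the one over \<open>t\<close> is at most a constant times
  the norm of \<open>B s\<close>, with the constant independent of \<open>s\<close> by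
  \<open>resolvent_bounded\<close>.\<close>

lemma forced_norm_integral_finite:
  assumes T: "T \<in> I"
  shows "(\<integral>\<^sup>+t. indicator {..T} t * forced_norm t \<partial>lborel) < \<infinity>"
proof -
  let ?N = "\<lambda>t s. \<Sum>j\<in>UNIV. norm (column j (resolvent I \<alpha> A t s))"
  note [measurable] = forced_integrand_measurable_lborel
  have "\<forall>j. \<exists>M. \<forall>s\<in>I. (\<integral>\<^sup>+t. indicator {..T} t * ennreal (norm (column j (resolvent I \<alpha> A t s))) \<partial>lborel) \<le> ennreal M"
    using resolvent_bounded[OF I \<alpha> A T] by blast
  then obtain M where M: "\<And>j s. s \<in> I \<Longrightarrow> (\<integral>\<^sup>+t. indicator {..T} t * ennreal (norm (column j (resolvent I \<alpha> A t s))) \<partial>lborel) \<le> ennreal (M j)"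
    unfolding choice_iff by blast
  define C where "C = (\<Sum>j\<in>UNIV. ennreal (M j))"
  have C: "C < \<infinity>" by (simp add: C_def)
  have inner: "(\<integral>\<^sup>+t. indicator {..T} t * ennreal (norm (forced_integrand t s)) \<partial>lborel) \<le> C * ennreal (indicator {..T} s * norm (B s))" for s
  proof (cases "s \<in> I \<and> s \<le> T")
    case True
    have cm: "(\<lambda>t. norm (column j (resolvent I \<alpha> A t s))) \<in> borel_measurable borel" for j
      by (rule norm_measurable_vec[OF vec_loc_int_measurable[OF resolvent_column_vec_loc_int[OF I \<alpha> A]]]) (use True in simp)
    have "(\<integral>\<^sup>+t. indicator {..T} t * ennreal (norm (forced_integrand t s)) \<partial>lborel)
        \<le> (\<integral>\<^sup>+t. (\<Sum>j\<in>UNIV. indicator {..T} t * ennreal (norm (column j (resolvent I \<alpha> A t s)))) * ennreal (norm (B s)) \<partial>lborel)"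
    proof (rule nn_integral_mono)
      fix t
      have "ennreal (norm (forced_integrand t s)) \<le> ennreal (?N t s * norm (B s))"
        unfolding forced_integrand_def by (intro ennreal_leI norm_matrix_vector_le_columns)
      also have "\<dots> = (\<Sum>j\<in>UNIV. ennreal (norm (column j (resolvent I \<alpha> A t s)))) * ennreal (norm (B s))"
        by (simp add: ennreal_mult sum_nonneg sum_ennreal)
      finally show "indicator {..T} t * ennreal (norm (forced_integrand t s)) \<le>
          (\<Sum>j\<in>UNIV. indicator {..T} t * ennreal (norm (column j (resolvent I \<alpha> A t s)))) * ennreal (norm (B s))"
        by (auto simp: indicator_def)
    qed
    also have "\<dots> = (\<integral>\<^sup>+t. (\<Sum>j\<in>UNIV. indicator {..T} t * ennreal (norm (column j (resolvent I \<alpha> A t s)))) \<partial>lborel) * ennreal (norm (B s))"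
      by (rule nn_integral_multc) (use cm in measurable)
    also have "(\<integral>\<^sup>+t. (\<Sum>j\<in>UNIV. indicator {..T} t * ennreal (norm (column j (resolvent I \<alpha> A t s)))) \<partial>lborel)
        = (\<Sum>j\<in>UNIV. \<integral>\<^sup>+t. indicator {..T} t * ennreal (norm (column j (resolvent I \<alpha> A t s))) \<partial>lborel)"
      by (rule nn_integral_sum) (use cm in measurable)
    also have "\<dots> * ennreal (norm (B s)) \<le> C * ennreal (norm (B s))"
      unfolding C_def using M True by (intro mult_right_mono sum_mono) auto
    finally show ?thesis using True by simp
  next
    case False
    have "(\<integral>\<^sup>+t. indicator {..T} t * ennreal (norm (forced_integrand t s)) \<partial>lborel) = (\<integral>\<^sup>+(t::real). 0 \<partial>lborel)"
    proof (rule nn_integral_cong)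
      fix t show "indicator {..T} t * ennreal (norm (forced_integrand t s)) = 0"
        using False forced_integrand_zero[of t s] by (cases "t \<le> T") auto
    qed
    then show ?thesis by simp
  qed
  have "(\<integral>\<^sup>+t. indicator {..T} t * forced_norm t \<partial>lborel) = (\<integral>\<^sup>+t. \<integral>\<^sup>+s. indicator {..T} t * ennreal (norm (forced_integrand t s)) \<partial>lborel \<partial>lborel)"
    unfolding forced_norm_def using forced_integrand_measurable_section
    by (intro nn_integral_cong nn_integral_cmult[symmetric]) measurable
  also have "\<dots> = (\<integral>\<^sup>+s. \<integral>\<^sup>+t. indicator {..T} t * ennreal (norm (forced_integrand t s)) \<partial>lborel \<partial>lborel)"
  proof (rule lborel_pair.Fubini')
    have [measurable]: "(\<lambda>p. forced_integrand (snd p) (fst p)) \<in> borel_measurable (lborel \<Otimes>\<^sub>M lborel)"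
      by (rule measurable_compose[of "\<lambda>q. (snd q, fst q)" _ "lborel \<Otimes>\<^sub>M lborel", OF _ forced_integrand_measurable_lborel, simplified]) measurable
    show "(\<lambda>(s, t). indicator {..T} t * ennreal (norm (forced_integrand t s))) \<in> borel_measurable (lborel \<Otimes>\<^sub>M lborel)"
      unfolding case_prod_unfold by measurable
  qed
  also have "\<dots> \<le> (\<integral>\<^sup>+s. C * ennreal (indicator {..T} s * norm (B s)) \<partial>lborel)"
    by (intro nn_integral_mono inner)
  also have "\<dots> = C * (\<integral>\<^sup>+s. ennreal (indicator {..T} s * norm (B s)) \<partial>lborel)"
    by (rule nn_integral_cmult) (use norm_measurable_vec[OF vec_loc_int_measurable[OF B]] in measurable)
  also have "\<dots> < \<infinity>" using C vec_loc_int_norm_finite[OF B T] by (simp add: ennreal_mult_less_top)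
  finally show ?thesis .
qed

lemma forced_norm_finite_AE: "AE t\<in>I in lborel. forced_norm t < \<infinity>"
proof (rule AE_on_interval[OF I])
  fix T assume T: "T \<in> I"
  have "AE t in lborel. indicator {..T} t * forced_norm t \<noteq> \<infinity>"
    using forced_norm_integral_finite[OF T] forced_norm_measurable by (intro nn_integral_PInf_AE) auto
  then show "AE t\<in>I in lborel. t \<le> T \<longrightarrow> forced_norm t < \<infinity>"
    by eventually_elim (auto simp: less_top)
qed

lemma forced_integrable: "forced_norm t < \<infinity> \<Longrightarrow> integrable lborel (forced_integrand t)"
  using forced_integrand_measurable_section by (intro integrableI_bounded) (auto simp: forced_norm_def)

lemma norm_forced_le: "ennreal (norm (forced t)) \<le> forced_norm t"
proof (cases "integrable lborel (forced_integrand t)")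
  case True
  then show ?thesis unfolding forced_def forced_norm_def by (rule integral_norm_bound_ennreal)
qed (simp add: forced_def not_integrable_integral_eq)

lemma forced_zero: "t \<notin> I \<Longrightarrow> forced t = 0"
  by (simp add: forced_def forced_integrand_zero)

lemma forced_vec_loc_int: "vec_loc_int I forced"
  unfolding vec_loc_int_def loc_int_def
proof (intro allI conjI ballI impI)
  fix i
  show m: "(\<lambda>t. forced t $ i) \<in> borel_measurable borel" by (rule borel_measurable_vec_nth[OF forced_measurable])
  show "forced x $ i = 0" if "x \<notin> I" for x using forced_zero[OF that] by simp
  fix T assume T: "T \<in> I"
  show "integrable lborel (\<lambda>t. indicator {..T} t * forced t $ i)"
  proof (rule integrableI_bounded)
    have "(\<integral>\<^sup>+t. ennreal (norm (indicator {..T} t * forced t $ i)) \<partial>lborel) \<le> (\<integral>\<^sup>+t. indicator {..T} t * forced_norm t \<partial>lborel)"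
    proof (rule nn_integral_mono)
      fix t
      have "ennreal \<bar>forced t $ i\<bar> \<le> forced_norm t"
        using norm_forced_le[of t] component_le_norm_cart[of "forced t" i] by (meson ennreal_leI order_trans)
      then show "ennreal (norm (indicator {..T} t * forced t $ i)) \<le> indicator {..T} t * forced_norm t"
        by (auto simp: indicator_def)
    qed
    also note forced_norm_integral_finite[OF T]
    finally show "(\<integral>\<^sup>+t. ennreal (norm (indicator {..T} t * forced t $ i)) \<partial>lborel) < \<infinity>" .
  qed (use m in measurable)
qed

text \<open>Provides the absolute integrability behind the exchange of integrals in
  \<open>forced_swap\<close>.\<close>

lemma majorant_forced_norm_finite_AE: "AE t\<in>I in lborel. majorant \<alpha> A forced_norm t < \<infinity>"
proof (rule AE_on_interval[OF I])
  fix T assume T: "T \<in> I"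
  obtain l where l: "l > 0" "\<And>u. u \<in> borel_measurable borel \<Longrightarrow> weighted_int T l (majorant \<alpha> A u) \<le> ennreal (1/2) * weighted_int T l u"
    using majorant_contraction[of \<alpha>, OF \<alpha> A T] by blast
  have z: "forced_norm t = 0" if "t < a" for t
  proof -
    have "t \<notin> I" using that intervals_fromD(2)[OF I, of t] by auto
    then show ?thesis by (simp add: forced_norm_def forced_integrand_zero)
  qed
  have "weighted_int T l forced_norm \<le> ennreal (exp (- l * a)) * (\<integral>\<^sup>+t. indicator {..T} t * forced_norm t \<partial>lborel)"
    using l(1) by (intro weighted_int_le_integral forced_norm_measurable z) auto
  also have "\<dots> < \<infinity>" using forced_norm_integral_finite[OF T] by (simp add: ennreal_mult_less_top)
  finally have "ennreal (1/2) * weighted_int T l forced_norm < \<infinity>"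
    by (auto simp only: ennreal_mult_less_top ennreal_less_top infinity_ennreal_def)
  then have "weighted_int T l (majorant \<alpha> A forced_norm) < \<infinity>" by (rule le_less_trans[OF l(2)[OF forced_norm_measurable]])
  from weighted_int_finite_AE[OF majorant_measurable[OF coefficient_measurable forced_norm_measurable] this]
  show "AE t\<in>I in lborel. t \<le> T \<longrightarrow> majorant \<alpha> A forced_norm t < \<infinity>"
    by (auto elim!: eventually_mono)
qed

text \<open>\<open>resolvent_vec_solves\<close> gives the equation for each \<open>s\<close> in
  \<open>I\<close> at almost every \<open>t\<close>. Integrating over \<open>s\<close> requires the
  other order; both sides are jointly Borel, so the exceptional set is measurable with null
  sections.\<close>

lemma forced_integrand_equation:
  "AE t\<in>I in lborel. (AE s in lborel. forced_integrand t s =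
     rl_kernel_vec \<alpha> (t - s) (B s) + rl_int_vec \<alpha> (\<lambda>\<tau>. A \<tau> *v forced_integrand \<tau> s) t)"
proof -
  let ?rhs = "\<lambda>t s. rl_kernel_vec \<alpha> (t - s) (B s) + rl_int_vec \<alpha> (\<lambda>\<tau>. A \<tau> *v forced_integrand \<tau> s) t"
  define E where "E = {p. fst p \<in> I \<and> forced_integrand (fst p) (snd p) \<noteq> ?rhs (fst p) (snd p)}"
  have comp: "(\<lambda>p. forced_integrand (fst p) (snd p) $ i) \<in> borel_measurable (borel \<Otimes>\<^sub>M borel)" for i
    by (rule borel_measurable_vec_nth[OF forced_integrand_measurable])
  have rhs: "(\<lambda>p. ?rhs (fst p) (snd p)) \<in> borel_measurable (borel \<Otimes>\<^sub>M borel)"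
  proof (rule borel_measurable_vec)
    fix i
    note [measurable] = vec_loc_int_measurable[OF B] coefficient_measurable
    have c[measurable]: "(\<lambda>q. forced_integrand (snd q) (snd (fst q)) $ j) \<in> borel_measurable ((borel \<Otimes>\<^sub>M borel) \<Otimes>\<^sub>M lborel)" for j
      by (rule measurable_compose[of "\<lambda>q. (snd q, snd (fst q))" _ "borel \<Otimes>\<^sub>M borel", OF _ comp, simplified]) measurable
    have "(\<lambda>p. LINT \<tau>|lborel. rl_kernel (\<alpha> $ i) (fst p - \<tau>) * (\<Sum>j\<in>UNIV. A \<tau> $ i $ j * forced_integrand \<tau> (snd p) $ j))
        \<in> borel_measurable (borel \<Otimes>\<^sub>M borel)"
      by (rule lborel.borel_measurable_lebesgue_integral) (unfold case_prod_unfold, measurable)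
    then show "(\<lambda>p. ?rhs (fst p) (snd p) $ i) \<in> borel_measurable (borel \<Otimes>\<^sub>M borel)"
      unfolding vector_add_component rl_int_vec_def rl_int_def matrix_vector_mult_def rl_kernel_vec_def vec_lambda_beta by measurable
  qed
  have "E \<in> sets (borel \<Otimes>\<^sub>M borel)"
  proof -
    have "(\<lambda>p. forced_integrand (fst p) (snd p) - ?rhs (fst p) (snd p)) \<in> borel_measurable (borel \<Otimes>\<^sub>M borel)"
      by (rule borel_measurable_diff[OF forced_integrand_measurable rhs])
    then have "{p\<in>space (borel \<Otimes>\<^sub>M borel). forced_integrand (fst p) (snd p) - ?rhs (fst p) (snd p) \<noteq> 0} \<in> sets (borel \<Otimes>\<^sub>M borel)"
      by measurable
    moreover have "I \<times> UNIV \<in> sets (borel \<Otimes>\<^sub>M (borel :: real measure))" using intervals_fromD(6)[OF I] by auto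
    ultimately have "(I \<times> UNIV) \<inter> {p\<in>space (borel \<Otimes>\<^sub>M borel). forced_integrand (fst p) (snd p) - ?rhs (fst p) (snd p) \<noteq> 0} \<in> sets (borel \<Otimes>\<^sub>M borel)"
      by (rule sets.Int[rotated])
    also have "(I \<times> UNIV) \<inter> {p\<in>space (borel \<Otimes>\<^sub>M borel). forced_integrand (fst p) (snd p) - ?rhs (fst p) (snd p) \<noteq> 0} = E"
      by (auto simp: E_def space_pair_measure)
    finally show ?thesis .
  qed
  then have "E \<in> sets borel" unfolding borel_prod .
  then have "E \<in> sets lebesgue" by simp
  moreover have "AE t in lborel. (t, s) \<notin> E" for s
  proof (cases "s \<in> I")
    case True
    from resolvent_vec_solves(2)[OF I \<alpha> A True, of "B s"]
    show ?thesis by eventually_elim (auto simp: E_def forced_integrand_def)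
  next
    case False
    then have z: "forced_integrand t s = 0" "B s = 0" for t
      using vec_loc_int_zero[OF B] by (auto simp: forced_integrand_zero)
    have "?rhs t s = 0" for t by (simp add: z rl_kernel_vec_def rl_int_vec_def rl_int_def vec_eq_iff)
    then show ?thesis by (intro AE_I2) (simp add: E_def z)
  qed
  ultimately have "AE t in lborel. AE s in lborel. (t, s) \<notin> E" by (rule lebesgue_null_sections)
  then show ?thesis
  proof eventually_elim
    case (elim t)
    show ?case
    proof
      assume "t \<in> I"
      show "AE s in lborel. forced_integrand t s = ?rhs t s"
        using elim by eventually_elim (use \<open>t \<in> I\<close> in \<open>auto simp: E_def\<close>)
    qed
  qed
qed

text \<open>Fubini in \<open>s\<close> and \<open>\<tau>\<close>: the norm of
  \<open>forced_integrand \<tau> s\<close> integrated over \<open>s\<close> is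
  \<open>forced_norm \<tau>\<close>, so \<open>K\<close> guarantees absolute integrability.\<close>

lemma forced_swap:
  assumes t: "t \<in> I" and K: "majorant \<alpha> A forced_norm t < \<infinity>"
  shows "(LINT s|lborel. rl_int (\<alpha> $ i) (\<lambda>\<tau>. (A \<tau> *v forced_integrand \<tau> s) $ i) t) = rl_int (\<alpha> $ i) (\<lambda>\<tau>. (A \<tau> *v forced \<tau>) $ i) t"
    and "integrable lborel (\<lambda>s. rl_int (\<alpha> $ i) (\<lambda>\<tau>. (A \<tau> *v forced_integrand \<tau> s) $ i) t)"
proof -
  let ?F = "\<lambda>\<tau> s. rl_kernel (\<alpha> $ i) (t - \<tau>) * (A \<tau> *v forced_integrand \<tau> s) $ i"
  note [measurable] = coefficient_measurable forced_integrand_measurable_lborel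
  have c[measurable]: "(\<lambda>p. forced_integrand (fst p) (snd p) $ j) \<in> borel_measurable (lborel \<Otimes>\<^sub>M lborel)" for j
    by (rule borel_measurable_vec_nth[OF forced_integrand_measurable_lborel])
  have Fm: "(\<lambda>(\<tau>, s). ?F \<tau> s) \<in> borel_measurable (lborel \<Otimes>\<^sub>M lborel)"
    unfolding matrix_vector_mult_def case_prod_unfold vec_lambda_beta by measurable
  have int: "integrable (lborel \<Otimes>\<^sub>M lborel) (\<lambda>(\<tau>, s). ?F \<tau> s)"
  proof (rule integrableI_bounded[OF Fm])
    have "(\<integral>\<^sup>+p. ennreal (norm (case p of (\<tau>, s) \<Rightarrow> ?F \<tau> s)) \<partial>(lborel \<Otimes>\<^sub>M lborel))
        = (\<integral>\<^sup>+\<tau>. \<integral>\<^sup>+s. ennreal (norm (?F \<tau> s)) \<partial>lborel \<partial>lborel)"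
      using Fm by (subst lborel.nn_integral_fst[symmetric]) (auto simp: case_prod_unfold)
    also have "\<dots> \<le> (\<integral>\<^sup>+\<tau>. \<integral>\<^sup>+s. ennreal (kernel_sum \<alpha> (t - \<tau>)) * (ennreal (entry_sum A \<tau>) * ennreal (norm (forced_integrand \<tau> s))) \<partial>lborel \<partial>lborel)"
    proof (intro nn_integral_mono)
      fix \<tau> s
      have "rl_kernel (\<alpha> $ i) (t - \<tau>) \<le> kernel_sum \<alpha> (t - \<tau>)"
        unfolding kernel_sum_def by (rule member_le_sum) (use rl_kernel_nonneg[OF \<alpha>] in auto)
      then have "norm (?F \<tau> s) \<le> kernel_sum \<alpha> (t - \<tau>) * (entry_sum A \<tau> * norm (forced_integrand \<tau> s))"
        using matrix_vector_mult_component_le[of A \<tau> "forced_integrand \<tau> s" i] rl_kernel_nonneg[OF \<alpha>] kernel_sum_nonneg[of \<alpha>, OF \<alpha>]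
        by (simp add: abs_mult mult_mono)
      then have "ennreal (norm (?F \<tau> s)) \<le> ennreal (kernel_sum \<alpha> (t - \<tau>) * (entry_sum A \<tau> * norm (forced_integrand \<tau> s)))" by (rule ennreal_leI)
      then show "ennreal (norm (?F \<tau> s)) \<le> ennreal (kernel_sum \<alpha> (t - \<tau>)) * (ennreal (entry_sum A \<tau>) * ennreal (norm (forced_integrand \<tau> s)))"
        using kernel_sum_nonneg[of \<alpha>, OF \<alpha>] entry_sum_nonneg[of A] by (simp add: ennreal_mult)
    qed
    also have "\<dots> = majorant \<alpha> A forced_norm t"
      unfolding majorant_def forced_norm_def using forced_integrand_measurable_section
      by (simp add: nn_integral_cmult)
    also note K
    finally show "(\<integral>\<^sup>+p. ennreal (norm (case p of (\<tau>, s) \<Rightarrow> ?F \<tau> s)) \<partial>(lborel \<Otimes>\<^sub>M lborel)) < \<infinity>" .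
  qed
  show "integrable lborel (\<lambda>s. rl_int (\<alpha> $ i) (\<lambda>\<tau>. (A \<tau> *v forced_integrand \<tau> s) $ i) t)"
    unfolding rl_int_def by (rule lborel_pair.integrable_snd[OF int])
  have "(LINT s|lborel. rl_int (\<alpha> $ i) (\<lambda>\<tau>. (A \<tau> *v forced_integrand \<tau> s) $ i) t) = (LINT s|lborel. LINT \<tau>|lborel. ?F \<tau> s)"
    by (simp add: rl_int_def)
  also have "\<dots> = (LINT \<tau>|lborel. LINT s|lborel. ?F \<tau> s)" by (rule lborel_pair.Fubini_integral[OF int])
  also have "\<dots> = rl_int (\<alpha> $ i) (\<lambda>\<tau>. (A \<tau> *v forced \<tau>) $ i) t"
    unfolding rl_int_def
  proof (rule integral_cong_AE)
    show "(\<lambda>\<tau>. LINT s|lborel. ?F \<tau> s) \<in> borel_measurable lborel"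
      by (rule lborel.borel_measurable_lebesgue_integral[OF Fm])
    have "(\<lambda>\<tau>. (A \<tau> *v forced \<tau>) $ i) \<in> borel_measurable borel"
      by (rule vec_loc_int_measurable[OF vec_loc_int_matrix_mult[OF A forced_vec_loc_int]])
    then show "(\<lambda>\<tau>. rl_kernel (\<alpha> $ i) (t - \<tau>) * (A \<tau> *v forced \<tau>) $ i) \<in> borel_measurable lborel" by measurable
    show "AE \<tau> in lborel. (LINT s|lborel. ?F \<tau> s) = rl_kernel (\<alpha> $ i) (t - \<tau>) * (A \<tau> *v forced \<tau>) $ i"
      using forced_norm_finite_AE
    proof eventually_elim
      case (elim \<tau>)
      show ?case
      proof (cases "\<tau> \<in> I")
        case True
        then have fint: "integrable lborel (forced_integrand \<tau>)" using elim by (intro forced_integrable) simp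
        then have fij: "integrable lborel (\<lambda>s. forced_integrand \<tau> s $ j)"
          and nth: "(LINT s|lborel. forced_integrand \<tau> s $ j) = forced \<tau> $ j" for j
          unfolding forced_def
          by (auto intro: integrable_bounded_linear[OF bounded_linear_vec_nth] integral_bounded_linear[OF bounded_linear_vec_nth])
        have "(LINT s|lborel. (A \<tau> *v forced_integrand \<tau> s) $ i) = (\<Sum>j\<in>UNIV. LINT s|lborel. A \<tau> $ i $ j * forced_integrand \<tau> s $ j)"
          unfolding matrix_vector_mult_def vec_lambda_beta using fij by (intro Bochner_Integration.integral_sum) auto
        then show ?thesis by (simp add: matrix_vector_mult_def nth)
      next
        case False
        then have "A \<tau> = 0" using A by (simp add: loc_bdd_def vec_eq_iff)
        then show ?thesis by simp
      qed
    qed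
  qed
  finally show "(LINT s|lborel. rl_int (\<alpha> $ i) (\<lambda>\<tau>. (A \<tau> *v forced_integrand \<tau> s) $ i) t) = rl_int (\<alpha> $ i) (\<lambda>\<tau>. (A \<tau> *v forced \<tau>) $ i) t" .
qed

text \<open>The equation of \<open>forced_integrand\<close> is integrated over \<open>s\<close>: the
  kernel term becomes the convolution with \<open>B\<close>, the other term the convolution with
  \<open>A *v forced\<close>.\<close>

lemma forced_equation:
  "AE t\<in>I in lborel. forced t = rl_int_vec \<alpha> (\<lambda>\<tau>. A \<tau> *v forced \<tau> + B \<tau>) t"
proof -
  have "AE t in lborel. \<forall>i. t \<in> I \<longrightarrow> integrable lborel (\<lambda>\<tau>. rl_kernel (\<alpha> $ i) (t - \<tau>) * B \<tau> $ i)"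
    using rl_int_integrable_AE[OF I _ \<alpha>] B by (simp only: eventually_all_finite_iff vec_loc_int_def) blast
  then show ?thesis
    using forced_norm_finite_AE majorant_forced_norm_finite_AE forced_integrand_equation
      rl_int_vec_add_AE[OF I \<alpha> vec_loc_int_matrix_mult[OF A forced_vec_loc_int] B]
  proof eventually_elim
    case (elim t)
    show ?case
    proof
      assume t: "t \<in> I"
      then have K: "majorant \<alpha> A forced_norm t < \<infinity>" and fint: "integrable lborel (forced_integrand t)"
        and eq: "AE s in lborel. forced_integrand t s = rl_kernel_vec \<alpha> (t - s) (B s) + rl_int_vec \<alpha> (\<lambda>\<tau>. A \<tau> *v forced_integrand \<tau> s) t"
        and Bi: "\<And>i. integrable lborel (\<lambda>\<tau>. rl_kernel (\<alpha> $ i) (t - \<tau>) * B \<tau> $ i)"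
        using elim by (auto intro: forced_integrable)
      have "forced t $ i = rl_int (\<alpha> $ i) (\<lambda>\<tau>. B \<tau> $ i) t + rl_int (\<alpha> $ i) (\<lambda>\<tau>. (A \<tau> *v forced \<tau>) $ i) t" for i
      proof -
        have "forced t $ i = (LINT s|lborel. forced_integrand t s $ i)"
          unfolding forced_def by (rule integral_bounded_linear[OF bounded_linear_vec_nth fint, symmetric])
        also have "\<dots> = (LINT s|lborel. rl_kernel (\<alpha> $ i) (t - s) * B s $ i + rl_int (\<alpha> $ i) (\<lambda>\<tau>. (A \<tau> *v forced_integrand \<tau> s) $ i) t)"
        proof (rule integral_cong_AE)
          show "(\<lambda>s. forced_integrand t s $ i) \<in> borel_measurable lborel"
            using borel_measurable_vec_nth[OF forced_integrand_measurable_section] by simp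
          show "(\<lambda>s. rl_kernel (\<alpha> $ i) (t - s) * B s $ i + rl_int (\<alpha> $ i) (\<lambda>\<tau>. (A \<tau> *v forced_integrand \<tau> s) $ i) t) \<in> borel_measurable lborel"
            by (intro borel_measurable_add borel_measurable_integrable Bi forced_swap(2)[OF t K])
          show "AE s in lborel. forced_integrand t s $ i = rl_kernel (\<alpha> $ i) (t - s) * B s $ i + rl_int (\<alpha> $ i) (\<lambda>\<tau>. (A \<tau> *v forced_integrand \<tau> s) $ i) t"
            using eq
          proof eventually_elim
            case (elim s)
            then have "forced_integrand t s $ i = (rl_kernel_vec \<alpha> (t - s) (B s) + rl_int_vec \<alpha> (\<lambda>\<tau>. A \<tau> *v forced_integrand \<tau> s) t) $ i" by simp
            then show ?case by (simp add: rl_kernel_vec_def rl_int_vec_def mult.commute)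
          qed
        qed
        also have "\<dots> = rl_int (\<alpha> $ i) (\<lambda>\<tau>. B \<tau> $ i) t + rl_int (\<alpha> $ i) (\<lambda>\<tau>. (A \<tau> *v forced \<tau>) $ i) t"
          using Bochner_Integration.integral_add[OF Bi forced_swap(2)[OF t K]] forced_swap(1)[OF t K]
          by (simp add: rl_int_def)
        finally show ?thesis .
      qed
      then have "forced t = rl_int_vec \<alpha> (\<lambda>\<tau>. A \<tau> *v forced \<tau>) t + rl_int_vec \<alpha> B t" by (simp add: vec_eq_iff rl_int_vec_def)
      then show "forced t = rl_int_vec \<alpha> (\<lambda>\<tau>. A \<tau> *v forced \<tau> + B \<tau>) t" using elim t by simp
    qed
  qed
qed

text \<open>Superposition of the homogeneous solution with initial datum \<open>x\<close> and of
  \<open>forced\<close>, whose initial datum is 0.\<close>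

lemma variation_of_constants:
  shows "vec_loc_int I (\<lambda>t. resolvent I \<alpha> A t a *v x + forced t)"
    and "AE t\<in>I in lborel. resolvent I \<alpha> A t a *v x + forced t = rl_kernel_vec \<alpha> (t - a) x +
      rl_int_vec \<alpha> (\<lambda>\<tau>. A \<tau> *v (resolvent I \<alpha> A \<tau> a *v x + forced \<tau>) + B \<tau>) t"
proof -
  note R = resolvent_vec_solves[OF I \<alpha> A intervals_fromD(1)[OF I], of x]
  show "vec_loc_int I (\<lambda>t. resolvent I \<alpha> A t a *v x + forced t)" by (rule vec_loc_int_add[OF R(1) forced_vec_loc_int])
  have "vec_loc_int I (\<lambda>\<tau>. A \<tau> *v forced \<tau> + B \<tau>)" by (rule vec_loc_int_add[OF vec_loc_int_matrix_mult[OF A forced_vec_loc_int] B])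
  from rl_int_vec_add_AE[OF I \<alpha> vec_loc_int_matrix_mult[OF A R(1)] this]
  show "AE t\<in>I in lborel. resolvent I \<alpha> A t a *v x + forced t = rl_kernel_vec \<alpha> (t - a) x +
      rl_int_vec \<alpha> (\<lambda>\<tau>. A \<tau> *v (resolvent I \<alpha> A \<tau> a *v x + forced \<tau>) + B \<tau>) t"
    using R(2) forced_equation
  proof eventually_elim
    case (elim t)
    show ?case
    proof
      assume t: "t \<in> I"
      have e: "(\<lambda>\<tau>. A \<tau> *v (resolvent I \<alpha> A \<tau> a *v x + forced \<tau>) + B \<tau>) =
          (\<lambda>\<tau>. A \<tau> *v (resolvent I \<alpha> A \<tau> a *v x) + (A \<tau> *v forced \<tau> + B \<tau>))"
        by (simp add: matrix_vector_right_distrib add.assoc)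
      have 1: "resolvent I \<alpha> A t a *v x = rl_kernel_vec \<alpha> (t - a) x + rl_int_vec \<alpha> (\<lambda>\<tau>. A \<tau> *v (resolvent I \<alpha> A \<tau> a *v x)) t"
        and 2: "forced t = rl_int_vec \<alpha> (\<lambda>\<tau>. A \<tau> *v forced \<tau> + B \<tau>) t"
        and 3: "rl_int_vec \<alpha> (\<lambda>\<tau>. A \<tau> *v (resolvent I \<alpha> A \<tau> a *v x) + (A \<tau> *v forced \<tau> + B \<tau>)) t =
          rl_int_vec \<alpha> (\<lambda>\<tau>. A \<tau> *v (resolvent I \<alpha> A \<tau> a *v x)) t + rl_int_vec \<alpha> (\<lambda>\<tau>. A \<tau> *v forced \<tau> + B \<tau>) t"
        using elim t by blast+
      show "resolvent I \<alpha> A t a *v x + forced t = rl_kernel_vec \<alpha> (t - a) x +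
          rl_int_vec \<alpha> (\<lambda>\<tau>. A \<tau> *v (resolvent I \<alpha> A \<tau> a *v x + forced \<tau>) + B \<tau>) t"
        unfolding e 3 using arg_cong2[where f="(+)", OF 1 2] by (simp only: add.assoc)
    qed
  qed
qed

end

theorem theorem5:
  fixes a :: real and I :: "real set"
    and q\<^sub>a \<alpha> :: "real^'m"
    and A :: "real \<Rightarrow> real^'m^'m" and B :: "real \<Rightarrow> real^'m"
    and Z :: "real \<Rightarrow> real \<Rightarrow> real^'m^'m"
  assumes "I \<in> intervals_from a"
    and "\<forall>i. 0 < \<alpha> $ i \<and> \<alpha> $ i \<le> 1"
    and "A \<in> Linf_loc I"
    and "B \<in> Linf_loc I"
    and "Z = RL_state_transition I A (row_constant \<alpha>)"
  shows "\<exists>q. RL_vector_solution a I \<alpha> A B q\<^sub>a q \<and>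
    (\<forall>p. RL_vector_solution a I \<alpha> A B q\<^sub>a p \<longrightarrow> (AE t in lebesgue_on I. p t = q t)) \<and>
    (AE t in lebesgue_on I.
       (\<lambda>s. Z t s *v B s) absolutely_integrable_on {a..t} \<and>
       q t = Z t a *v q\<^sub>a + (LINT s:{a..t}|lebesgue. Z t s *v B s))"
proof -
  note I = assms(1)
  note ID = intervals_fromD[OF I]
  have \<alpha>: "\<And>i. 0 < \<alpha> $ i \<and> \<alpha> $ i \<le> 1" and \<alpha>0: "\<And>i. 0 < \<alpha> $ i" using assms(2) by auto
  obtain A' where A': "\<And>i j. loc_bdd I (\<lambda>t. A' t $ i $ j)" "AE t\<in>I in lborel. A t = A' t"
    using mat_representative[OF I assms(3)] by blast
  obtain B' where B': "\<And>i. loc_bdd I (\<lambda>t. B' t $ i)" "AE t\<in>I in lborel. B t = B' t"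
    using vec_representative[OF I assms(4)] by blast
  have vB: "vec_loc_int I B'" by (rule loc_bdd_vec_loc_int[OF I B'(1)])
  let ?R = "resolvent I \<alpha> A'"
  let ?f = "forced I \<alpha> A' B'"
  define q where "q t = ?R t a *v q\<^sub>a + ?f t" for t
  \<comment> \<open>Since some state-transition matrix exists, the chosen \<open>Z\<close> is
    one.\<close>
  have "is_RL_state_transition I A (row_constant \<alpha>) Z"
    unfolding assms(5) RL_state_transition_def
    by (rule someI[of "is_RL_state_transition I A (row_constant \<alpha>)"]) (rule resolvent_is_state_transition[OF I \<alpha> A'])
  note Z = state_transition_eq_resolvent[OF I \<alpha> assms(3) A' this]
  note voc = variation_of_constants[OF I \<alpha>0 A'(1) vB, of "q\<^sub>a"]
  have sol: "RL_vector_solution a I \<alpha> A B q\<^sub>a q"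
    unfolding RL_vector_solution_iff[OF I \<alpha> A' B'] using voc
    by (intro exI[of _ q]) (simp add: q_def[abs_def])
  have uniq: "AE t in lebesgue_on I. p t = q t" if "RL_vector_solution a I \<alpha> A B q\<^sub>a p" for p
    using RL_vector_solution_unique[OF I \<alpha> assms(3,4) that sol] by (simp add: AE_lebesgue_on_iff ID(7))
  \<comment> \<open>Absolute integrability is proved along with the formula; it excludes that the
    integral is merely the default 0.\<close>
  have "AE t\<in>I in lborel. (\<lambda>s. Z t s *v B s) absolutely_integrable_on {a..t} \<and>
       q t = Z t a *v q\<^sub>a + (LINT s:{a..t}|lebesgue. Z t s *v B s)"
    using Z forced_norm_finite_AE[OF I \<alpha>0 A'(1) vB]
  proof eventually_elim
    case (elim t)
    show ?case
    proof
      assume t: "t \<in> I"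
      have int: "integrable lborel (forced_integrand I \<alpha> A' B' t)"
        using elim t by (intro forced_integrable[OF I \<alpha>0 A'(1) vB]) simp
      \<comment> \<open>The diagonal \<open>s = t\<close> is dropped as a null set: \<open>Z\<close>
        is compared with the resolvent only for \<open>s < t\<close>.\<close>
      have AE: "AE s in lborel. indicator {a..t} s *\<^sub>R (Z t s *v B s) = forced_integrand I \<alpha> A' B' t s"
        using elim(2) B'(2) AE_lborel_singleton[of t]
      proof eventually_elim
        case (elim s)
        show ?case
        proof (cases "s \<in> {a..t}")
          case True
          then have "s \<in> I" "s < t" using ID(3)[OF t] elim by auto
          then show ?thesis using elim t True by (simp add: forced_integrand_def[OF I \<alpha>0 A'(1) vB])
        next
          case False
          then have "s \<notin> I \<or> t \<le> s" using ID(2)[of s] by auto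
          then show ?thesis using False forced_integrand_zero[OF I \<alpha>0 A'(1) vB, of t s] by auto
        qed
      qed
      have "(LINT s:{a..t}|lebesgue. Z t s *v B s) = ?f t"
        using absolutely_integrable_AE_lborel(2)[OF int AE] by (simp add: forced_def[OF I \<alpha>0 A'(1) vB])
      then show "(\<lambda>s. Z t s *v B s) absolutely_integrable_on {a..t} \<and>
          q t = Z t a *v q\<^sub>a + (LINT s:{a..t}|lebesgue. Z t s *v B s)"
        using absolutely_integrable_AE_lborel(1)[OF int AE] elim t by (simp add: q_def)
    qed
  qed
  then have "AE t in lebesgue_on I. (\<lambda>s. Z t s *v B s) absolutely_integrable_on {a..t} \<and>
       q t = Z t a *v q\<^sub>a + (LINT s:{a..t}|lebesgue. Z t s *v B s)"
    unfolding AE_lebesgue_on_iff[OF ID(7)] .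
  with sol uniq show ?thesis by blast
qed

end
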